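(* Let $\mathcal{C}$ be Klein's curve, the compact Riemann surface of genus 3 given by the smooth plane projective curve $x^3y+y^3z+z^3x=0$ in $\mathbb{P}^2(\mathbb{C})$, and let $(\mathfrak{a}_1,\mathfrak{a}_2,\mathfrak{a}_3,\mathfrak{b}_1,\mathfrak{b}_2,\mathfrak{b}_3)$ be the canonical homology basis of $H_1(\mathcal{C},\mathbb{Z})$ specified in the context. For any basis $\omega_1,\omega_2,\omega_3$ of holomorphic differentials on $\mathcal{C}$, put $\mathcal{A}=\left(\oint_{\mathfrak{a}_i}\omega_j\right)_{i,j}$ and $\mathcal{B}=\left(\oint_{\mathfrak{b}_i}\omega_j\right)_{i,j}$. Then the period matrix $\tau=\mathcal{B}\mathcal{A}^{-1}$ of $\mathcal{C}$ with respect to this homology basis is $$\tau=\frac12\begin{pmatrix} e&1&1\\ 1&e&1\\ 1&1&e\end{pmatrix},\qquad e=\frac{-1+i\sqrt7}{2}.$$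
   Context: A canonical homology basis is a $\mathbb{Z}$-basis $\mathfrak{a}_1,\mathfrak{a}_2,\mathfrak{a}_3,\mathfrak{b}_1,\mathfrak{b}_2,\mathfrak{b}_3$ of $H_1(\mathcal{C},\mathbb{Z})$ with intersection numbers $\langle\mathfrak{a}_i,\mathfrak{a}_j\rangle=\langle\mathfrak{b}_i,\mathfrak{b}_j\rangle=0$ and $\langle\mathfrak{a}_i,\mathfrak{b}_j\rangle=\delta_{ij}$. The period matrix $\tau=\mathcal{B}\mathcal{A}^{-1}$ does not depend on the choice of basis of holomorphic differentials. Coordinates. Let $\rho=\exp(2\pi i/3)$. The affine form of Klein's curve, with $(x,y)\leftrightarrow[x,y,1]$, is $x^3y+y^3+x=0$. The birational map $(x,y)\mapsto(t,s)=\left(1+\frac{x^3}{y^2},-\frac{x}{y}\right)$, with inverse $(t,s)\mapsto(x,y)=\left(\frac{t-1}{s^2},\frac{1-t}{s^3}\right)$, identifies it with $s^7=t(t-1)^2$. The further map $(t,s)\mapsto(z,w)=\left(\frac{t+\rho^2}{\rho t+\rho^2},\frac{s(\rho^2-1)}{\rho t+\rho^2}\right)$, with inverse $(z,w)\mapsto(t,s)=\left(\frac{\rho^2(z-1)}{1-\rho z},\frac{w}{1-\rho z}\right)$, identifies this with the curve $$w^7=(z-1)(z-\rho)^2(z-\rho^2)^4 .$$ (Here $z$ is a new affine coordinate, not the homogeneous coordinate of $\mathbb{P}^2$.) Thus $\mathcal{C}$ is the compact Riemann surface of this curve, and $z:\mathcal{C}\to\mathbb{P}^1$ is a degree 7 covering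 branched exactly over $1,\rho,\rho^2$. Sheets. For $k=0,\dots,6$, sheet $k$ at the base point $z=0$ is the point $(z,w)=\left(0,\exp\left[\pi i(6k-1)/21\right]\right)$. Continuation along a loop based at $z=0$ that goes once in the positive (anticlockwise) direction around a branch point sends sheet $k$ to sheet $k+1$, $k+2$, $k+4\pmod 7$ for the branch point $1$, $\rho$, $\rho^2$ respectively. Here the loop around a branch point $p$ goes from $0$ along the straight segment towards $p$, around $p$ on a small circle, and back along the segment. Order 3 automorphism. Let $\sigma$ be the automorphism of $\mathcal{C}$ induced by $[x,y,z]\mapsto[y,z,x]$, i.e. $(x,y)\mapsto\left(\frac{y}{x},\frac1x\right)$. In the $(z,w)$ coordinates it is $$(z,w)\mapsto\left(\rho^2z,\ \frac{\rho^2(z-1)(z-\rho)(z-\rho^2)^2}{w^3}\right).$$ The homology basis. - $\mathfrak{a}_1$ is the class of the closed path on $\mathcal{C}$ that starts over $z=0$ on sheet $0$ and is the lift of the path going clockwise 3 times around $z=1$ and then clockwise 1 time around $z=\rho^2$ (by loops based at $0$, where the loop around a branch point $p$ goes from $0$ along the straight segment towards $p$, around $p$ on a small circle, and back along the segment to $0$). - $\mathfrak{b}_1$ is the class of the lift of the same path starting on sheet $2$. - $\mathfrak{a}_2=\sigma_*\mathfrak{a}_1$, $\mathfrak{a}_3=\sigma_*\mathfrak{a}_2$, $\mathfrak{b}_2=\sigma_*\mathfrak{b}_1$, $\mathfrak{b}_3=\sigma_*\mathfrak{b}_2$. These six cycles form a canonical homology basis. *)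

theory Defs
  imports "HOL-Analysis.Analysis" "HOL-Homology.Homology"
begin

section \<open>The complex projective plane and Klein's curve\<close>

text \<open>The point with homogeneous coordinates \<open>v \<noteq> 0\<close> is the set of all its homogeneous coordinate
  vectors.\<close>

type_synonym ppoint = "(complex ^ 3) set"

definition hpt :: "complex ^ 3 \<Rightarrow> ppoint" where
  "hpt v = {c *s v | c. c \<noteq> 0}"

definition proj_plane :: "ppoint set" where
  "proj_plane = hpt ` (- {0})"

text \<open>The quotient topology of \<open>hpt\<close> on the nonzero vectors.\<close>

definition proj_plane_topology :: "ppoint topology" where
  "proj_plane_topology = topology (\<lambda>U. U \<subseteq> proj_plane \<and> open {v. v \<noteq> 0 \<and> hpt v \<in> U})"

lemma openin_proj_plane_topology:
  "openin proj_plane_topology U \<longleftrightarrow> U \<subseteq> proj_plane \<and> open {v. v \<noteq> 0 \<and> hpt v \<in> U}"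
proof -
  have inter: "{v. v \<noteq> 0 \<and> hpt v \<in> S \<inter> T} =
      {v. v \<noteq> 0 \<and> hpt v \<in> S} \<inter> {v. v \<noteq> 0 \<and> hpt v \<in> T}" for S T
    by auto
  have union: "{v. v \<noteq> 0 \<and> hpt v \<in> \<Union>K} = (\<Union>S\<in>K. {v. v \<noteq> 0 \<and> hpt v \<in> S})" for K
    by auto
  have "istopology (\<lambda>U. U \<subseteq> proj_plane \<and> open {v. v \<noteq> 0 \<and> hpt v \<in> U})"
    unfolding istopology_def inter union by (auto intro!: open_Int open_UN)
  then show ?thesis
    by (simp add: proj_plane_topology_def topology_inverse')
qed

definition klein_curve :: "ppoint set" where
  "klein_curve = {hpt v | v. v \<noteq> 0 \<and>
     (v $ 1) ^ 3 * v $ 2 + (v $ 2) ^ 3 * v $ 3 + (v $ 3) ^ 3 * v $ 1 = 0}"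

definition klein_top :: "ppoint topology" where
  "klein_top = subtopology proj_plane_topology klein_curve"


section \<open>Holomorphic differentials\<close>

text \<open>A holomorphic parametrization is the inverse \<open>\<phi>\<close>, defined on \<open>D\<close>, of a holomorphic chart of
  the Riemann surface.  Since the curve is smooth, every injective holomorphic map from an open
  subset of the complex plane to the curve is biholomorphic onto an open subset of the curve, so
  that no separate condition on the inverse map is needed.\<close>

definition klein_param :: "complex set \<Rightarrow> (complex \<Rightarrow> ppoint) \<Rightarrow> bool" where
  "klein_param D \<phi> \<longleftrightarrow> open D \<and> inj_on \<phi> D \<and> \<phi> ` D \<subseteq> klein_curve \<and>
     (\<exists>X :: complex \<Rightarrow> complex ^ 3. (\<forall>i. (\<lambda>u. X u $ i) holomorphic_on D) \<and>
        (\<forall>u\<in>D. X u \<noteq> 0 \<and> \<phi> u = hpt (X u)))"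

text \<open>A differential is given by its coefficient with respect to \<open>du\<close> in every parametrization,
  subject to the transformation law \<open>f du = (g \<circ> h) h' du\<close> under holomorphic changes \<open>h\<close> of the
  parameter (which include restrictions).  Coefficients are 0 where they carry no meaning, so that
  two differentials are equal if and only if they are equal as functions.\<close>

type_synonym differential = "complex set \<Rightarrow> (complex \<Rightarrow> ppoint) \<Rightarrow> complex \<Rightarrow> complex"

definition holomorphic_differentials :: "differential set" where
  "holomorphic_differentials = {\<omega>.
     (\<forall>D \<phi>. klein_param D \<phi> \<longrightarrow> \<omega> D \<phi> holomorphic_on D) \<and>
     (\<forall>D \<phi> E \<psi> h. klein_param D \<phi> \<longrightarrow> klein_param E \<psi> \<longrightarrow>
        h holomorphic_on D \<longrightarrow> h ` D \<subseteq> E \<longrightarrow> (\<forall>u\<in>D. \<phi> u = \<psi> (h u)) \<longrightarrow>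
        (\<forall>u\<in>D. \<omega> D \<phi> u = \<omega> E \<psi> (h u) * deriv h u)) \<and>
     (\<forall>D \<phi> u. \<not> (klein_param D \<phi> \<and> u \<in> D) \<longrightarrow> \<omega> D \<phi> u = 0)}"

definition differential_basis :: "(3 \<Rightarrow> differential) \<Rightarrow> bool" where
  "differential_basis \<omega> \<longleftrightarrow>
     (\<forall>j. \<omega> j \<in> holomorphic_differentials) \<and>
     (\<forall>c :: 3 \<Rightarrow> complex. (\<forall>D \<phi> u. (\<Sum>j\<in>UNIV. c j * \<omega> j D \<phi> u) = 0) \<longrightarrow> (\<forall>j. c j = 0)) \<and>
     (\<forall>\<eta>\<in>holomorphic_differentials. \<exists>c :: 3 \<Rightarrow> complex.
        \<forall>D \<phi> u. \<eta> D \<phi> u = (\<Sum>j\<in>UNIV. c j * \<omega> j D \<phi> u))"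


section \<open>Integration over paths and homology classes\<close>

definition local_primitive :: "differential \<Rightarrow> ppoint set \<Rightarrow> (ppoint \<Rightarrow> complex) \<Rightarrow> bool" where
  "local_primitive \<omega> V g \<longleftrightarrow> openin klein_top V \<and>
     (\<forall>D \<phi> u. klein_param D \<phi> \<longrightarrow> \<phi> ` D \<subseteq> V \<longrightarrow> u \<in> D \<longrightarrow>
        ((\<lambda>u. g (\<phi> u)) has_field_derivative \<omega> D \<phi> u) (at u))"

text \<open>The integral of a holomorphic (hence closed) differential along a continuous path \<open>\<gamma>\<close> on
  \<open>[0, 1]\<close> is the increment of a primitive \<open>F\<close> along \<open>\<gamma>\<close>, i.e. of a function that near each
  parameter \<open>t\<close> has the form \<open>g \<circ> \<gamma>\<close> with \<open>g\<close> a primitive of the differential near \<open>\<gamma> t\<close>.  For piecewise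
  continuously differentiable \<open>\<gamma>\<close> it is the usual line integral.  Arbitrary continuous paths
  are needed because singular homology is built from them.\<close>

definition has_path_integral :: "differential \<Rightarrow> (real \<Rightarrow> ppoint) \<Rightarrow> complex \<Rightarrow> bool" where
  "has_path_integral \<omega> \<gamma> I \<longleftrightarrow>
     (\<exists>F :: real \<Rightarrow> complex.
        (\<forall>t\<in>{0..1}. \<exists>V g e. local_primitive \<omega> V g \<and> \<gamma> t \<in> V \<and> e > 0 \<and>
           (\<forall>s\<in>{0..1}. \<bar>s - t\<bar> < e \<longrightarrow> \<gamma> s \<in> V \<and> F s = g (\<gamma> s))) \<and>
        I = F 1 - F 0)"

definition path_integral :: "differential \<Rightarrow> (real \<Rightarrow> ppoint) \<Rightarrow> complex" where
  "path_integral \<omega> \<gamma> = (THE I. has_path_integral \<omega> \<gamma> I)"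

text \<open>A singular 1-simplex and the path running through it from vertex 0 to vertex 1; with this
  orientation the library's boundary of a simplex is the end point minus the starting point of the
  path.\<close>

definition path_of_simplex :: "((nat \<Rightarrow> real) \<Rightarrow> 'a) \<Rightarrow> real \<Rightarrow> 'a" where
  "path_of_simplex s = (\<lambda>t. s (\<lambda>i. if i = 0 then 1 - t else if i = 1 then t else 0))"

definition simplex_of_path :: "(real \<Rightarrow> 'a) \<Rightarrow> (nat \<Rightarrow> real) \<Rightarrow> 'a" where
  "simplex_of_path \<gamma> = restrict (\<lambda>x. \<gamma> (x 1)) (standard_simplex 1)"

definition chain_integral :: "differential \<Rightarrow> ppoint chain \<Rightarrow> complex" where
  "chain_integral \<omega> c =
     (\<Sum>s\<in>Poly_Mapping.keys c.
        of_int (Poly_Mapping.lookup c s) * path_integral \<omega> (path_of_simplex s))"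

text \<open>Elements of \<open>homology_group 1 klein_top\<close> are sets of homologous cycles; the integral over a class
  is the common value of the integrals over these cycles.\<close>

definition period :: "differential \<Rightarrow> ppoint chain set \<Rightarrow> complex" where
  "period \<omega> \<alpha> = (THE I. \<forall>c\<in>\<alpha>. chain_integral \<omega> c = I)"

definition loop_class :: "(real \<Rightarrow> ppoint) \<Rightarrow> ppoint chain set" where
  "loop_class \<gamma> = homologous_rel_set 1 klein_top {} (frag_of (simplex_of_path \<gamma>))"

definition period_entries ::
    "(3 \<Rightarrow> differential) \<Rightarrow> (3 \<Rightarrow> ppoint chain set) \<Rightarrow> complex ^ 3 ^ 3" where
  "period_entries \<omega> \<alpha> = (\<chi> i j. period (\<omega> j) (\<alpha> i))"


section \<open>The covering of the sphere by the coordinate \<open>z\<close>\<close>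

definition rho :: complex where
  "rho = exp (2 * of_real pi * \<i> / 3)"

text \<open>Off the branch points, the point \<open>(z, w)\<close> of \<open>w^7 = (z - 1) (z - \<rho>)^2 (z - \<rho>^2)^4\<close> corresponds to
  \<open>(t, s) = (\<rho>^2 (z - 1) / (1 - \<rho> z), w / (1 - \<rho> z))\<close> on \<open>s^7 = t (t - 1)^2\<close> and to
  \<open>(x, y) = ((t - 1) / s^2, (1 - t) / s^3)\<close> on \<open>x^3 y + y^3 + x = 0\<close>.\<close>

definition klein_pt :: "complex \<Rightarrow> complex \<Rightarrow> ppoint" where
  "klein_pt z w =
     (let t = rho ^ 2 * (z - 1) / (1 - rho * z);
          s = w / (1 - rho * z);
          x = (t - 1) / s ^ 2;
          y = (1 - t) / s ^ 3
      in hpt (vector [x, y, 1]))"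

definition klein_fibre :: "complex \<Rightarrow> ppoint set" where
  "klein_fibre z = {klein_pt z w | w. w ^ 7 = (z - 1) * (z - rho) ^ 2 * (z - rho ^ 2) ^ 4}"

definition sheet :: "nat \<Rightarrow> ppoint" where
  "sheet k = klein_pt 0 (exp (of_real pi * \<i> * (6 * of_nat k - 1) / 21))"

text \<open>For a branch point \<open>p\<close>, so that \<open>cmod p = 1\<close>, and \<open>0 < r < 1\<close>: the segment from 0 towards \<open>p\<close>, the
  clockwise circle of radius \<open>r\<close> about \<open>p\<close>, and the segment back to 0.\<close>

definition clockwise_loop :: "real \<Rightarrow> complex \<Rightarrow> real \<Rightarrow> complex" where
  "clockwise_loop r p =
     linepath 0 (p * of_real (1 - r)) +++
     (\<lambda>u. p * (1 - of_real r * exp (- 2 * of_real pi * \<i> * of_real u))) +++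
     linepath (p * of_real (1 - r)) 0"

definition base_path :: "real \<Rightarrow> real \<Rightarrow> complex" where
  "base_path r =
     clockwise_loop r 1 +++ clockwise_loop r 1 +++ clockwise_loop r 1 +++ clockwise_loop r (rho ^ 2)"

definition is_lift :: "(real \<Rightarrow> complex) \<Rightarrow> nat \<Rightarrow> (real \<Rightarrow> ppoint) \<Rightarrow> bool" where
  "is_lift p k \<gamma> \<longleftrightarrow> pathin klein_top \<gamma> \<and> (\<forall>u\<in>{0..1}. \<gamma> u \<in> klein_fibre (p u)) \<and> \<gamma> 0 = sheet k"

text \<open>The lift is unique as a path on \<open>[0, 1]\<close>; the choice only concerns its values elsewhere.\<close>

definition lift_class :: "real \<Rightarrow> nat \<Rightarrow> ppoint chain set" where
  "lift_class r k = loop_class (SOME \<gamma>. is_lift (base_path r) k \<gamma>)"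


section \<open>The homology basis\<close>

text \<open>The automorphism \<open>[x, y, z] \<mapsto> [y, z, x]\<close> and the map it induces on the first homology group.\<close>

definition klein_sigma :: "ppoint \<Rightarrow> ppoint" where
  "klein_sigma P = (\<lambda>v. vector [v $ 2, v $ 3, v $ 1]) ` P"

definition sigma_star :: "ppoint chain set \<Rightarrow> ppoint chain set" where
  "sigma_star = hom_induced 1 klein_top {} klein_top {} klein_sigma"

definition sigma_orbit :: "ppoint chain set \<Rightarrow> 3 \<Rightarrow> ppoint chain set" where
  "sigma_orbit \<alpha> i =
     (if i = 1 then \<alpha> else if i = 2 then sigma_star \<alpha> else sigma_star (sigma_star \<alpha>))"

definition a_cycles :: "real \<Rightarrow> 3 \<Rightarrow> ppoint chain set" where
  "a_cycles r = sigma_orbit (lift_class r 0)"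

definition b_cycles :: "real \<Rightarrow> 3 \<Rightarrow> ppoint chain set" where
  "b_cycles r = sigma_orbit (lift_class r 2)"

end

theory Submission
  imports Defs "HOL-Complex_Analysis.Cauchy_Integral_Formula"
begin

text \<open>
  The map \<open>(u, c) \<mapsto> [- u c\<^sup>3, c, u\<^sup>3]\<close> from the Fermat curve \<open>u\<^sup>7 + c\<^sup>7 = 1\<close> to Klein's curve is a quotient
  map.  With the principal root \<open>c = (1 - u\<^sup>7)\<^sup>1\<^sup>/\<^sup>7\<close> it becomes an injective map of \<open>u\<close> in the plane slit along
  the rays \<open>u\<^sup>7 \<ge> 1\<close>, a chart in which \<open>t = u\<^sup>7\<close>.  The chart and its images under the order 3 automorphism \<open>\<sigma>\<close> cover
  the curve.  The slit plane is starlike, so every holomorphic differential has a primitive on each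
  of the three charts.  Hence integrals along continuous paths exist and are unique
  (\<open>local_primitive_exists\<close>, \<open>local_primitive_unique\<close>), a subdivision of triangles as in Goursat's
  lemma shows that they vanish on boundaries of singular 2-simplices (\<open>J_triangle\<close>), and the period
  over the class of a loop is the integral along the loop (\<open>period_loop_class\<close>).

  The residue form \<open>\<Omega> = (X \<times> dX) / \<nabla>F\<close> yields the three holomorphic differentials \<open>\<eta>\<^sub>j = X\<^sub>j \<Omega>\<close>, with
  \<open>\<Omega> = du / c\<^sup>6\<close> in the chart.  The automorphism \<open>\<sigma>\<close> permutes them cyclically, and \<open>u \<mapsto> \<zeta> u\<close> with
  \<open>\<zeta> = exp (2 \<pi> i / 7)\<close> multiplies them by \<open>\<zeta>\<^sup>2\<close>, \<open>\<zeta>\<close>, \<open>\<zeta>\<^sup>4\<close>.  Let \<open>G\<^sub>j\<close> be the primitive of \<open>\<eta>\<^sub>j\<close> with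
  \<open>G\<^sub>j(0) = 0\<close>, and \<open>x\<^sub>j = G\<^sub>j(b)\<close> for \<open>b = exp (\<pi> i / 21)\<close>; the point \<open>u = \<zeta>\<^sup>k b\<close> lies on sheet \<open>k\<close> over \<open>z = 0\<close>.
  The loops about \<open>1\<close> lift to paths in the chart, the loop about \<open>\<rho>\<^sup>2\<close> to a path in the next chart, and
  both have explicit end points (\<open>lift_path_integral\<close>).  With
    \<open>D\<^sub>1 = x\<^sub>1 - \<zeta> x\<^sub>2\<close>,  \<open>D\<^sub>2 = x\<^sub>2 - \<zeta>\<^sup>4 x\<^sub>3\<close>,  \<open>D\<^sub>3 = x\<^sub>3 - \<zeta>\<^sup>2 x\<^sub>1\<close>
  the integrals over \<open>\<aa>\<^sub>1\<close> are \<open>p\<^sub>1 = (\<zeta> - 1) D\<^sub>1\<close>, \<open>p\<^sub>2 = (\<zeta>\<^sup>4 - 1) D\<^sub>2\<close>, \<open>p\<^sub>3 = (\<zeta>\<^sup>2 - 1) D\<^sub>3\<close>, those over \<open>\<bb>\<^sub>1\<close> are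
  \<open>\<zeta>\<^sup>4 p\<^sub>1\<close>, \<open>\<zeta>\<^sup>2 p\<^sub>2\<close>, \<open>\<zeta> p\<^sub>3\<close> (\<open>lift_integrals\<close>), and the other rows of the two period matrices are cyclic
  shifts of these.

  The point is that the transcendental numbers \<open>D\<^sub>j\<close> have algebraic ratios.  They satisfy two linear
  relations: \<open>D\<^sub>1 + \<zeta> D\<^sub>2 + \<zeta>\<^sup>5 D\<^sub>3 = 0\<close>, which says that \<open>x\<^sub>1\<close>, \<open>\<zeta> x\<^sub>2\<close>, \<open>\<zeta>\<^sup>5 x\<^sub>3\<close> are the corners of a
  triangle, and \<open>D\<^sub>1 + D\<^sub>2 + D\<^sub>3 = 0\<close>, the same statement for the point \<open>z = \<infinity>\<close> in place of \<open>z = 0\<close>.  The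
  latter comes from continuing the primitives across the three arcs into which the branch points cut
  the unit circle, where two charts overlap (\<open>crossing_relation\<close>).  The relations determine the \<open>D\<^sub>j\<close>
  up to a common factor, which is not zero because \<open>Im x\<^sub>1 < 0 < Im (\<zeta> x\<^sub>2)\<close> (\<open>prim_1_2_distinct\<close>).  As
  \<open>e\<close> is the Gauss period \<open>\<zeta> + \<zeta>\<^sup>2 + \<zeta>\<^sup>4\<close>, the equation \<open>\<B> = \<tau> \<A>\<close> is then an identity between polynomials
  in \<open>\<zeta>\<close> (\<open>lift_periods_2\<close>).

  For another basis \<open>\<omega>\<close> the \<open>\<eta>\<^sub>j\<close> are linear combinations of the \<open>\<omega>\<^sub>k\<close>, so both period matrices of \<open>\<eta>\<close> arise
  from those of \<open>\<omega>\<close> by multiplication with one matrix.  It is invertible since \<open>\<A>\<close> is invertible for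
  \<open>\<eta>\<close>, and it cancels in \<open>\<B> \<A>\<^sup>-\<^sup>1\<close>.
\<close>

section \<open>Homogeneous coordinates on Klein's curve\<close>

lemma three_cases: fixes i :: 3 obtains "i = 0" | "i = 1" | "i = 2"
proof -
  have "(3::3) = 0" by simp
  then show ?thesis using exhaust_3[of i] that by metis
qed

lemma three_numerals [simp]: "(4::3) = 1" "(5::3) = 2"
  by simp_all

lemma three_eq_0: "(3::3) = 0"
  by simp

lemma three_add [simp]: "3 + i = i" "i + 3 = i" for i :: 3
  by (simp_all add: three_eq_0)

lemma hpt_eqI: "c \<noteq> 0 \<Longrightarrow> hpt (c *s v) = hpt v"
proof -
  assume c: "c \<noteq> 0"
  have "\<exists>d. d *s v = e *s (c *s v) \<and> d \<noteq> 0" if "e \<noteq> 0" for e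
    using that c by (intro exI[of _ "e * c"]) (auto simp: vector_smult_assoc)
  moreover have "\<exists>d. e *s v = d *s (c *s v) \<and> d \<noteq> 0" if "e \<noteq> 0" for e
    using that c by (intro exI[of _ "e / c"]) (auto simp: vector_smult_assoc)
  ultimately show ?thesis
    unfolding hpt_def by (auto simp: vector_smult_assoc) metis+
qed

lemma hpt_eq_iff: "hpt v = hpt w \<longleftrightarrow> (\<exists>c. c \<noteq> 0 \<and> v = c *s w)"
proof
  assume "hpt v = hpt w"
  moreover have "v \<in> hpt v"
    unfolding hpt_def by (auto intro!: exI[of _ 1])
  ultimately show "\<exists>c. c \<noteq> 0 \<and> v = c *s w"
    unfolding hpt_def by auto
qed (auto simp: hpt_eqI)

definition klein_form :: "complex ^ 3 \<Rightarrow> complex" where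
  "klein_form v = (\<Sum>k\<in>UNIV. (v $ k) ^ 3 * v $ (k + 1))"

lemma klein_form_3: "klein_form v = (v $ 1) ^ 3 * v $ 2 + (v $ 2) ^ 3 * v $ 3 + (v $ 3) ^ 3 * v $ 1"
  by (simp add: klein_form_def sum_3)

lemma klein_form_scale: "klein_form (c *s v) = c ^ 4 * klein_form v"
  by (simp add: klein_form_3 algebra_simps power_mult_distrib power_numeral_reduce)

lemma hpt_in_klein_curve: "v \<noteq> 0 \<Longrightarrow> hpt v \<in> klein_curve \<longleftrightarrow> klein_form v = 0"
proof
  assume "v \<noteq> 0" "hpt v \<in> klein_curve"
  then obtain w where "hpt v = hpt w" "klein_form w = 0"
    unfolding klein_curve_def klein_form_3 by auto
  then show "klein_form v = 0"
    by (auto simp: hpt_eq_iff klein_form_scale)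
qed (auto simp: klein_curve_def klein_form_3)

lemma klein_curve_cases:
  assumes "P \<in> klein_curve"
  obtains v where "v \<noteq> 0" "klein_form v = 0" "P = hpt v"
  using assms unfolding klein_curve_def klein_form_3 by auto

lemma klein_curve_subset_plane: "klein_curve \<subseteq> proj_plane"
  unfolding klein_curve_def proj_plane_def by auto

lemma topspace_proj_plane: "topspace proj_plane_topology = proj_plane"
proof -
  have "openin proj_plane_topology proj_plane"
  proof -
    have "{v. v \<noteq> 0 \<and> hpt v \<in> proj_plane} = - {0}"
      by (auto simp: proj_plane_def)
    then show ?thesis by (simp add: openin_proj_plane_topology open_Compl)
  qed
  then show ?thesis
    by (meson openin_proj_plane_topology openin_subset openin_topspace subset_antisym)
qed

lemma topspace_klein: "topspace klein_top = klein_curve"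
  unfolding klein_top_def using klein_curve_subset_plane
  by (auto simp: topspace_proj_plane)

text \<open>The only access to the quotient topology: open sets of the curve are given by open conditions on
  homogeneous coordinates.\<close>

lemma openin_klein_top_coordinates:
  assumes op: "open {v. v \<noteq> 0 \<and> Q v}"
    and inv: "\<And>c v. c \<noteq> 0 \<Longrightarrow> v \<noteq> 0 \<Longrightarrow> Q v \<Longrightarrow> Q (c *s v)"
  shows "openin klein_top {hpt v | v. v \<noteq> 0 \<and> klein_form v = 0 \<and> Q v}"
proof -
  let ?U = "{hpt v | v. v \<noteq> 0 \<and> Q v}"
  have "{v. v \<noteq> 0 \<and> hpt v \<in> ?U} = {v. v \<noteq> 0 \<and> Q v}"
    using inv by (auto simp: hpt_eq_iff) (metis one_neq_zero vector_smult_lid)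
  then have "openin proj_plane_topology ?U"
    using op by (auto simp: openin_proj_plane_topology proj_plane_def)
  moreover have "{hpt v | v. v \<noteq> 0 \<and> klein_form v = 0 \<and> Q v} = ?U \<inter> klein_curve"
    using hpt_in_klein_curve by auto
  ultimately show ?thesis
    unfolding klein_top_def openin_subtopology by blast
qed

lemma continuous_map_hpt:
  fixes X :: "'a::topological_space \<Rightarrow> complex ^ 3"
  assumes "continuous_on D X" and nz: "\<And>u. u \<in> D \<Longrightarrow> X u \<noteq> 0"
    and "\<And>u. u \<in> D \<Longrightarrow> klein_form (X u) = 0"
  shows "continuous_map (top_of_set D) klein_top (\<lambda>u. hpt (X u))"
  unfolding klein_top_def continuous_map_in_subtopology
proof
  show "continuous_map (top_of_set D) proj_plane_topology (\<lambda>u. hpt (X u))"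
    unfolding continuous_map
  proof (intro conjI allI impI)
    show "(\<lambda>u. hpt (X u)) ` topspace (top_of_set D) \<subseteq> topspace proj_plane_topology"
      using nz by (auto simp: topspace_proj_plane proj_plane_def)
  next
    fix U assume "openin proj_plane_topology U"
    then have "open {v. v \<noteq> 0 \<and> hpt v \<in> U}"
      by (simp add: openin_proj_plane_topology)
    then have "openin (top_of_set D) (D \<inter> X -` {v. v \<noteq> 0 \<and> hpt v \<in> U})"
      using assms(1) continuous_openin_preimage_gen by blast
    also have "D \<inter> X -` {v. v \<noteq> 0 \<and> hpt v \<in> U} = {x \<in> topspace (top_of_set D). hpt (X x) \<in> U}"
      using nz by auto
    finally show "openin (top_of_set D) {x \<in> topspace (top_of_set D). hpt (X x) \<in> U}" .
  qed
  show "(\<lambda>u. hpt (X u)) \<in> topspace (top_of_set D) \<rightarrow> klein_curve"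
    using assms by (auto simp: hpt_in_klein_curve)
qed

text \<open>The index type \<open>3\<close> is the integers modulo 3, so that \<open>k + i\<close> rotates the coordinates and \<open>rot i\<close>
  induces the \<open>i\<close>-th power of the order 3 automorphism.\<close>

definition rot :: "3 \<Rightarrow> complex ^ 3 \<Rightarrow> complex ^ 3" where
  "rot i v = (\<chi> k. v $ (k + i))"

lemma rot_nth [simp]: "rot i v $ k = v $ (k + i)"
  by (simp add: rot_def)

lemma rot_0 [simp]: "rot 0 v = v"
  by (simp add: rot_def)

lemma rot_rot: "rot i (rot j v) = rot (i + j) v"
  by (simp add: vec_eq_iff ac_simps)

lemma rot_scale: "rot i (c *s v) = c *s rot i v"
  by (simp add: vec_eq_iff)

lemma rot_eq_0_iff [simp]: "rot i v = 0 \<longleftrightarrow> v = 0"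
proof
  assume "rot i v = 0"
  then have "rot (-i) (rot i v) = 0" by (simp add: rot_def vec_eq_iff)
  then show "v = 0" by (simp add: rot_rot)
qed (simp add: rot_def vec_eq_iff)

lemma klein_form_rot [simp]: "klein_form (rot i v) = klein_form v"
  by (cases i rule: three_cases) (simp_all add: klein_form_3)

lemma klein_sigma_hpt: "klein_sigma (hpt v) = hpt (rot 1 v)"
proof -
  have eq: "(\<lambda>v. vector [v $ 2, v $ 3, v $ 1]) = rot 1"
    by (rule ext) (simp add: vec_eq_iff forall_3)
  show ?thesis
    unfolding klein_sigma_def hpt_def eq by (auto simp: rot_scale image_iff) (metis rot_scale)
qed

lemma continuous_on_rot [continuous_intros]:
  "continuous_on S f \<Longrightarrow> continuous_on S (\<lambda>x. rot i (f x))"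
  unfolding rot_def by (intro continuous_intros)

lemma continuous_map_klein_sigma: "continuous_map klein_top klein_top klein_sigma"
  unfolding continuous_map
proof (intro conjI allI impI)
  show "klein_sigma ` topspace klein_top \<subseteq> topspace klein_top"
    by (auto simp: topspace_klein hpt_in_klein_curve klein_sigma_hpt elim!: klein_curve_cases)
next
  fix U assume "openin klein_top U"
  then obtain T where T: "openin proj_plane_topology T" "U = T \<inter> klein_curve"
    by (auto simp: klein_top_def openin_subtopology)
  let ?Q = "\<lambda>v. hpt (rot 1 v) \<in> T"
  have "open (rot 1 -` {v. v \<noteq> 0 \<and> hpt v \<in> T})"
    using T by (intro open_vimage continuous_intros) (auto simp: openin_proj_plane_topology)
  moreover have "rot 1 -` {v. v \<noteq> 0 \<and> hpt v \<in> T} = {v. v \<noteq> 0 \<and> ?Q v}"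
    by auto
  ultimately have "openin klein_top {hpt v | v. v \<noteq> 0 \<and> klein_form v = 0 \<and> ?Q v}"
    by (intro openin_klein_top_coordinates) (simp_all add: rot_scale hpt_eqI)
  also have "{hpt v | v. v \<noteq> 0 \<and> klein_form v = 0 \<and> ?Q v} = {x \<in> topspace klein_top. klein_sigma x \<in> U}"
    by (auto simp: T topspace_klein klein_sigma_hpt hpt_in_klein_curve elim!: klein_curve_cases) 
  finally show "openin klein_top {x \<in> topspace klein_top. klein_sigma x \<in> U}" .
qed

section \<open>The charts\<close>

text \<open>In terms of \<open>t = u\<^sup>7\<close> this is the complement of the ray from the branch value \<open>1\<close> to the branch value
  \<open>\<infinity>\<close>.\<close>

definition slit_domain :: "complex set" where
  "slit_domain = {u. 1 - u ^ 7 \<notin> \<real>\<^sub>\<le>\<^sub>0}"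

definition croot :: "complex \<Rightarrow> complex" where
  "croot u = exp (Ln (1 - u ^ 7) / 7)"

lemma croot_nonzero [simp]: "croot u \<noteq> 0"
  by (simp add: croot_def)

lemma exp_div_7_power: "exp (z / 7) ^ 7 = exp (z::complex)"
  by (simp flip: exp_of_nat_mult)

lemma slit_domain_nz: "u \<in> slit_domain \<Longrightarrow> 1 - u ^ 7 \<noteq> 0"
  by (auto simp: slit_domain_def)

lemma croot_power: "u \<in> slit_domain \<Longrightarrow> croot u ^ 7 = 1 - u ^ 7"
  using slit_domain_nz[of u] unfolding croot_def exp_div_7_power by (auto simp: exp_Ln)

lemma open_slit_domain: "open slit_domain"
proof -
  have "slit_domain = (\<lambda>u. 1 - u ^ 7) -` (- \<real>\<^sub>\<le>\<^sub>0)"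
    by (auto simp: slit_domain_def)
  then show ?thesis
    using open_vimage[of "- \<real>\<^sub>\<le>\<^sub>0" "\<lambda>u::complex. 1 - u ^ 7"]
    by (simp add: open_Compl continuous_intros)
qed

lemma zero_in_slit_domain: "0 \<in> slit_domain"
  by (simp add: slit_domain_def)

text \<open>Holomorphic functions on starlike domains have primitives.\<close>

lemma starlike_slit_domain: "starlike slit_domain"
  unfolding starlike_def
proof (intro bexI[of _ 0] ballI subsetI zero_in_slit_domain)
  fix u z assume u: "u \<in> slit_domain" and "z \<in> closed_segment 0 u"
  then obtain a where a: "0 \<le> a" "a \<le> 1" "z = a *\<^sub>R u"
    by (auto simp: closed_segment_def)
  show "z \<in> slit_domain"
  proof (rule ccontr)
    assume "z \<notin> slit_domain"
    then have "1 - z ^ 7 \<in> \<real>\<^sub>\<le>\<^sub>0"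
      by (simp add: slit_domain_def)
    then have im: "Im (z ^ 7) = 0" and re: "Re (z ^ 7) \<ge> 1"
      by (auto simp: complex_nonpos_Reals_iff)
    have z7: "z ^ 7 = of_real (a ^ 7) * u ^ 7"
      by (simp add: a scaleR_conv_of_real power_mult_distrib)
    have a7: "a ^ 7 \<le> 1" "0 \<le> a ^ 7" "a ^ 7 \<noteq> 0" 
      using a re z7 by (auto simp: power_le_one)
    have "Im (u ^ 7) = 0"
      using im a7 by (simp add: z7)
    moreover have "Re (u ^ 7) \<ge> 1"
    proof -
      have "1 \<le> a ^ 7 * Re (u ^ 7)" using re by (simp add: z7)
      moreover from this have "Re (u ^ 7) \<ge> 0"
        using a7 by (smt (verit) mult_nonneg_nonpos)
      ultimately show ?thesis
        using a7 by (smt (verit) mult_left_le_one_le)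
    qed
    ultimately show False
      using u by (auto simp: slit_domain_def complex_nonpos_Reals_iff)
  qed
qed

lemma connected_slit_domain: "connected slit_domain"
  using starlike_imp_connected[OF starlike_slit_domain] .

lemma has_field_derivative_croot:
  assumes "u \<in> slit_domain"
  shows "(croot has_field_derivative - (u ^ 6) / croot u ^ 6) (at u)"
proof -
  have "(croot has_field_derivative (exp (Ln (1 - u ^ 7) / 7) * (- (7 * u ^ 6) / (1 - u ^ 7) / 7))) (at u)"
    unfolding croot_def using assms
    by (auto intro!: derivative_eq_intros simp: slit_domain_def)
       (simp add: divide_simps)
  also have "exp (Ln (1 - u ^ 7) / 7) * (- (7 * u ^ 6) / (1 - u ^ 7) / 7) = - (u ^ 6) / croot u ^ 6"
    unfolding croot_def[symmetric] unfolding croot_power[OF assms, symmetric]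
    by (simp add: divide_simps) (simp add: power_numeral_reduce)
  finally show ?thesis .
qed

lemma holomorphic_on_croot [holomorphic_intros]: "croot holomorphic_on slit_domain"
  by (meson has_field_derivative_croot holomorphic_on_open open_slit_domain)

text \<open>With \<open>c\<close> for \<open>croot u\<close>, the equation of Klein's curve at \<open>[- u c\<^sup>3, c, u\<^sup>3]\<close> is \<open>u\<^sup>3 c\<^sup>3 (1 - u\<^sup>7 - c\<^sup>7) = 0\<close>.\<close>

definition chart_vec :: "complex \<Rightarrow> complex ^ 3" where
  "chart_vec u = vector [- u * croot u ^ 3, croot u, u ^ 3]"

lemma chart_vec_nth [simp]:
  "chart_vec u $ 1 = - u * croot u ^ 3" "chart_vec u $ 2 = croot u" "chart_vec u $ 3 = u ^ 3"
  "chart_vec u $ 0 = u ^ 3"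
proof -
  show 3: "chart_vec u $ 3 = u ^ 3" by (simp only: chart_vec_def vector_3)
  then show "chart_vec u $ 0 = u ^ 3" by (simp only: three_eq_0)
qed (simp_all only: chart_vec_def vector_3)

definition chart :: "3 \<Rightarrow> complex \<Rightarrow> ppoint" where
  "chart i u = hpt (rot i (chart_vec u))"

lemma chart_vec_nonzero [simp]: "chart_vec u \<noteq> 0"
proof
  assume "chart_vec u = 0"
  then have "chart_vec u $ 2 = 0" by simp
  then show False by (simp only: chart_vec_nth croot_nonzero)
qed

lemma klein_form_chart_vec: "u \<in> slit_domain \<Longrightarrow> klein_form (chart_vec u) = 0"
proof -
  assume "u \<in> slit_domain"
  then have c: "croot u ^ 7 = 1 - u ^ 7" by (rule croot_power)
  have "klein_form (chart_vec u) = u ^ 3 * croot u ^ 3 * (1 - u ^ 7 - croot u ^ 7)"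
    unfolding klein_form_3 chart_vec_nth
    by (simp add: algebra_simps power_numeral_reduce)
  then show ?thesis by (simp add: c)
qed

text \<open>The coordinates \<open>s = - X\<^sub>1 / X\<^sub>2\<close> and \<open>t = - X\<^sub>3\<^sup>2 X\<^sub>1 / X\<^sub>2\<^sup>3\<close> of a point \<open>X\<close> of the first chart are \<open>u c\<^sup>2\<close> and \<open>u\<^sup>7\<close>;
  so \<open>u = s / c\<^sup>2\<close>, where \<open>c\<close> is the principal seventh root of \<open>1 - t\<close>.\<close>

definition chart_cond :: "complex ^ 3 \<Rightarrow> bool" where
  "chart_cond v \<longleftrightarrow> v $ 2 \<noteq> 0 \<and> 1 + v $ 3 ^ 2 * v $ 1 / v $ 2 ^ 3 \<notin> \<real>\<^sub>\<le>\<^sub>0"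

definition chart_inv :: "complex ^ 3 \<Rightarrow> complex" where
  "chart_inv v = - (v $ 1 / v $ 2) * exp (- 2 * Ln (1 + v $ 3 ^ 2 * v $ 1 / v $ 2 ^ 3) / 7)"

lemma chart_cond_scale: "c \<noteq> 0 \<Longrightarrow> chart_cond (c *s v) \<longleftrightarrow> chart_cond v"
  and chart_inv_scale: "c \<noteq> 0 \<Longrightarrow> chart_inv (c *s v) = chart_inv v"
proof -
  assume c: "c \<noteq> 0"
  have "(c *s v) $ 3 ^ 2 * (c *s v) $ 1 / (c *s v) $ 2 ^ 3 = v $ 3 ^ 2 * v $ 1 / v $ 2 ^ 3"
    using c by (simp add: power_mult_distrib field_simps power3_eq_cube power2_eq_square)
  then show "chart_cond (c *s v) \<longleftrightarrow> chart_cond v" "chart_inv (c *s v) = chart_inv v"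
    using c by (auto simp: chart_cond_def chart_inv_def)
qed

lemma chart_vec_t:
  "u \<in> slit_domain \<Longrightarrow> 1 + chart_vec u $ 3 ^ 2 * chart_vec u $ 1 / chart_vec u $ 2 ^ 3 = 1 - u ^ 7"
  unfolding chart_vec_nth by (simp add: power_numeral_reduce)

lemma chart_cond_chart_vec: "u \<in> slit_domain \<Longrightarrow> chart_cond (chart_vec u)"
  unfolding chart_cond_def chart_vec_t unfolding chart_vec_nth by (simp add: slit_domain_def)

lemma exp_minus_two_sevenths: "exp (- 2 * L / 7) = 1 / exp (L / 7 :: complex) ^ 2"
proof -
  have "exp (- 2 * L / 7) * exp (L / 7) ^ 2 = exp (- 2 * L / 7 + of_nat 2 * (L / 7))"
    unfolding exp_of_nat_mult exp_add ..
  then show ?thesis by (simp add: eq_divide_eq)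
qed

lemma chart_inv_chart_vec: "u \<in> slit_domain \<Longrightarrow> chart_inv (chart_vec u) = u"
  unfolding chart_inv_def chart_vec_t exp_minus_two_sevenths croot_def[symmetric] unfolding chart_vec_nth
  by (simp add: power_numeral_reduce)

text \<open>In the normalization \<open>v $ 2 = 1\<close> these are the equations \<open>x (1 - t) = s\<^sup>3\<close> and \<open>s\<^sup>7 = t (1 - t)\<^sup>2\<close> of the
  curve, with \<open>t = x\<^sup>2 s\<close>.\<close>

lemma klein_form_normalized:
  assumes v: "klein_form v = 0" "v $ 2 \<noteq> 0"
  defines "s \<equiv> - v $ 1 / v $ 2" and "x \<equiv> v $ 3 / v $ 2"
  shows "s ^ 3 = x * (1 - x ^ 2 * s)" "s ^ 7 = x ^ 2 * s * (1 - x ^ 2 * s) ^ 2"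
proof -
  define d where "d = v $ 2"
  have vd: "v $ 1 = - d * s" "v $ 2 = d" "v $ 3 = d * x"
    using v(2) by (simp_all add: s_def x_def d_def)
  have "d ^ 4 * (x - x ^ 3 * s - s ^ 3) = 0"
    using v(1) unfolding klein_form_3 vd by (simp add: algebra_simps power_numeral_reduce)
  then have "x - x ^ 3 * s - s ^ 3 = 0" using v(2) by (simp add: d_def)
  then show s3: "s ^ 3 = x * (1 - x ^ 2 * s)" by (simp add: algebra_simps power_numeral_reduce)
  have "s ^ 7 = s * (s ^ 3) ^ 2" by (simp add: power_numeral_reduce)
  then show "s ^ 7 = x ^ 2 * s * (1 - x ^ 2 * s) ^ 2" unfolding s3 by (simp add: power_mult_distrib)
qed

text \<open>By \<open>klein_form_normalized\<close>, \<open>u = s / (1 - t) powr (2 / 7)\<close> is a seventh root of \<open>t\<close>; it determines \<open>t\<close>, then \<open>s\<close>,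
  then the point.\<close>

lemma chart_inv_right:
  assumes v: "klein_form v = 0" "chart_cond v"
  shows "chart_inv v \<in> slit_domain" "hpt (chart_vec (chart_inv v)) = hpt v"
proof -
  have d: "v $ 2 \<noteq> 0" using v by (simp add: chart_cond_def)
  define s x where "s = - v $ 1 / v $ 2" and "x = v $ 3 / v $ 2"
  have vd: "v $ 1 = - s * v $ 2" "v $ 3 = x * v $ 2" using d by (simp_all add: s_def x_def)
  define t where "t = x ^ 2 * s"
  have s3: "s ^ 3 = x * (1 - t)" and s7: "s ^ 7 = t * (1 - t) ^ 2"
    using klein_form_normalized[OF v(1) d] by (simp_all add: s_def x_def t_def)
  have t: "1 + v $ 3 ^ 2 * v $ 1 / v $ 2 ^ 3 = 1 - t"
    unfolding vd t_def using d by (simp add: field_simps power2_eq_square power3_eq_cube)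
  have tn: "1 - t \<notin> \<real>\<^sub>\<le>\<^sub>0" "1 - t \<noteq> 0"
    using v(2) unfolding chart_cond_def t by auto
  define u c where "u = chart_inv v" and "c = exp (Ln (1 - t) / 7)"
  have c7: "c ^ 7 = 1 - t" "c \<noteq> 0"
    using tn unfolding c_def exp_div_7_power by (auto simp: exp_Ln)
  have u: "u = s / c ^ 2"
    unfolding u_def chart_inv_def t exp_minus_two_sevenths c_def[symmetric] using d by (simp add: vd)
  have "u ^ 7 = s ^ 7 / (c ^ 7) ^ 2"
    unfolding u by (simp add: power_divide flip: power_mult)
  then have u7: "u ^ 7 = t"
    using tn by (simp add: c7 s7)
  then show "chart_inv v \<in> slit_domain"
    using tn by (simp add: slit_domain_def flip: u_def)
  have cr: "croot u = c"
    by (simp add: croot_def u7 c_def)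
  have "v $ 2 *s chart_vec u = c *s v"
    unfolding vec_eq_iff forall_3 vector_smult_component chart_vec_nth cr
  proof (intro conjI)
    show "v $ 2 * (- u * c ^ 3) = c * v $ 1"
      unfolding vd using c7 by (simp add: u power_numeral_reduce)
    have "u ^ 3 = x * c ^ 7 / c ^ 6"
      unfolding u power_divide s3 c7 by (simp flip: power_mult)
    then have "u ^ 3 = c * x" using c7(2) by (simp add: power_numeral_reduce)
    then show "v $ 2 * u ^ 3 = c * v $ 3" unfolding vd by simp
  qed simp
  then show "hpt (chart_vec (chart_inv v)) = hpt v"
    unfolding u_def[symmetric] using d c7 hpt_eqI by metis
qed

lemma chart_in_klein_curve: "u \<in> slit_domain \<Longrightarrow> chart i u \<in> klein_curve"
  by (simp add: chart_def hpt_in_klein_curve klein_form_chart_vec)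

lemma hpt_rot_cong: "hpt v = hpt w \<Longrightarrow> hpt (rot i v) = hpt (rot i w)"
  by (auto simp: hpt_eq_iff rot_scale)

lemma chart_image_iff:
  assumes B: "B \<subseteq> slit_domain" and v: "v \<noteq> 0"
  shows "hpt v \<in> chart i ` B \<longleftrightarrow> klein_form v = 0 \<and> chart_cond (rot (-i) v) \<and> chart_inv (rot (-i) v) \<in> B"
proof
  assume "hpt v \<in> chart i ` B"
  then obtain u where u: "u \<in> B" "u \<in> slit_domain" "hpt v = hpt (rot i (chart_vec u))"
    using B by (auto simp: chart_def)
  then obtain c where c: "c \<noteq> 0" "v = c *s rot i (chart_vec u)"
    by (auto simp: hpt_eq_iff)
  have "rot (-i) v = c *s chart_vec u"
    by (simp add: c rot_scale rot_rot)
  then show "klein_form v = 0 \<and> chart_cond (rot (-i) v) \<and> chart_inv (rot (-i) v) \<in> B"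
    using c u by (simp add: chart_cond_scale chart_inv_scale chart_cond_chart_vec chart_inv_chart_vec
        klein_form_scale klein_form_chart_vec)
next
  assume *: "klein_form v = 0 \<and> chart_cond (rot (-i) v) \<and> chart_inv (rot (-i) v) \<in> B"
  then have "hpt (chart_vec (chart_inv (rot (-i) v))) = hpt (rot (-i) v)"
    by (intro chart_inv_right) auto
  from hpt_rot_cong[OF this, of i] show "hpt v \<in> chart i ` B"
    using * by (auto simp: chart_def rot_rot image_iff)
qed

lemma continuous_on_chart_inv: "continuous_on {v. chart_cond v} chart_inv"
  unfolding chart_inv_def by (intro continuous_intros) (auto simp: chart_cond_def)

lemma open_chart_cond: "open {v. chart_cond v}"
proof -
  have "open ({v :: complex ^ 3. v $ 2 \<noteq> 0} \<inter> (\<lambda>v. 1 + v $ 3 ^ 2 * v $ 1 / v $ 2 ^ 3) -` (- \<real>\<^sub>\<le>\<^sub>0))"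
    by (rule continuous_open_preimage)
      (auto intro!: continuous_intros open_Collect_neq)
  also have "{v :: complex ^ 3. v $ 2 \<noteq> 0} \<inter> (\<lambda>v. 1 + v $ 3 ^ 2 * v $ 1 / v $ 2 ^ 3) -` (- \<real>\<^sub>\<le>\<^sub>0) = {v. chart_cond v}"
    by (auto simp: chart_cond_def)
  finally show ?thesis .
qed

lemma openin_chart_image:
  assumes "open B" "B \<subseteq> slit_domain"
  shows "openin klein_top (chart i ` B)"
proof -
  let ?Q = "\<lambda>v. chart_cond (rot (-i) v) \<and> chart_inv (rot (-i) v) \<in> B"
  have "open ({v. chart_cond v} \<inter> chart_inv -` B)"
    using continuous_open_preimage[OF continuous_on_chart_inv open_chart_cond assms(1)] .
  then have "open (rot (-i) -` ({v. chart_cond v} \<inter> chart_inv -` B))"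
    by (intro open_vimage continuous_intros)
  moreover have "rot (-i) -` ({v. chart_cond v} \<inter> chart_inv -` B) = {v. ?Q v}" by auto
  ultimately have "open ({v. ?Q v} \<inter> -{0})"
    by (auto intro!: open_Int)
  moreover have "{v. ?Q v} \<inter> -{0} = {v. v \<noteq> 0 \<and> ?Q v}" by auto
  ultimately have "openin klein_top {hpt v | v. v \<noteq> 0 \<and> klein_form v = 0 \<and> ?Q v}"
    by (intro openin_klein_top_coordinates)
       (simp_all add: rot_scale chart_cond_scale chart_inv_scale)
  also have "{hpt v | v. v \<noteq> 0 \<and> klein_form v = 0 \<and> ?Q v} = chart i ` B" (is "?L = ?R")
  proof
    show "?L \<subseteq> ?R" using chart_image_iff[OF assms(2)] by auto
    show "?R \<subseteq> ?L"
    proof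
      fix P assume P: "P \<in> ?R"
      then have "P \<in> klein_curve" using assms(2) chart_in_klein_curve by auto
      then obtain v where "v \<noteq> 0" "P = hpt v" by (rule klein_curve_cases)
      then show "P \<in> ?L" using P chart_image_iff[OF assms(2), of v] by auto
    qed
  qed
  finally show ?thesis .
qed

lemma chart_inj: "u \<in> slit_domain \<Longrightarrow> w \<in> slit_domain \<Longrightarrow> chart i u = chart i w \<Longrightarrow> u = w"
proof -
  assume u: "u \<in> slit_domain" and w: "w \<in> slit_domain" and "chart i u = chart i w"
  then have "hpt (rot (-i) (rot i (chart_vec u))) = hpt (rot (-i) (rot i (chart_vec w)))"
    unfolding chart_def by (rule_tac hpt_rot_cong)
  then obtain c where "c \<noteq> 0" "chart_vec u = c *s chart_vec w"
    by (auto simp: rot_rot hpt_eq_iff)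
  then show "u = w"
    using chart_inv_scale chart_inv_chart_vec u w by metis
qed

lemma holomorphic_on_chart_vec: "(\<lambda>u. rot i (chart_vec u) $ k) holomorphic_on slit_domain"
proof -
  have "(\<lambda>u. chart_vec u $ j) holomorphic_on slit_domain" for j
    using exhaust_3[of j] by (elim disjE; simp only: chart_vec_nth) (intro holomorphic_intros)+
  then show ?thesis by simp
qed

lemma klein_param_chart: "klein_param slit_domain (chart i)"
  unfolding klein_param_def
proof (intro conjI exI[of _ "\<lambda>u. rot i (chart_vec u)"] allI ballI)
  show "inj_on (chart i) slit_domain" by (auto simp: inj_on_def dest: chart_inj)
qed (auto simp: open_slit_domain chart_in_klein_curve holomorphic_on_chart_vec[simplified] simp flip: chart_def)

lemma klein_param_lift:
  assumes "klein_param D \<phi>"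
  obtains X :: "complex \<Rightarrow> complex ^ 3" where "\<And>k. (\<lambda>u. X u $ k) holomorphic_on D"
    "\<And>u. u \<in> D \<Longrightarrow> X u \<noteq> 0" "\<And>u. u \<in> D \<Longrightarrow> \<phi> u = hpt (X u)" "\<And>u. u \<in> D \<Longrightarrow> klein_form (X u) = 0"
proof -
  from assms obtain X :: "complex \<Rightarrow> complex ^ 3" where X: "\<And>k. (\<lambda>u. X u $ k) holomorphic_on D"
    "\<And>u. u \<in> D \<Longrightarrow> X u \<noteq> 0 \<and> \<phi> u = hpt (X u)" and sub: "\<phi> ` D \<subseteq> klein_curve"
    unfolding klein_param_def by blast
  have "klein_form (X u) = 0" if "u \<in> D" for u
    using sub X(2)[OF that] that hpt_in_klein_curve[of "X u"] by auto
  then show ?thesis using that X by blast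
qed

lemma klein_param_subset:
  assumes "klein_param D \<phi>" "open E" "E \<subseteq> D"
  shows "klein_param E \<phi>"
proof -
  obtain X :: "complex \<Rightarrow> complex ^ 3" where X: "\<And>k. (\<lambda>u. X u $ k) holomorphic_on D"
    "\<And>u. u \<in> D \<Longrightarrow> X u \<noteq> 0" "\<And>u. u \<in> D \<Longrightarrow> \<phi> u = hpt (X u)"
    using klein_param_lift[OF assms(1)] by metis
  show ?thesis
    unfolding klein_param_def
  proof (intro conjI exI[of _ X] allI ballI)
    show "inj_on \<phi> E" "\<phi> ` E \<subseteq> klein_curve"
      using assms unfolding klein_param_def by (auto intro: inj_on_subset)
    show "(\<lambda>u. X u $ k) holomorphic_on E" for k
      using X(1) assms(3) by (rule holomorphic_on_subset)
  qed (use assms X in auto)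
qed

lemma continuous_map_klein_param:
  assumes "klein_param D \<phi>"
  shows "continuous_map (top_of_set D) klein_top \<phi>"
proof -
  obtain X :: "complex \<Rightarrow> complex ^ 3" where X: "\<And>k. (\<lambda>u. X u $ k) holomorphic_on D"
    "\<And>u. u \<in> D \<Longrightarrow> X u \<noteq> 0" "\<And>u. u \<in> D \<Longrightarrow> \<phi> u = hpt (X u)" "\<And>u. u \<in> D \<Longrightarrow> klein_form (X u) = 0"
    using klein_param_lift[OF assms] by metis
  have "continuous_on D (\<lambda>u. \<chi> i. X u $ i)"
    using X by (intro continuous_intros holomorphic_on_imp_continuous_on)
  then have "continuous_map (top_of_set D) klein_top (\<lambda>u. hpt (X u))"
    using X by (intro continuous_map_hpt) auto
  then show ?thesis
    by (rule continuous_map_eq) (use X in auto)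
qed

text \<open>The change of parameter is \<open>chart_inv\<close> applied to the homogeneous coordinates of \<open>\<phi>\<close>.\<close>

lemma klein_param_through_chart:
  assumes "klein_param D \<phi>" "\<phi> ` D \<subseteq> chart i ` slit_domain"
  obtains h where "h holomorphic_on D" "h ` D \<subseteq> slit_domain" "\<And>u. u \<in> D \<Longrightarrow> \<phi> u = chart i (h u)"
proof -
  obtain X :: "complex \<Rightarrow> complex ^ 3" where X: "\<And>k. (\<lambda>u. X u $ k) holomorphic_on D"
    "\<And>u. u \<in> D \<Longrightarrow> X u \<noteq> 0" "\<And>u. u \<in> D \<Longrightarrow> \<phi> u = hpt (X u)"
    using klein_param_lift[OF assms(1)] by metis
  define h where "h u = chart_inv (rot (-i) (X u))" for u
  have cond: "klein_form (X u) = 0 \<and> chart_cond (rot (-i) (X u)) \<and> h u \<in> slit_domain" if "u \<in> D" for u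
  proof -
    have "hpt (X u) \<in> chart i ` slit_domain" using assms(2) X(3)[OF that] that by auto
    then show ?thesis using X(2)[OF that] chart_image_iff[of slit_domain "X u" i] by (simp add: h_def)
  qed
  have "h holomorphic_on D"
    unfolding h_def chart_inv_def rot_nth using cond
    by (intro holomorphic_intros X) (auto simp: chart_cond_def)
  moreover have "\<phi> u = chart i (h u)" if u: "u \<in> D" for u
  proof -
    have "hpt (chart_vec (h u)) = hpt (rot (-i) (X u))"
      unfolding h_def using cond[OF u] by (intro chart_inv_right) auto
    from hpt_rot_cong[OF this, of i] show ?thesis
      using X(3)[OF u] by (simp add: chart_def rot_rot)
  qed
  ultimately show ?thesis using that cond by blast
qed

text \<open>A point that the first chart misses has \<open>t \<in> [1, \<infinity>]\<close>.  Rotations of the coordinates replace \<open>t\<close> by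
  \<open>(t - 1) / t\<close>, which is in \<open>[0, 1)\<close> unless \<open>t = \<infinity>\<close>, and by \<open>1 / (1 - t)\<close>, which is \<open>0\<close> for \<open>t = \<infinity>\<close>.  In the
  notation of the proof \<open>t\<close> is \<open>- p\<close> and \<open>(t - 1) / t\<close> is \<open>- q\<close>.\<close>

lemma charts_cover:
  assumes "P \<in> klein_curve"
  obtains i where "P \<in> chart i ` slit_domain"
proof -
  from assms obtain v where v: "v \<noteq> 0" "klein_form v = 0" "P = hpt v"
    by (rule klein_curve_cases)
  have "\<exists>i. chart_cond (rot (-i) v)"
  proof (rule ccontr)
    assume "\<not> ?thesis"
    then have n: "\<not> chart_cond (rot i v)" for i by (metis add.inverse_inverse)
    have step: "v $ (2 + i) = 0 \<or> v $ i = 0" for i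
    proof (rule ccontr)
      assume nz: "\<not> ?thesis"
      define a b c where "a = v $ (1 + i)" and "b = v $ (2 + i)" and "c = v $ i"
      have nz': "b \<noteq> 0" "c \<noteq> 0" using nz by (auto simp: b_def c_def)
      have form: "a ^ 3 * b + b ^ 3 * c + c ^ 3 * a = 0"
        using v(2) klein_form_rot[of i v] unfolding klein_form_3[of "rot i v"] 
        by (simp add: a_def b_def c_def three_eq_0)
      define p q where "p = c ^ 2 * a / b ^ 3" and "q = a ^ 2 * b / c ^ 3"
      have "1 + p \<in> \<real>\<^sub>\<le>\<^sub>0"
        using n[of i] nz' by (simp add: chart_cond_def a_def b_def c_def p_def)
      then obtain x where x: "1 + p = of_real x" "x \<le> 0" by (auto elim!: nonpos_Reals_cases)
      have "(p * q + 1 + p) * (b ^ 3 * c) = a ^ 3 * b + b ^ 3 * c + c ^ 3 * a"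
        unfolding p_def q_def using nz' by (simp add: field_simps power_numeral_reduce)
      then have pq: "p * q + 1 + p = 0" using form nz' by simp
      have p: "p = of_real (x - 1)" using x by (simp add: algebra_simps)
      have "p * (1 + q) = - 1" using pq by (simp add: algebra_simps eq_neg_iff_add_eq_0)
      then have "of_real (1 - x) * (1 + q) = 1" unfolding p by (simp add: algebra_simps)
      then have "1 + q = 1 / of_real (1 - x)"
        by (metis eq_divide_eq mult.commute mult_zero_left zero_neq_one)
      then have "1 + q = of_real (1 / (1 - x))" by simp
      then have "1 + q \<notin> \<real>\<^sub>\<le>\<^sub>0" using x(2) by (simp del: of_real_divide)
      moreover have "chart_cond (rot (1 + i) v) \<longleftrightarrow> 1 + q \<notin> \<real>\<^sub>\<le>\<^sub>0"
        using nz' by (simp add: chart_cond_def a_def b_def c_def q_def flip: add.assoc)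
      ultimately show False using n[of "1 + i"] by simp
    qed
    have one: "v $ (2 + i) = 0" for i
    proof (rule ccontr)
      assume b: "v $ (2 + i) \<noteq> 0"
      then have c: "v $ i = 0" using step[of i] by auto
      then have "chart_cond (rot i v)"
        using b by (simp add: chart_cond_def)
      then show False using n by simp
    qed
    have "v $ k = 0" for k using one[of "k - 2"] by simp
    then show False using v(1) by (simp add: vec_eq_iff)
  qed
  then obtain i where "chart_cond (rot (-i) v)" ..
  then have "P \<in> chart i ` slit_domain"
    using v chart_image_iff[of slit_domain v i] chart_inv_right(1)[of "rot (-i) v"] by auto
  then show ?thesis by (rule that)
qed

lemma chart_neighbourhood:
  assumes "P \<in> chart i ` slit_domain" "openin klein_top W" "P \<in> W"
  obtains u \<epsilon> where "\<epsilon> > 0" "ball u \<epsilon> \<subseteq> slit_domain" "P = chart i u" "chart i ` ball u \<epsilon> \<subseteq> W"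
    "openin klein_top (chart i ` ball u \<epsilon>)"
proof -
  from assms obtain u where u: "u \<in> slit_domain" "P = chart i u" by auto
  have "openin (top_of_set slit_domain) {x \<in> topspace (top_of_set slit_domain). chart i x \<in> W}"
    using continuous_map_klein_param[OF klein_param_chart] assms(2)
    by (rule openin_continuous_map_preimage)
  then have "open {x \<in> slit_domain. chart i x \<in> W}"
    using open_slit_domain by (simp add: openin_open_eq)
  moreover have "u \<in> {x \<in> slit_domain. chart i x \<in> W}" using u assms by auto
  ultimately obtain \<epsilon> where "\<epsilon> > 0" "ball u \<epsilon> \<subseteq> {x \<in> slit_domain. chart i x \<in> W}"
    using open_contains_ball by blast
  then show ?thesis
    using that[of \<epsilon> u] u openin_chart_image[of "ball u \<epsilon>" i] by auto
qed

section \<open>Three holomorphic differentials\<close>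

text \<open>The partial derivatives of the form \<open>\<Sum>X\<^sub>k\<^sup>3 X\<^sub>k\<^sub>+\<^sub>1\<close>, and the components of \<open>X \<times> X'\<close>.\<close>

definition grad :: "3 \<Rightarrow> complex ^ 3 \<Rightarrow> complex" where
  "grad k v = 3 * (v $ k) ^ 2 * v $ (k + 1) + (v $ (k + 2)) ^ 3"

definition cross :: "(complex \<Rightarrow> complex ^ 3) \<Rightarrow> complex \<Rightarrow> 3 \<Rightarrow> complex" where
  "cross X u k = X u $ (k + 1) * deriv (\<lambda>u. X u $ (k + 2)) u - X u $ (k + 2) * deriv (\<lambda>u. X u $ (k + 1)) u"

text \<open>The coefficient of the residue of \<open>1 / F\<close>, in homogeneous coordinates the quotient of \<open>X \<times> dX\<close> by the
  gradient of \<open>F\<close>.  It has degree \<open>-1\<close>, so that its products with the coordinates are differentials.\<close>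

definition residue_form :: "(complex \<Rightarrow> complex ^ 3) \<Rightarrow> complex \<Rightarrow> complex" where
  "residue_form X u = (let k = SOME k. grad k (X u) \<noteq> 0 in cross X u k / grad k (X u))"

definition is_lifting :: "complex set \<Rightarrow> (complex \<Rightarrow> ppoint) \<Rightarrow> (complex \<Rightarrow> complex ^ 3) \<Rightarrow> bool" where
  "is_lifting D \<phi> X \<longleftrightarrow> (\<forall>k. (\<lambda>u. X u $ k) holomorphic_on D) \<and> 
     (\<forall>u\<in>D. X u \<noteq> 0 \<and> \<phi> u = hpt (X u) \<and> klein_form (X u) = 0)"

definition klein_diff :: "3 \<Rightarrow> differential" where
  "klein_diff j D \<phi> u =
     (if klein_param D \<phi> \<and> u \<in> D
      then let X = SOME X. is_lifting D \<phi> X in X u $ j * residue_form X u else 0)"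

lemma is_lifting_exists: "klein_param D \<phi> \<Longrightarrow> \<exists>X. is_lifting D \<phi> X"
  unfolding is_lifting_def by (metis klein_param_lift)

text \<open>With \<open>A\<^sub>k = X\<^sub>k\<^sup>3 X\<^sub>k\<^sub>+\<^sub>1\<close>, the equation \<open>X\<^sub>k F\<^sub>k = 0\<close> reads \<open>A\<^sub>k\<^sub>+\<^sub>2 = - 3 A\<^sub>k\<close>; going round three times gives
  \<open>A\<^sub>k = - 27 A\<^sub>k\<close>.\<close>

lemma klein_form_smooth:
  assumes "v \<noteq> 0" "klein_form v = 0"
  shows "\<exists>k. grad k v \<noteq> 0"
proof (rule ccontr)
  assume "\<not> ?thesis"
  then have g: "grad k v = 0" for k by auto
  define A where "A k = (v $ k) ^ 3 * v $ (k + 1)" for k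
  have 3: "A (k + 2) = - 3 * A k" for k
  proof -
    have "v $ k * grad k v = 3 * A k + A (k + 2)"
      by (simp add: grad_def A_def power_numeral_reduce algebra_simps)
    then show ?thesis by (simp add: g eq_neg_iff_add_eq_0 add.commute)
  qed
  have "A 1 = - 27 * A 1"
    using 3[of 1] 3[of 3] 3[of 2] by simp
  then have "A 1 = 0" by simp
  then have A0: "A k = 0" for k
    using 3[of 1] 3[of 3] exhaust_3[of k] by auto
  have "v $ k = 0" for k
  proof (rule ccontr)
    assume nz: "v $ k \<noteq> 0"
    then have "v $ (k + 1) = 0" using A0[of k] by (simp add: A_def)
    moreover have "grad (k + 1) v = 3 * v $ (k + 1) ^ 2 * v $ (k + 2) + v $ k ^ 3"
      by (simp add: grad_def add.assoc)
    ultimately show False using g[of "k + 1"] nz by simp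
  qed
  then show False using assms(1) by (simp add: vec_eq_iff)
qed

lemma grad_scale: "grad k (c *s v) = c ^ 3 * grad k v"
  by (simp add: grad_def power_mult_distrib algebra_simps power_numeral_reduce)

lemma orthogonal_cross_parallel:
  fixes g1 g2 g3 :: complex
  assumes "g1 * x1 + g2 * x2 + g3 * x3 = 0" "g1 * y1 + g2 * y2 + g3 * y3 = 0"
  shows "(x2 * y3 - x3 * y2) * g2 = (x3 * y1 - x1 * y3) * g1"
proof -
  have 1: "g1 * x1 = - g2 * x2 - g3 * x3" "g1 * y1 = - g2 * y2 - g3 * y3"
    using assms by (simp_all add: algebra_simps eq_neg_iff_add_eq_0)
  have "(x3 * y1 - x1 * y3) * g1 = x3 * (g1 * y1) - (g1 * x1) * y3"
    by (simp add: algebra_simps)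
  then show ?thesis unfolding 1 by (simp add: algebra_simps)
qed

text \<open>Euler's relation \<open>\<Sum>X\<^sub>k F\<^sub>k = 4 F = 0\<close> and its companion \<open>\<Sum>X\<^sub>k' F\<^sub>k = F' = 0\<close> make the gradient of \<open>F\<close>
  parallel to \<open>X \<times> X'\<close>, so the quotient of the two does not depend on the component used.\<close>

lemma cross_grad:
  assumes X: "is_lifting D \<phi> X" and D: "open D" "u \<in> D"
  shows "cross X u k * grad l (X u) = cross X u l * grad k (X u)"
proof -
  define x d where "x k = X u $ k" and "d k = deriv (\<lambda>u. X u $ k) u" for k
  have der: "((\<lambda>u. X u $ k) has_field_derivative d k) (at u)" for k
    unfolding d_def using X D by (auto simp: is_lifting_def intro: holomorphic_derivI)
  have "((\<lambda>u. klein_form (X u)) has_field_derivative (\<Sum>k\<in>UNIV. grad k (X u) * d k)) (at u)"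
    unfolding klein_form_3 sum_3
    by (auto intro!: derivative_eq_intros der simp: grad_def)
       (simp add: algebra_simps power_numeral_reduce)
  moreover have "((\<lambda>u. klein_form (X u)) has_field_derivative 0) (at u)"
    by (rule DERIV_cong_ev[THEN iffD2, OF refl _ refl, of _ "\<lambda>_. 0"])
       (use X D in \<open>auto simp: is_lifting_def intro!: eventually_mono[OF eventually_nhds_in_open[of D u]]\<close>)
  ultimately have e2: "grad 1 (X u) * d 1 + grad 2 (X u) * d 2 + grad 3 (X u) * d 3 = 0"
    by (metis DERIV_unique sum_3)
  have "grad 1 (X u) * x 1 + grad 2 (X u) * x 2 + grad 3 (X u) * x 3 = 4 * klein_form (X u)"
    by (simp add: klein_form_3 grad_def x_def algebra_simps power_numeral_reduce)
  then have e1: "grad 1 (X u) * x 1 + grad 2 (X u) * x 2 + grad 3 (X u) * x 3 = 0"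
    using X D by (simp add: is_lifting_def)
  have c: "cross X u 1 = x 2 * d 3 - x 3 * d 2" "cross X u 2 = x 3 * d 1 - x 1 * d 3"
    "cross X u 3 = x 1 * d 2 - x 2 * d 1"
    by (simp_all add: cross_def x_def d_def)
  have "cross X u 1 * grad 2 (X u) = cross X u 2 * grad 1 (X u)"
    "cross X u 2 * grad 3 (X u) = cross X u 3 * grad 2 (X u)"
    "cross X u 3 * grad 1 (X u) = cross X u 1 * grad 3 (X u)"
    unfolding c
    by (rule orthogonal_cross_parallel[of _ _ _ _ "grad 3 (X u)"]
          orthogonal_cross_parallel[of _ _ _ _ "grad 1 (X u)"]
          orthogonal_cross_parallel[of _ _ _ _ "grad 2 (X u)"], use e1 e2 in \<open>simp add: algebra_simps\<close>,
        use e1 e2 in \<open>simp add: algebra_simps\<close>)+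
  then show ?thesis
    using exhaust_3[of k] exhaust_3[of l] by metis
qed

lemma residue_form_eq:
  assumes X: "is_lifting D \<phi> X" and D: "open D" "u \<in> D" and k: "grad k (X u) \<noteq> 0"
  shows "residue_form X u = cross X u k / grad k (X u)"
proof -
  define l where "l = (SOME k. grad k (X u) \<noteq> 0)"
  have "grad l (X u) \<noteq> 0" unfolding l_def using k by (rule someI)
  then show ?thesis
    using cross_grad[OF X D, of k l] k
    by (simp add: residue_form_def field_simps flip: l_def)
qed

text \<open>If \<open>X = c Y\<close> then \<open>X \<times> X' = c\<^sup>2 (Y \<times> Y')\<close>, whereas the gradient gets the factor \<open>c\<^sup>3\<close> and the coordinate
  the factor \<open>c\<close>.\<close>

lemma residue_form_transform:
  assumes X: "is_lifting D \<phi> X" and Y: "is_lifting E \<psi> Y" and op: "open D" "open E" and u: "u \<in> D"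
    and h: "h holomorphic_on D" "h ` D \<subseteq> E" and eq: "\<And>u. u \<in> D \<Longrightarrow> \<phi> u = \<psi> (h u)"
  shows "X u $ j * residue_form X u = Y (h u) $ j * residue_form Y (h u) * deriv h u"
proof -
  have hu: "h u \<in> E" using h u by auto
  have "hpt (X u) = hpt (Y (h u))"
    using X Y u hu eq by (auto simp: is_lifting_def)
  then obtain c where c: "c \<noteq> 0" "X u = c *s Y (h u)"
    by (auto simp: hpt_eq_iff)
  have dX: "((\<lambda>u. X u $ k) has_field_derivative deriv (\<lambda>u. X u $ k) u) (at u)" for k
    using X op u by (auto simp: is_lifting_def intro: holomorphic_derivI)
  have dh: "(h has_field_derivative deriv h u) (at u)"
    using h op u by (auto intro: holomorphic_derivI)
  have "((\<lambda>u. Y u $ k) has_field_derivative deriv (\<lambda>u. Y u $ k) (h u)) (at (h u))" for k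
    using Y op hu by (auto simp: is_lifting_def intro: holomorphic_derivI)
  from DERIV_chain2[OF this dh]
  have dY: "((\<lambda>u. Y (h u) $ k) has_field_derivative deriv (\<lambda>u. Y u $ k) (h u) * deriv h u) (at u)" for k .
  have par: "X w $ a * Y (h w) $ b = X w $ b * Y (h w) $ a" if "w \<in> D" for w a b
  proof -
    have "h w \<in> E" using h(2) that by auto
    then have "hpt (X w) = hpt (Y (h w))"
      using X Y eq[OF that] that unfolding is_lifting_def by metis
    then show ?thesis by (auto simp: hpt_eq_iff)
  qed
  \<comment> \<open>Differentiating the proportionality of \<open>X\<close> and \<open>Y \<circ> h\<close> avoids differentiating the factor.\<close>
  have dpar: "deriv (\<lambda>u. X u $ a) u * Y (h u) $ b + X u $ a * (deriv (\<lambda>u. Y u $ b) (h u) * deriv h u) =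
      deriv (\<lambda>u. X u $ b) u * Y (h u) $ a + X u $ b * (deriv (\<lambda>u. Y u $ a) (h u) * deriv h u)" for a b
  proof (rule DERIV_unique)
    show "((\<lambda>w. X w $ a * Y (h w) $ b) has_field_derivative
      (deriv (\<lambda>u. X u $ a) u * Y (h u) $ b + X u $ a * (deriv (\<lambda>u. Y u $ b) (h u) * deriv h u))) (at u)"
      by (auto intro!: derivative_eq_intros dX dY)
    have "((\<lambda>w. X w $ b * Y (h w) $ a) has_field_derivative
      (deriv (\<lambda>u. X u $ b) u * Y (h u) $ a + X u $ b * (deriv (\<lambda>u. Y u $ a) (h u) * deriv h u))) (at u)"
      by (auto intro!: derivative_eq_intros dX dY)
    then show "((\<lambda>w. X w $ a * Y (h w) $ b) has_field_derivative
      (deriv (\<lambda>u. X u $ b) u * Y (h u) $ a + X u $ b * (deriv (\<lambda>u. Y u $ a) (h u) * deriv h u))) (at u)"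
      by (rule has_field_derivative_transform_within_open[OF _ op(1) u]) (rule par)
  qed
  have cr: "cross X u k = c ^ 2 * (cross Y (h u) k * deriv h u)" for k
  proof -
    let ?y = "\<lambda>a. Y (h u) $ a" and ?dx = "\<lambda>a. deriv (\<lambda>u. X u $ a) u"
      and ?dy = "\<lambda>a. deriv (\<lambda>u. Y u $ a) (h u) * deriv h u"
    have "?dx (k + 2) * ?y (k + 1) - ?dx (k + 1) * ?y (k + 2) = c * (?y (k + 1) * ?dy (k + 2) - ?y (k + 2) * ?dy (k + 1))"
      using dpar[of "k + 1" "k + 2"] unfolding c(2) vector_smult_component by (simp add: algebra_simps)
    then have "c * (?dx (k + 2) * ?y (k + 1) - ?dx (k + 1) * ?y (k + 2)) = c * (c * (?y (k + 1) * ?dy (k + 2) - ?y (k + 2) * ?dy (k + 1)))"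
      by simp
    then show ?thesis
      unfolding cross_def c(2) vector_smult_component by (simp add: algebra_simps power2_eq_square)
  qed
  obtain k where k: "grad k (Y (h u)) \<noteq> 0"
    using klein_form_smooth[of "Y (h u)"] Y hu by (auto simp: is_lifting_def)
  have kX: "grad k (X u) = c ^ 3 * grad k (Y (h u))"
    unfolding c(2) grad_scale ..
  then have "grad k (X u) \<noteq> 0" using k c by simp
  then show ?thesis
    unfolding residue_form_eq[OF X op(1) u \<open>grad k (X u) \<noteq> 0\<close>] residue_form_eq[OF Y op(2) hu k] cr kX
    using k c by (simp add: field_simps power_numeral_reduce)
qed

lemma klein_diff_lifting:
  assumes "klein_param D \<phi>" "is_lifting D \<phi> X" "u \<in> D"
  shows "klein_diff j D \<phi> u = X u $ j * residue_form X u"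
proof -
  define Y where "Y = (SOME X. is_lifting D \<phi> X)"
  have Y: "is_lifting D \<phi> Y"
    unfolding Y_def using is_lifting_exists[OF assms(1)] by (rule someI_ex)
  have "open D" using assms(1) by (simp add: klein_param_def)
  with residue_form_transform[OF Y assms(2), of u "\<lambda>u. u" j] assms(3)
  show ?thesis
    by (simp add: klein_diff_def assms(1) flip: Y_def)
qed

lemma residue_form_holomorphic:
  assumes X: "is_lifting D \<phi> X" and D: "open D"
  shows "residue_form X holomorphic_on D"
  unfolding holomorphic_on_def
proof
  fix u assume u: "u \<in> D"
  then obtain k where k: "grad k (X u) \<noteq> 0"
    using klein_form_smooth[of "X u"] X by (auto simp: is_lifting_def)
  have hX: "(\<lambda>u. X u $ k) holomorphic_on D" for k using X by (simp add: is_lifting_def)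
  have hg: "(\<lambda>u. grad k (X u)) holomorphic_on D"
    unfolding grad_def by (intro holomorphic_intros hX)
  have hc: "(\<lambda>u. cross X u k) holomorphic_on D"
    unfolding cross_def by (intro holomorphic_intros holomorphic_deriv hX D)
  define E where "E = D \<inter> (\<lambda>u. grad k (X u)) -` (-{0})"
  have "open E"
    unfolding E_def using holomorphic_on_imp_continuous_on[OF hg] D
    by (intro continuous_open_preimage) auto
  have "(\<lambda>u. cross X u k / grad k (X u)) holomorphic_on E"
    by (intro holomorphic_intros holomorphic_on_subset[OF hg] holomorphic_on_subset[OF hc]) (auto simp: E_def)
  then have "residue_form X holomorphic_on E"
    by (rule holomorphic_transform) (auto simp: E_def residue_form_eq[OF X D])
  then show "residue_form X field_differentiable (at u within D)"
    using \<open>open E\<close> u k by (auto simp: E_def holomorphic_on_open field_differentiable_def intro: has_field_derivative_at_within)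
qed

lemma klein_diff_in_holomorphic_differentials: "klein_diff j \<in> holomorphic_differentials"
  unfolding holomorphic_differentials_def
proof (intro CollectI conjI allI impI ballI)
  fix D \<phi> assume p: "klein_param D \<phi>"
  then obtain X where X: "is_lifting D \<phi> X" using is_lifting_exists by blast
  have D: "open D" using p by (simp add: klein_param_def)
  have "(\<lambda>u. X u $ j * residue_form X u) holomorphic_on D"
    using X by (intro holomorphic_intros residue_form_holomorphic[OF X D]) (simp add: is_lifting_def)
  then show "klein_diff j D \<phi> holomorphic_on D"
    by (rule holomorphic_transform) (simp add: klein_diff_lifting[OF p X])
next
  fix D \<phi> E \<psi> h u
  assume p: "klein_param D \<phi>" and q: "klein_param E \<psi>" and h: "h holomorphic_on D" "h ` D \<subseteq> E"
    and eq: "\<forall>u\<in>D. \<phi> u = \<psi> (h u)" and u: "u \<in> D"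
  obtain X where X: "is_lifting D \<phi> X" using is_lifting_exists[OF p] by blast
  obtain Y where Y: "is_lifting E \<psi> Y" using is_lifting_exists[OF q] by blast
  have "h u \<in> E" using h u by auto
  then show "klein_diff j D \<phi> u = klein_diff j E \<psi> (h u) * deriv h u"
    unfolding klein_diff_lifting[OF p X u] klein_diff_lifting[OF q Y \<open>h u \<in> E\<close>]
    using p q eq by (intro residue_form_transform[OF X Y _ _ u h]) (auto simp: klein_param_def)
qed (auto simp: klein_diff_def)

lemma is_lifting_chart: "is_lifting slit_domain (chart i) (\<lambda>u. rot i (chart_vec u))"
  using holomorphic_on_chart_vec[of i] by (simp add: is_lifting_def chart_def klein_form_chart_vec)

text \<open>That is, \<open>\<Omega> = du / c\<^sup>6\<close>.\<close>

lemma cross_chart_vec: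
  assumes u: "u \<in> slit_domain"
  shows "cross chart_vec u k = grad k (chart_vec u) / croot u ^ 6"
proof -
  define c where "c = croot u"
  have nz: "c \<noteq> 0" by (simp add: c_def)
  have c7: "c ^ 7 = 1 - u ^ 7" unfolding c_def using u by (rule croot_power)
  note dc = has_field_derivative_croot[OF u, folded c_def]
  have d2: "deriv (\<lambda>u. chart_vec u $ 2) u = - (u ^ 6) / c ^ 6"
    unfolding chart_vec_nth using dc by (rule DERIV_imp_deriv)
  have d3: "deriv (\<lambda>u. chart_vec u $ 3) u = 3 * u ^ 2"
    unfolding chart_vec_nth by (rule DERIV_imp_deriv) (auto intro!: derivative_eq_intros)
  have d1: "deriv (\<lambda>u. chart_vec u $ 1) u = - (c ^ 3) + 3 * u ^ 7 / c ^ 4"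
    unfolding chart_vec_nth
  proof (rule DERIV_imp_deriv)
    show "((\<lambda>u. - u * croot u ^ 3) has_field_derivative - (c ^ 3) + 3 * u ^ 7 / c ^ 4) (at u)"
      using nz by (auto intro!: derivative_eq_intros dc simp flip: c_def)
         (simp add: field_simps power_numeral_reduce)
  qed
  have sub: "u ^ 7 = 1 - c ^ 7" using c7 by simp
  have "cross chart_vec u 1 = grad 1 (chart_vec u) / c ^ 6"
  proof -
    have "cross chart_vec u 1 = chart_vec u $ 2 * deriv (\<lambda>u. chart_vec u $ 3) u - chart_vec u $ 3 * deriv (\<lambda>u. chart_vec u $ 2) u"
      by (simp add: cross_def)
    also have "\<dots> = grad 1 (chart_vec u) / c ^ 6"
      unfolding d2 d3 grad_def using nz
      by (simp add: field_simps power_numeral_reduce flip: c_def)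
    finally show ?thesis .
  qed
  moreover have "cross chart_vec u 2 = grad 2 (chart_vec u) / c ^ 6"
  proof -
    have "cross chart_vec u 2 = chart_vec u $ 3 * deriv (\<lambda>u. chart_vec u $ 1) u - chart_vec u $ 1 * deriv (\<lambda>u. chart_vec u $ 3) u"
      by (simp add: cross_def)
    also have "\<dots> = u ^ 3 * (2 * c ^ 7 + 3 * u ^ 7) / c ^ 4"
      unfolding d1 d3 using nz
      by (simp add: field_simps power_numeral_reduce flip: c_def)
    also have "\<dots> = grad 2 (chart_vec u) / c ^ 6"
      unfolding sub grad_def using nz
      by (simp add: field_simps power_numeral_reduce flip: c_def)
    finally show ?thesis .
  qed
  moreover have "cross chart_vec u 3 = grad 3 (chart_vec u) / c ^ 6"
  proof -
    have "cross chart_vec u 3 = chart_vec u $ 1 * deriv (\<lambda>u. chart_vec u $ 2) u - chart_vec u $ 2 * deriv (\<lambda>u. chart_vec u $ 1) u"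
      by (simp add: cross_def)
    also have "\<dots> = (c ^ 7 - 2 * u ^ 7) / c ^ 3"
      unfolding d1 d2 using nz
      by (simp add: field_simps power_numeral_reduce flip: c_def)
    also have "\<dots> = grad 3 (chart_vec u) / c ^ 6"
      unfolding c7 grad_def using nz
      by (simp add: field_simps power_numeral_reduce flip: c_def)
    finally show ?thesis .
  qed
  ultimately show ?thesis
    using exhaust_3[of k] by (auto simp: c_def)
qed

definition chart_coeff :: "3 \<Rightarrow> complex \<Rightarrow> complex" where
  "chart_coeff j u = chart_vec u $ j / croot u ^ 6"

lemma klein_diff_chart:
  assumes u: "u \<in> slit_domain"
  shows "klein_diff j slit_domain (chart i) u = chart_coeff (j + i) u"
proof -
  let ?X = "\<lambda>u. rot i (chart_vec u)"
  have X: "is_lifting slit_domain (chart i) ?X" by (rule is_lifting_chart)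
  obtain k where k: "grad k (?X u) \<noteq> 0"
    using klein_form_smooth[of "?X u"] X u by (auto simp: is_lifting_def)
  have "cross ?X u k = cross chart_vec u (k + i)" "grad k (?X u) = grad (k + i) (chart_vec u)"
    by (simp_all add: cross_def grad_def ac_simps)
  then have "residue_form ?X u = 1 / croot u ^ 6"
    using residue_form_eq[OF X open_slit_domain u k] cross_chart_vec[OF u] k by simp
  then show ?thesis
    using klein_diff_lifting[OF klein_param_chart X u] by (simp add: chart_coeff_def)
qed

lemma holomorphic_on_chart_coeff: "chart_coeff j holomorphic_on slit_domain"
  unfolding chart_coeff_def
  using holomorphic_on_chart_vec[of 0 j] by (intro holomorphic_intros) auto

section \<open>Integration along paths\<close>

lemma holomorphic_differentialsD:
  assumes "\<omega> \<in> holomorphic_differentials"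
  shows "klein_param D \<phi> \<Longrightarrow> \<omega> D \<phi> holomorphic_on D"
    and "klein_param D \<phi> \<Longrightarrow> klein_param E \<psi> \<Longrightarrow> h holomorphic_on D \<Longrightarrow> h ` D \<subseteq> E \<Longrightarrow>
      (\<And>u. u \<in> D \<Longrightarrow> \<phi> u = \<psi> (h u)) \<Longrightarrow> u \<in> D \<Longrightarrow> \<omega> D \<phi> u = \<omega> E \<psi> (h u) * deriv h u"
proof -
  show "klein_param D \<phi> \<Longrightarrow> \<omega> D \<phi> holomorphic_on D"
    using assms by (simp add: holomorphic_differentials_def)
  have "\<forall>D \<phi> E \<psi> h. klein_param D \<phi> \<longrightarrow> klein_param E \<psi> \<longrightarrow>
        h holomorphic_on D \<longrightarrow> h ` D \<subseteq> E \<longrightarrow> (\<forall>u\<in>D. \<phi> u = \<psi> (h u)) \<longrightarrow>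
        (\<forall>u\<in>D. \<omega> D \<phi> u = \<omega> E \<psi> (h u) * deriv h u)"
    using assms by (simp add: holomorphic_differentials_def)
  then show "klein_param D \<phi> \<Longrightarrow> klein_param E \<psi> \<Longrightarrow> h holomorphic_on D \<Longrightarrow> h ` D \<subseteq> E \<Longrightarrow>
      (\<And>u. u \<in> D \<Longrightarrow> \<phi> u = \<psi> (h u)) \<Longrightarrow> u \<in> D \<Longrightarrow> \<omega> D \<phi> u = \<omega> E \<psi> (h u) * deriv h u"
    by simp
qed

lemma differential_restrict:
  assumes "\<omega> \<in> holomorphic_differentials" "klein_param D \<phi>" "open E" "E \<subseteq> D" "u \<in> E"
  shows "\<omega> E \<phi> u = \<omega> D \<phi> u"
proof -
  have "\<omega> E \<phi> u = \<omega> D \<phi> u * deriv (\<lambda>u. u) u"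
    using assms(4) by (intro holomorphic_differentialsD(2)[OF assms(1) klein_param_subset[OF assms(2-4)] assms(2)])
      (simp_all add: assms(5))
  then show ?thesis by simp
qed

lemma local_primitive_exists:
  assumes \<omega>: "\<omega> \<in> holomorphic_differentials" and P: "P \<in> klein_curve"
  obtains V g where "local_primitive \<omega> V g" "P \<in> V"
proof -
  obtain i where i: "P \<in> chart i ` slit_domain" using charts_cover[OF P] .
  have hol: "\<omega> slit_domain (chart i) holomorphic_on slit_domain"
    using \<omega> klein_param_chart by (rule holomorphic_differentialsD)
  then obtain G where G: "\<And>u. u \<in> slit_domain \<Longrightarrow> (G has_field_derivative \<omega> slit_domain (chart i) u) (at u)"
    using holomorphic_starlike_primitive[OF holomorphic_on_imp_continuous_on[OF hol] starlike_slit_domain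
        open_slit_domain finite.emptyI] holomorphic_on_imp_differentiable_at[OF hol open_slit_domain]
    by auto
  define g where "g Q = G (inv_into slit_domain (chart i) Q)" for Q
  have inj: "inj_on (chart i) slit_domain" using klein_param_chart by (simp add: klein_param_def)
  have "local_primitive \<omega> (chart i ` slit_domain) g"
    unfolding local_primitive_def
  proof (intro conjI allI impI)
    show "openin klein_top (chart i ` slit_domain)"
      using open_slit_domain by (rule openin_chart_image) simp
    fix D \<phi> u assume p: "klein_param D \<phi>" and sub: "\<phi> ` D \<subseteq> chart i ` slit_domain" and u: "u \<in> D"
    obtain h where h: "h holomorphic_on D" "h ` D \<subseteq> slit_domain" "\<And>u. u \<in> D \<Longrightarrow> \<phi> u = chart i (h u)"
      using klein_param_through_chart[OF p sub] by metis
    have D: "open D" using p by (simp add: klein_param_def)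
    have hu: "h u \<in> slit_domain" using h(2) u by auto
    have "((\<lambda>u. G (h u)) has_field_derivative \<omega> slit_domain (chart i) (h u) * deriv h u) (at u)"
      by (rule DERIV_chain2[OF G[OF hu] holomorphic_derivI[OF h(1) D u]])
    moreover have "G (h w) = g (\<phi> w)" if "w \<in> D" for w
      using h that inj by (auto simp: g_def inv_into_f_f)
    ultimately have "((\<lambda>u. g (\<phi> u)) has_field_derivative \<omega> slit_domain (chart i) (h u) * deriv h u) (at u)"
      using has_field_derivative_transform_within_open[OF _ D u] by simp
    moreover have "\<omega> D \<phi> u = \<omega> slit_domain (chart i) (h u) * deriv h u"
    proof (rule holomorphic_differentialsD(2)[OF \<omega> p klein_param_chart[of i] h(1,2)])
      show "\<phi> w = chart i (h w)" if "w \<in> D" for w using that by (rule h(3))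
    qed (rule u)
    ultimately show "((\<lambda>u. g (\<phi> u)) has_field_derivative \<omega> D \<phi> u) (at u)"
      by (simp only:)
  qed
  then show ?thesis using i by (rule that)
qed

lemma local_primitiveD:
  assumes "local_primitive \<omega> V g"
  shows "openin klein_top V"
    and "klein_param D \<phi> \<Longrightarrow> \<phi> ` D \<subseteq> V \<Longrightarrow> u \<in> D \<Longrightarrow>
      ((\<lambda>u. g (\<phi> u)) has_field_derivative \<omega> D \<phi> u) (at u)"
proof -
  show "openin klein_top V" using assms unfolding local_primitive_def by (rule conjunct1)
  assume D: "klein_param D \<phi>" "\<phi> ` D \<subseteq> V" "u \<in> D"
  have "\<forall>D \<phi> u. klein_param D \<phi> \<longrightarrow> \<phi> ` D \<subseteq> V \<longrightarrow> u \<in> D \<longrightarrow>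
        ((\<lambda>u. g (\<phi> u)) has_field_derivative \<omega> D \<phi> u) (at u)"
    using assms unfolding local_primitive_def by (rule conjunct2)
  from this[THEN spec, THEN spec, THEN spec, THEN mp, THEN mp, THEN mp, OF D]
  show "((\<lambda>u. g (\<phi> u)) has_field_derivative \<omega> D \<phi> u) (at u)" .
qed

lemma local_primitive_subset:
  assumes "local_primitive \<omega> V g" "openin klein_top W" "W \<subseteq> V"
  shows "local_primitive \<omega> W g"
  unfolding local_primitive_def
proof (intro conjI allI impI)
  fix D \<phi> u assume D: "klein_param D \<phi>" "\<phi> ` D \<subseteq> W" "u \<in> D"
  show "((\<lambda>u. g (\<phi> u)) has_field_derivative \<omega> D \<phi> u) (at u)"
    using local_primitiveD(2)[OF assms(1) D(1) order_trans[OF D(2) assms(3)] D(3)] .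
qed fact

lemma local_primitive_add_const:
  assumes "local_primitive \<omega> V g"
  shows "local_primitive \<omega> V (\<lambda>P. g P + c)"
  unfolding local_primitive_def
proof (intro conjI allI impI)
  show "openin klein_top V" using assms by (rule local_primitiveD)
  fix D \<phi> u assume "klein_param D \<phi>" "\<phi> ` D \<subseteq> V" "u \<in> D"
  from DERIV_add[OF local_primitiveD(2)[OF assms this] DERIV_const[of c]]
  show "((\<lambda>u. g (\<phi> u) + c) has_field_derivative \<omega> D \<phi> u) (at u)" by simp
qed

text \<open>Two primitives are compared in a disc of a chart, where their difference has derivative 0; hence it is
  constant near each point, although not on \<open>V \<inter> V'\<close>.\<close>

lemma local_primitive_unique:
  assumes V: "local_primitive \<omega> V g" "local_primitive \<omega> V' g'" and P: "P \<in> V" "P \<in> V'"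
  obtains W where "openin klein_top W" "P \<in> W" "W \<subseteq> V \<inter> V'" "\<And>Q. Q \<in> W \<Longrightarrow> g Q - g' Q = g P - g' P"
proof -
  have op: "openin klein_top (V \<inter> V')" using V by (auto simp: local_primitive_def)
  then have "P \<in> klein_curve" using P openin_subset topspace_klein by fastforce
  then obtain i where i: "P \<in> chart i ` slit_domain" by (rule charts_cover)
  have PV: "P \<in> V \<inter> V'" using P by simp
  obtain u \<epsilon> where u: "\<epsilon> > 0" "ball u \<epsilon> \<subseteq> slit_domain" "P = chart i u" "chart i ` ball u \<epsilon> \<subseteq> V \<inter> V'"
    "openin klein_top (chart i ` ball u \<epsilon>)"
    by (rule chart_neighbourhood[OF i op PV])
  have p: "klein_param (ball u \<epsilon>) (chart i)"
    using klein_param_chart open_ball u(2) by (rule klein_param_subset)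
  let ?B = "ball u \<epsilon>"
  have const: "g (chart i w) - g' (chart i w) = g (chart i u) - g' (chart i u)" if w: "w \<in> ?B" for w
  proof -
    have "((\<lambda>w. g (chart i w) - g' (chart i w)) has_field_derivative 0) (at x within ?B)"
      if x: "x \<in> ?B" for x
    proof -
      have sub: "chart i ` ?B \<subseteq> V" "chart i ` ?B \<subseteq> V'" using u(4) by simp_all
      from DERIV_diff[OF local_primitiveD(2)[OF V(1) p sub(1) x] local_primitiveD(2)[OF V(2) p sub(2) x]]
      show ?thesis by (simp add: has_field_derivative_at_within)
    qed
    from has_field_derivative_zero_constant[OF convex_ball this]
    obtain c where "\<forall>x\<in>?B. g (chart i x) - g' (chart i x) = c" by metis
    then show ?thesis using w u(1) by (metis centre_in_ball)
  qed
  show ?thesis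
  proof (rule that)
    show "openin klein_top (chart i ` ?B)" "chart i ` ?B \<subseteq> V \<inter> V'" by (rule u)+
    show "P \<in> chart i ` ?B" unfolding u(3) using u(1) by simp
    fix Q assume "Q \<in> chart i ` ?B"
    then obtain w where "w \<in> ?B" "Q = chart i w" by (rule imageE)
    then show "g Q - g' Q = g P - g' P" unfolding u(3) using const by simp
  qed
qed

definition path_primitive :: "differential \<Rightarrow> (real \<Rightarrow> ppoint) \<Rightarrow> (real \<Rightarrow> complex) \<Rightarrow> bool" where
  "path_primitive \<omega> \<gamma> F \<longleftrightarrow> (\<forall>t\<in>{0..1}. \<exists>V g e. local_primitive \<omega> V g \<and> \<gamma> t \<in> V \<and> e > 0 \<and>
           (\<forall>s\<in>{0..1}. \<bar>s - t\<bar> < e \<longrightarrow> \<gamma> s \<in> V \<and> F s = g (\<gamma> s)))"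

lemma has_path_integral_iff:
  "has_path_integral \<omega> \<gamma> I \<longleftrightarrow> (\<exists>F. path_primitive \<omega> \<gamma> F \<and> I = F 1 - F 0)"
  unfolding has_path_integral_def path_primitive_def by simp

lemma has_path_integral_cong:
  assumes "\<And>t. t \<in> {0..1} \<Longrightarrow> \<gamma> t = \<gamma>' t"
  shows "has_path_integral \<omega> \<gamma> = has_path_integral \<omega> \<gamma>'"
proof -
  have "path_primitive \<omega> \<gamma> F \<longleftrightarrow> path_primitive \<omega> \<gamma>' F" for F
    unfolding path_primitive_def using assms by auto
  then show ?thesis unfolding has_path_integral_iff[abs_def] by simp
qed

lemma path_integral_cong:
  assumes "\<And>t. t \<in> {0..1} \<Longrightarrow> \<gamma> t = \<gamma>' t"
  shows "path_integral \<omega> \<gamma> = path_integral \<omega> \<gamma>'"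
proof -
  have "has_path_integral \<omega> \<gamma> = has_path_integral \<omega> \<gamma>'"
    by (rule has_path_integral_cong) (rule assms)
  then show ?thesis by (simp only: path_integral_def)
qed

lemma pathin_near:
  assumes "pathin X \<gamma>" "openin X W" "\<gamma> t \<in> W" "t \<in> {0..1}"
  obtains e where "e > 0" "\<And>s. s \<in> {0..1} \<Longrightarrow> \<bar>s - t\<bar> < e \<Longrightarrow> \<gamma> s \<in> W"
proof -
  have "openin (top_of_set {0..1}) {s \<in> topspace (top_of_set {0..1}). \<gamma> s \<in> W}"
    using assms(1,2) unfolding pathin_def by (rule openin_continuous_map_preimage)
  then obtain e where "e > 0" "\<forall>s\<in>{0..1}. dist s t < e \<longrightarrow> s \<in> {s \<in> {0..1}. \<gamma> s \<in> W}"
    using assms(3,4) unfolding openin_euclidean_subtopology_iff by force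
  then show ?thesis using that[of e] by (auto simp: dist_real_def)
qed

lemma path_primitive_unique:
  assumes F: "path_primitive \<omega> \<gamma> F" "path_primitive \<omega> \<gamma> F'" and \<gamma>: "pathin klein_top \<gamma>"
  shows "F 1 - F 0 = F' 1 - F' 0"
proof -
  have "F 0 - F' 0 = F 1 - F' 1"
  proof (rule connected_local_const[of "{0..1::real}" 0 1 "\<lambda>t. F t - F' t"])
    show "\<forall>t\<in>{0..1}. \<forall>\<^sub>F s in at t within {0..1}. F t - F' t = F s - F' s"
    proof
      fix t :: real assume t: "t \<in> {0..1}"
      obtain V g e where 1: "local_primitive \<omega> V g" "\<gamma> t \<in> V" "e > 0"
        "\<And>s. s\<in>{0..1} \<Longrightarrow> \<bar>s - t\<bar> < e \<Longrightarrow> \<gamma> s \<in> V \<and> F s = g (\<gamma> s)"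
        using F(1) t unfolding path_primitive_def by metis
      obtain V' g' e' where 2: "local_primitive \<omega> V' g'" "\<gamma> t \<in> V'" "e' > 0"
        "\<And>s. s\<in>{0..1} \<Longrightarrow> \<bar>s - t\<bar> < e' \<Longrightarrow> \<gamma> s \<in> V' \<and> F' s = g' (\<gamma> s)"
        using F(2) t unfolding path_primitive_def by metis
      obtain W where W: "openin klein_top W" "\<gamma> t \<in> W" "\<And>Q. Q \<in> W \<Longrightarrow> g Q - g' Q = g (\<gamma> t) - g' (\<gamma> t)"
        using local_primitive_unique[OF 1(1) 2(1) 1(2) 2(2)] by metis
      obtain d where d: "d > 0" "\<And>s. s \<in> {0..1} \<Longrightarrow> \<bar>s - t\<bar> < d \<Longrightarrow> \<gamma> s \<in> W"
        using pathin_near[OF \<gamma> W(1,2) t] by metis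
      have "F t - F' t = F s - F' s" if "s \<in> {0..1}" "dist s t < min d (min e e')" for s
        using that 1(3) 2(3) 1(4)[of s] 2(4)[of s] 1(4)[of t] 2(4)[of t] d(2)[of s] W(3)[of "\<gamma> s"] t
        by (auto simp: dist_real_def)
      then show "\<forall>\<^sub>F s in at t within {0..1}. F t - F' t = F s - F' s"
        unfolding eventually_at using d(1) 1(3) 2(3) by (intro exI[of _ "min d (min e e')"]) auto
    qed
  qed auto
  then show ?thesis by (simp add: algebra_simps)
qed

lemma path_integral_eqI:
  assumes "pathin klein_top \<gamma>" "has_path_integral \<omega> \<gamma> I"
  shows "path_integral \<omega> \<gamma> = I"
  unfolding path_integral_def
proof (rule the_equality)
  fix J assume "has_path_integral \<omega> \<gamma> J"
  then show "J = I"
    using assms path_primitive_unique[of \<omega> \<gamma>] by (auto simp: has_path_integral_iff)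
qed fact

text \<open>The concatenation of paths.  The operation \<open>+++\<close> asks for a type with a topology, but the points of the curve
  get theirs from \<open>klein_top\<close>.\<close>

definition glue :: "(real \<Rightarrow> 'a) \<Rightarrow> (real \<Rightarrow> 'a) \<Rightarrow> real \<Rightarrow> 'a" where
  "glue \<gamma> \<delta> t = (if t \<le> 1/2 then \<gamma> (2 * t) else \<delta> (2 * t - 1))"

lemma pathin_glue:
  assumes "pathin X \<gamma>" "pathin X \<delta>" "\<gamma> 1 = \<delta> 0"
  shows "pathin X (glue \<gamma> \<delta>)"
proof -
  let ?T = "top_of_set {0..1::real}"
  have 1: "continuous_map (subtopology ?T {x \<in> topspace ?T. x \<le> 1/2}) X (\<gamma> \<circ> (\<lambda>x. 2 * x))"
    using assms(1) unfolding pathin_def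
    by (intro continuous_map_compose) (auto simp: continuous_map_in_subtopology subtopology_subtopology intro!: continuous_intros)
  have 2: "continuous_map (subtopology ?T {x \<in> topspace ?T. 1/2 \<le> x}) X (\<delta> \<circ> (\<lambda>x. 2 * x - 1))"
    using assms(2) unfolding pathin_def
    by (intro continuous_map_compose) (auto simp: continuous_map_in_subtopology subtopology_subtopology intro!: continuous_intros)
  have "continuous_map ?T X (\<lambda>x. if x \<le> 1/2 then (\<gamma> \<circ> (\<lambda>x. 2 * x)) x else (\<delta> \<circ> (\<lambda>x. 2 * x - 1)) x)"
  proof (rule continuous_map_cases_le[OF _ _ 1 2])
    fix x :: real assume "x = 1/2"
    then have "2 * x = 1" "2 * x - 1 = 0" by simp_all
    then show "(\<gamma> \<circ> (\<lambda>x. 2 * x)) x = (\<delta> \<circ> (\<lambda>x. 2 * x - 1)) x" using assms(3) by (simp only: o_def)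
  qed auto
  then show ?thesis
    unfolding pathin_def glue_def[abs_def] o_def .
qed

lemma has_path_integral_glue:
  assumes \<gamma>: "pathin klein_top \<gamma>" "has_path_integral \<omega> \<gamma> I"
    and \<delta>: "pathin klein_top \<delta>" "has_path_integral \<omega> \<delta> J" and eq: "\<gamma> 1 = \<delta> 0"
  shows "has_path_integral \<omega> (glue \<gamma> \<delta>) (I + J)"
proof -
  obtain F where F: "path_primitive \<omega> \<gamma> F" "I = F 1 - F 0"
    using \<gamma>(2) unfolding has_path_integral_iff by blast
  obtain G where G: "path_primitive \<omega> \<delta> G" "J = G 1 - G 0"
    using \<delta>(2) unfolding has_path_integral_iff by blast
  define k where "k = F 1 - G 0"
  define H where "H t = (if t \<le> 1/2 then F (2 * t) else G (2 * t - 1) + k)" for t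
  have "path_primitive \<omega> (glue \<gamma> \<delta>) H"
    unfolding path_primitive_def
  proof
    fix t :: real assume t: "t \<in> {0..1}"
    consider "t < 1/2" | "t > 1/2" | "t = 1/2" by linarith
    then show "\<exists>V g e. local_primitive \<omega> V g \<and> (glue \<gamma> \<delta>) t \<in> V \<and> e > 0 \<and>
           (\<forall>s\<in>{0..1}. \<bar>s - t\<bar> < e \<longrightarrow> (glue \<gamma> \<delta>) s \<in> V \<and> H s = g ((glue \<gamma> \<delta>) s))"
    proof cases
      case 1
      then have "2 * t \<in> {0..1}" using t by auto
      then obtain V g e where e: "local_primitive \<omega> V g" "\<gamma> (2 * t) \<in> V" "e > 0"
        "\<And>s. s\<in>{0..1} \<Longrightarrow> \<bar>s - 2 * t\<bar> < e \<Longrightarrow> \<gamma> s \<in> V \<and> F s = g (\<gamma> s)"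
        using F(1) unfolding path_primitive_def by metis
      show ?thesis
      proof (intro exI conjI ballI impI)
        show "local_primitive \<omega> V g" "(glue \<gamma> \<delta>) t \<in> V" "min (e/2) (1/2 - t) > 0"
          using e 1 by (auto simp: glue_def)
        fix s :: real assume s: "s \<in> {0..1}" "\<bar>s - t\<bar> < min (e/2) (1/2 - t)"
        then have "s \<le> 1/2" "2 * s \<in> {0..1}" "\<bar>2 * s - 2 * t\<bar> < e" by (auto simp: abs_if split: if_splits)
        then show "(glue \<gamma> \<delta>) s \<in> V" "H s = g ((glue \<gamma> \<delta>) s)"
          using e(4)[of "2 * s"] by (auto simp: glue_def H_def)
      qed
    next
      case 2
      then have "2 * t - 1 \<in> {0..1}" using t by auto
      then obtain V g e where e: "local_primitive \<omega> V g" "\<delta> (2 * t - 1) \<in> V" "e > 0"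
        "\<And>s. s\<in>{0..1} \<Longrightarrow> \<bar>s - (2 * t - 1)\<bar> < e \<Longrightarrow> \<delta> s \<in> V \<and> G s = g (\<delta> s)"
        using G(1) unfolding path_primitive_def by metis
      show ?thesis
      proof (intro exI conjI ballI impI)
        show "local_primitive \<omega> V (\<lambda>P. g P + k)" "(glue \<gamma> \<delta>) t \<in> V" "min (e/2) (t - 1/2) > 0"
          using e 2 by (auto simp: glue_def local_primitive_add_const)
        fix s :: real assume s: "s \<in> {0..1}" "\<bar>s - t\<bar> < min (e/2) (t - 1/2)"
        then have "\<not> s \<le> 1/2" "2 * s - 1 \<in> {0..1}" "\<bar>2 * s - 1 - (2 * t - 1)\<bar> < e" by (auto simp: abs_if split: if_splits)
        then show "(glue \<gamma> \<delta>) s \<in> V" "H s = g ((glue \<gamma> \<delta>) s) + k"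
          using e(4)[of "2 * s - 1"] by (auto simp: glue_def H_def)
      qed
    next
      case 3
      obtain V g e where e: "local_primitive \<omega> V g" "\<gamma> 1 \<in> V" "e > 0"
        "\<And>s. s\<in>{0..1} \<Longrightarrow> \<bar>s - 1\<bar> < e \<Longrightarrow> \<gamma> s \<in> V \<and> F s = g (\<gamma> s)"
        using F(1) unfolding path_primitive_def by (metis atLeastAtMost_iff order_refl zero_le_one)
      obtain V' g' e' where e': "local_primitive \<omega> V' g'" "\<delta> 0 \<in> V'" "e' > 0"
        "\<And>s. s\<in>{0..1} \<Longrightarrow> \<bar>s - 0\<bar> < e' \<Longrightarrow> \<delta> s \<in> V' \<and> G s = g' (\<delta> s)"
        using G(1) unfolding path_primitive_def by (metis atLeastAtMost_iff order_refl zero_le_one)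
      obtain W where W: "openin klein_top W" "\<gamma> 1 \<in> W" "W \<subseteq> V \<inter> V'" "\<And>Q. Q \<in> W \<Longrightarrow> g Q - g' Q = g (\<gamma> 1) - g' (\<gamma> 1)"
        using local_primitive_unique[OF e(1) e'(1) e(2)] e'(2) eq by metis
      obtain d where d: "d > 0" "\<And>s. s \<in> {0..1} \<Longrightarrow> \<bar>s - 1\<bar> < d \<Longrightarrow> \<gamma> s \<in> W"
        using pathin_near[OF \<gamma>(1) W(1,2)] by auto
      obtain d' where d': "d' > 0" "\<And>s. s \<in> {0..1} \<Longrightarrow> \<bar>s - 0\<bar> < d' \<Longrightarrow> \<delta> s \<in> W"
        using pathin_near[OF \<delta>(1) W(1), of 0] W(2) eq by auto
      have k: "k = g (\<gamma> 1) - g' (\<gamma> 1)"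
        using e(3) e'(3) e(4)[of 1] e'(4)[of 0] eq by (simp add: k_def)
      show ?thesis
      proof (intro exI conjI ballI impI)
        show "local_primitive \<omega> W g" using e(1) W by (auto intro: local_primitive_subset)
        show "(glue \<gamma> \<delta>) t \<in> W" unfolding 3 using W by (simp add: glue_def)
        show "min (min e e') (min d d') / 2 > 0" using e e' d d' by auto
        fix s :: real assume s: "s \<in> {0..1}" "\<bar>s - t\<bar> < min (min e e') (min d d') / 2"
        show "(glue \<gamma> \<delta>) s \<in> W" "H s = g ((glue \<gamma> \<delta>) s)"
        proof (atomize (full), cases "s \<le> 1/2")
          case True
          then have "2 * s \<in> {0..1}" "\<bar>2 * s - 1\<bar> < e" "\<bar>2 * s - 1\<bar> < d" using s 3 by auto
          then show "(glue \<gamma> \<delta>) s \<in> W \<and> H s = g ((glue \<gamma> \<delta>) s)"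
            using True e(4) d(2) by (auto simp: glue_def H_def)
        next
          case False
          then have *: "2 * s - 1 \<in> {0..1}" "\<bar>2 * s - 1 - 0\<bar> < e'" "\<bar>2 * s - 1 - 0\<bar> < d'" using s 3 by auto
          then have "\<delta> (2 * s - 1) \<in> W" using d'(2) by blast
          then show "(glue \<gamma> \<delta>) s \<in> W \<and> H s = g ((glue \<gamma> \<delta>) s)"
            using False e'(4)[OF *(1,2)] W(4)[of "\<delta> (2 * s - 1)"] k by (simp add: glue_def H_def diff_eq_eq)
        qed
      qed
    qed
  qed
  moreover have "H 1 - H 0 = I + J" by (simp add: H_def k_def F G)
  ultimately show ?thesis unfolding has_path_integral_iff by metis
qed

lemma has_path_integral_reverse:
  assumes "has_path_integral \<omega> \<gamma> I"
  shows "has_path_integral \<omega> (\<lambda>t. \<gamma> (1 - t)) (- I)"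
proof -
  obtain F where F: "path_primitive \<omega> \<gamma> F" "I = F 1 - F 0"
    using assms unfolding has_path_integral_iff by blast
  have "path_primitive \<omega> (\<lambda>t. \<gamma> (1 - t)) (\<lambda>t. F (1 - t))"
    unfolding path_primitive_def
  proof
    fix t :: real assume "t \<in> {0..1}"
    then have "1 - t \<in> {0..1}" by auto
    then obtain V g e where e: "local_primitive \<omega> V g" "\<gamma> (1 - t) \<in> V" "e > 0"
        "\<And>s. s\<in>{0..1} \<Longrightarrow> \<bar>s - (1 - t)\<bar> < e \<Longrightarrow> \<gamma> s \<in> V \<and> F s = g (\<gamma> s)"
      using F(1) unfolding path_primitive_def by metis
    have "\<forall>s\<in>{0..1}. \<bar>s - t\<bar> < e \<longrightarrow> \<gamma> (1 - s) \<in> V \<and> F (1 - s) = g (\<gamma> (1 - s))"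
    proof (intro ballI impI)
      fix s :: real assume "s \<in> {0..1}" "\<bar>s - t\<bar> < e"
      then show "\<gamma> (1 - s) \<in> V \<and> F (1 - s) = g (\<gamma> (1 - s))" by (intro e(4)) auto
    qed
    with e show "\<exists>V g e. local_primitive \<omega> V g \<and> \<gamma> (1 - t) \<in> V \<and> e > 0 \<and>
           (\<forall>s\<in>{0..1}. \<bar>s - t\<bar> < e \<longrightarrow> \<gamma> (1 - s) \<in> V \<and> F (1 - s) = g (\<gamma> (1 - s)))"
      by blast
  qed
  then show ?thesis unfolding has_path_integral_iff by (intro exI conjI) (auto simp: F)
qed

lemma has_path_integral_local:
  assumes "local_primitive \<omega> V g" "\<And>t. t \<in> {0..1} \<Longrightarrow> \<gamma> t \<in> V"
  shows "has_path_integral \<omega> \<gamma> (g (\<gamma> 1) - g (\<gamma> 0))"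
proof -
  have "path_primitive \<omega> \<gamma> (g \<circ> \<gamma>)"
    unfolding path_primitive_def using assms zero_less_one[where 'a = real] by (metis comp_apply)
  then show ?thesis unfolding has_path_integral_iff by (metis comp_apply)
qed

text \<open>The primitive \<open>G\<close> need not come from a function on the curve: along the path, \<open>G \<circ> c\<close> differs from a local
  primitive on the curve by a constant.\<close>

lemma has_path_integral_klein_param:
  assumes \<omega>: "\<omega> \<in> holomorphic_differentials" and p: "klein_param D \<phi>"
    and G: "\<And>u. u \<in> D \<Longrightarrow> (G has_field_derivative \<omega> D \<phi> u) (at u)"
    and c: "continuous_on {0..1} c" "c ` {0..1} \<subseteq> D"
  shows "pathin klein_top (\<phi> \<circ> c)" "has_path_integral \<omega> (\<phi> \<circ> c) (G (c 1) - G (c 0))"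
proof -
  have "continuous_map (top_of_set {0..1}) (top_of_set D) c"
    using c by (auto simp: continuous_map_in_subtopology)
  then show pa: "pathin klein_top (\<phi> \<circ> c)"
    unfolding pathin_def using continuous_map_klein_param[OF p] by (rule continuous_map_compose)
  have D: "open D" using p by (simp add: klein_param_def)
  have "path_primitive \<omega> (\<phi> \<circ> c) (G \<circ> c)"
    unfolding path_primitive_def
  proof
    fix t :: real assume t: "t \<in> {0..1}"
    then have ct: "c t \<in> D" using c by auto
    have "\<phi> (c t) \<in> klein_curve" using p ct by (auto simp: klein_param_def)
    then obtain V g where V: "local_primitive \<omega> V g" "\<phi> (c t) \<in> V"
      using local_primitive_exists[OF \<omega>] by metis
    have "openin (top_of_set D) {x \<in> topspace (top_of_set D). \<phi> x \<in> V}"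
      using continuous_map_klein_param[OF p] V(1) unfolding local_primitive_def
      by (intro openin_continuous_map_preimage) auto
    then have "open {x \<in> D. \<phi> x \<in> V}" using D by (simp add: openin_open_eq)
    then obtain r where r: "r > 0" "ball (c t) r \<subseteq> {x \<in> D. \<phi> x \<in> V}"
      using ct V(2) open_contains_ball by (metis (no_types, lifting) mem_Collect_eq)
    let ?B = "ball (c t) r"
    have pB: "klein_param ?B \<phi>" using r(2) by (intro klein_param_subset[OF p]) auto
    have const: "G w - g (\<phi> w) = G (c t) - g (\<phi> (c t))" if "w \<in> ?B" for w
    proof (rule has_field_derivative_zero_constant[of ?B, THEN exE])
      show "((\<lambda>w. G w - g (\<phi> w)) has_field_derivative 0) (at x within ?B)" if "x \<in> ?B" for x
      proof -
        have "((\<lambda>w. g (\<phi> w)) has_field_derivative \<omega> ?B \<phi> x) (at x)"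
        proof -
          have "\<phi> ` ?B \<subseteq> V" 
          proof (rule image_subsetI)
            show "\<phi> w \<in> V" if "w \<in> ?B" for w using subsetD[OF r(2) that] by simp
          qed
          then show ?thesis using that by (rule local_primitiveD(2)[OF V(1) pB])
        qed
        moreover have "\<omega> ?B \<phi> x = \<omega> D \<phi> x"
          using r(2) that by (intro differential_restrict[OF \<omega> p]) auto
        moreover have "(G has_field_derivative \<omega> D \<phi> x) (at x)"
          using that r(2) by (intro G) auto
        ultimately show ?thesis
          using DERIV_diff[of G "\<omega> D \<phi> x" x UNIV "\<lambda>w. g (\<phi> w)" "\<omega> D \<phi> x"]
          by (simp add: has_field_derivative_at_within)
      qed
      fix k assume "\<forall>x\<in>?B. G x - g (\<phi> x) = k"
      then show ?thesis using that r(1) by (metis centre_in_ball)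
    qed simp
    obtain e where e: "e > 0" "\<And>s. s \<in> {0..1} \<Longrightarrow> dist s t < e \<Longrightarrow> dist (c s) (c t) < r"
      using c(1) t r(1) unfolding continuous_on_iff by metis
    let ?k = "G (c t) - g (\<phi> (c t))"
    show "\<exists>V g e. local_primitive \<omega> V g \<and> (\<phi> \<circ> c) t \<in> V \<and> e > 0 \<and>
           (\<forall>s\<in>{0..1}. \<bar>s - t\<bar> < e \<longrightarrow> (\<phi> \<circ> c) s \<in> V \<and> (G \<circ> c) s = g ((\<phi> \<circ> c) s))"
    proof (intro exI conjI ballI impI)
      show "local_primitive \<omega> V (\<lambda>P. g P + ?k)" using V(1) by (rule local_primitive_add_const)
      fix s :: real assume "s \<in> {0..1}" "\<bar>s - t\<bar> < e"
      then have "c s \<in> ?B" using e(2)[of s] by (simp add: dist_real_def dist_commute)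
      then show "(\<phi> \<circ> c) s \<in> V" "(G \<circ> c) s = g ((\<phi> \<circ> c) s) + ?k"
        using r(2) const[of "c s"] by (auto simp: algebra_simps)
    qed (use V e in auto)
  qed
  then show "has_path_integral \<omega> (\<phi> \<circ> c) (G (c 1) - G (c 0))"
    unfolding has_path_integral_iff by (intro exI[of _ "G \<circ> c"] conjI) auto
qed

lemma has_path_integral_linear_combination:
  fixes c :: "3 \<Rightarrow> complex"
  assumes eq: "\<And>D \<phi> u. \<eta> D \<phi> u = (\<Sum>j\<in>UNIV. c j * \<omega> j D \<phi> u)"
    and I: "\<And>j. has_path_integral (\<omega> j) \<gamma> (I j)"
  shows "has_path_integral \<eta> \<gamma> (\<Sum>j\<in>UNIV. c j * I j)"
proof -
  obtain F where F: "\<And>j. path_primitive (\<omega> j) \<gamma> (F j)" "\<And>j. I j = F j 1 - F j 0"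
    using I unfolding has_path_integral_iff by metis
  have "path_primitive \<eta> \<gamma> (\<lambda>t. \<Sum>j\<in>UNIV. c j * F j t)"
    unfolding path_primitive_def
  proof
    fix t :: real assume t: "t \<in> {0..1}"
    then have "\<forall>j. \<exists>V g e. local_primitive (\<omega> j) V g \<and> \<gamma> t \<in> V \<and> e > 0 \<and>
        (\<forall>s\<in>{0..1}. \<bar>s - t\<bar> < e \<longrightarrow> \<gamma> s \<in> V \<and> F j s = g (\<gamma> s))"
      using F(1) unfolding path_primitive_def by blast
    then obtain V g e where V: "\<And>j. local_primitive (\<omega> j) (V j) (g j)" "\<And>j. \<gamma> t \<in> V j" "\<And>j. e j > 0"
      "\<And>j s. s\<in>{0..1} \<Longrightarrow> \<bar>s - t\<bar> < e j \<Longrightarrow> \<gamma> s \<in> V j \<and> F j s = g j (\<gamma> s)"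
      by metis
    show "\<exists>V g e. local_primitive \<eta> V g \<and> \<gamma> t \<in> V \<and> e > 0 \<and>
           (\<forall>s\<in>{0..1}. \<bar>s - t\<bar> < e \<longrightarrow> \<gamma> s \<in> V \<and> (\<Sum>j\<in>UNIV. c j * F j s) = g (\<gamma> s))"
    proof (intro exI conjI ballI impI)
      show "local_primitive \<eta> (\<Inter>j. V j) (\<lambda>P. \<Sum>j\<in>UNIV. c j * g j P)"
        unfolding local_primitive_def
      proof (intro conjI allI impI)
        show "openin klein_top (\<Inter>j. V j)"
          using V(1) by (intro openin_INT2) (auto simp: local_primitive_def)
        fix D \<phi> u assume "klein_param D \<phi>" "\<phi> ` D \<subseteq> (\<Inter>j. V j)" "u \<in> D"
        then have "((\<lambda>u. g j (\<phi> u)) has_field_derivative \<omega> j D \<phi> u) (at u)" for j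
          by (intro local_primitiveD(2)[OF V(1)[of j]]) auto
        then show "((\<lambda>u. \<Sum>j\<in>UNIV. c j * g j (\<phi> u)) has_field_derivative \<eta> D \<phi> u) (at u)"
          unfolding eq by (intro DERIV_sum DERIV_cmult)
      qed
      show "\<gamma> t \<in> (\<Inter>j. V j)" using V(2) by auto
      show "0 < (MIN j. e j)" using V(3) by (subst Min_gr_iff) auto
      fix s :: real assume "s \<in> {0..1}" "\<bar>s - t\<bar> < (MIN j. e j)"
      then have "\<gamma> s \<in> V j \<and> F j s = g j (\<gamma> s)" for j
        by (intro V(4)) auto
      then show "\<gamma> s \<in> (\<Inter>j. V j)" "(\<Sum>j\<in>UNIV. c j * F j s) = (\<Sum>j\<in>UNIV. c j * g j (\<gamma> s))" by auto
    qed
  qed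
  then show ?thesis
    unfolding has_path_integral_iff F(2)
    by (intro exI[of _ "\<lambda>t. \<Sum>j\<in>UNIV. c j * F j t"] conjI) (auto simp: right_diff_distrib sum_subtractf)
qed

section \<open>Integration over homology classes\<close>

lemma glue_linepath:
  fixes a b :: "'a::real_normed_vector"
  shows "glue (s \<circ> linepath a (midpoint a b)) (s \<circ> linepath (midpoint a b) b) = s \<circ> linepath a b"
proof
  fix t :: real
  have b: "(2 * t - 1) *\<^sub>R b = t *\<^sub>R b + t *\<^sub>R b - b"
    by (simp add: scaleR_diff_left flip: scaleR_add_left)
  have "(2 - 2 * t) *\<^sub>R midpoint a b = (1 - t) *\<^sub>R (a + b)"
    by (simp add: midpoint_def diff_divide_distrib)
  then have "linepath (midpoint a b) b (2 * t - 1) = linepath a b t"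
    by (simp add: linepath_def b) (simp add: algebra_simps)
  moreover have "linepath a (midpoint a b) (2 * t) = linepath a b t"
    by (simp add: linepath_def midpoint_def algebra_simps flip: scaleR_add_left)
  ultimately show "glue (s \<circ> linepath a (midpoint a b)) (s \<circ> linepath (midpoint a b) b) t = (s \<circ> linepath a b) t"
    by (simp add: glue_def)
qed

text \<open>The set \<open>K\<close> will be the unit interval, for the existence of path integrals, and a triangle, for
  the boundaries of singular simplices.\<close>

locale convex_map =
  fixes \<omega> :: differential and K :: "'a::euclidean_space set" and s :: "'a \<Rightarrow> ppoint"
  assumes \<omega>: "\<omega> \<in> holomorphic_differentials"
    and K: "compact K" "convex K"
    and s: "continuous_map (top_of_set K) klein_top s"
begin

definition J :: "'a \<Rightarrow> 'a \<Rightarrow> complex" where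
  "J a b = path_integral \<omega> (s \<circ> linepath a b)"

lemma pathin_segment:
  assumes "a \<in> K" "b \<in> K"
  shows "pathin klein_top (s \<circ> linepath a b)"
proof -
  have "linepath a b t \<in> K" if "t \<in> {0..1}" for t
    using closed_segment_subset[OF assms K(2)] that linepath_in_path[of t a b] by auto
  then have "continuous_map (top_of_set {0..1}) (top_of_set K) (linepath a b)"
    by (auto simp: continuous_map_in_subtopology intro!: continuous_on_linepath)
  then show ?thesis
    unfolding pathin_def using s by (rule continuous_map_compose)
qed

text \<open>By compactness, primitives exist on balls of one radius.\<close>

lemma uniform_local_primitives:
  obtains \<delta> where "\<delta> > 0"
    "\<And>x. x \<in> K \<Longrightarrow> \<exists>V g. local_primitive \<omega> V g \<and> s ` (ball x \<delta> \<inter> K) \<subseteq> V"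
proof -
  define \<G> where "\<G> = {U. open U \<and> (\<exists>V g. local_primitive \<omega> V g \<and> s ` (U \<inter> K) \<subseteq> V)}"
  have cover: "K \<subseteq> \<Union>\<G>"
  proof
    fix x assume x: "x \<in> K"
    then have "s x \<in> klein_curve"
      using continuous_map_image_subset_topspace[OF s] by (auto simp: topspace_klein)
    then obtain V g where V: "local_primitive \<omega> V g" "s x \<in> V"
      using local_primitive_exists[OF \<omega>] by metis
    have "openin (top_of_set K) {x \<in> topspace (top_of_set K). s x \<in> V}"
      by (rule openin_continuous_map_preimage[OF s local_primitiveD(1)[OF V(1)]])
    then obtain U where U: "open U" "{x \<in> K. s x \<in> V} = K \<inter> U"
      unfolding openin_open by auto
    then have "s ` (U \<inter> K) \<subseteq> V" by blast
    then have "U \<in> \<G>" unfolding \<G>_def using U(1) V(1) by blast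
    moreover have "x \<in> U" using U(2) x V(2) by blast
    ultimately show "x \<in> \<Union>\<G>" by blast
  qed
  have "\<And>U. U \<in> \<G> \<Longrightarrow> open U" by (simp add: \<G>_def)
  then obtain \<delta> where \<delta>: "\<delta> > 0" "\<And>x. x \<in> K \<Longrightarrow> \<exists>U\<in>\<G>. ball x \<delta> \<subseteq> U"
    using Heine_Borel_lemma[OF K(1) cover] by metis
  have "\<exists>V g. local_primitive \<omega> V g \<and> s ` (ball x \<delta> \<inter> K) \<subseteq> V" if "x \<in> K" for x
  proof -
    obtain U V g where "ball x \<delta> \<subseteq> U" "local_primitive \<omega> V g" "s ` (U \<inter> K) \<subseteq> V"
      using \<delta>(2)[OF \<open>x \<in> K\<close>] unfolding \<G>_def by auto
    then show ?thesis by (intro exI[of _ V] exI[of _ g]) auto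
  qed
  then show ?thesis using that \<delta>(1) by metis
qed

lemma midpoint_in: "a \<in> K \<Longrightarrow> b \<in> K \<Longrightarrow> midpoint a b \<in> K"
  using K(2) midpoints_in_convex_hull closed_segment_subset midpoint_in_closed_segment by blast

text \<open>By induction on \<open>n\<close> for segments of length below \<open>2\<^sup>n \<delta>\<close>, which are halved.\<close>

lemma segment_integral_exists:
  assumes "a \<in> K" "b \<in> K"
  shows "\<exists>I. has_path_integral \<omega> (s \<circ> linepath a b) I"
proof -
  obtain \<delta> where \<delta>: "\<delta> > 0" "\<And>x. x \<in> K \<Longrightarrow> \<exists>V g. local_primitive \<omega> V g \<and> s ` (ball x \<delta> \<inter> K) \<subseteq> V"
    using uniform_local_primitives by metis
  have "\<forall>a\<in>K. \<forall>b\<in>K. dist a b < 2 ^ n * \<delta> \<longrightarrow> (\<exists>I. has_path_integral \<omega> (s \<circ> linepath a b) I)" for n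
  proof (induction n)
    case 0
    show ?case
    proof (intro ballI impI)
      fix a b assume ab: "a \<in> K" "b \<in> K" "dist a b < 2 ^ 0 * \<delta>"
      obtain V g where V: "local_primitive \<omega> V g" "s ` (ball a \<delta> \<inter> K) \<subseteq> V"
        using \<delta>(2)[OF ab(1)] by metis
      have "closed_segment a b \<subseteq> ball a \<delta> \<inter> K"
        using ab \<delta>(1) K(2) by (intro closed_segment_subset convex_Int) auto
      then have inV: "(s \<circ> linepath a b) t \<in> V" if "t \<in> {0..1}" for t
        using V(2) linepath_in_path[OF that, of a b] by auto
      from has_path_integral_local[OF V(1), of "s \<circ> linepath a b", OF inV]
      show "\<exists>I. has_path_integral \<omega> (s \<circ> linepath a b) I" by blast
    qed
  next
    case (Suc n)
    show ?case
    proof (intro ballI impI)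
      fix a b assume ab: "a \<in> K" "b \<in> K" "dist a b < 2 ^ Suc n * \<delta>"
      let ?m = "midpoint a b"
      have m: "?m \<in> K" using ab by (intro midpoint_in)
      have "dist a ?m < 2 ^ n * \<delta>" "dist ?m b < 2 ^ n * \<delta>"
        using ab(3) by (simp_all add: dist_midpoint)
      then obtain I I' where "has_path_integral \<omega> (s \<circ> linepath a ?m) I" "has_path_integral \<omega> (s \<circ> linepath ?m b) I'"
        using Suc ab m by metis
      from has_path_integral_glue[OF pathin_segment[OF ab(1) m] this(1) pathin_segment[OF m ab(2)] this(2)]
      show "\<exists>I. has_path_integral \<omega> (s \<circ> linepath a b) I"
        unfolding glue_linepath by (auto simp: linepath_0' linepath_1')
    qed
  qed
  moreover obtain n :: nat where "dist a b / \<delta> < 2 ^ n"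
    using real_arch_pow[of 2 "dist a b / \<delta>"] by auto
  then have "dist a b < 2 ^ n * \<delta>" using \<delta>(1) by (simp add: field_simps)
  ultimately show ?thesis using assms by blast
qed

lemma has_segment_integral:
  assumes "a \<in> K" "b \<in> K"
  shows "has_path_integral \<omega> (s \<circ> linepath a b) (J a b)"
proof -
  obtain I where I: "has_path_integral \<omega> (s \<circ> linepath a b) I"
    using segment_integral_exists[OF assms] by blast
  have "J a b = I"
    unfolding J_def using pathin_segment[OF assms] I by (rule path_integral_eqI)
  then show ?thesis using I by simp
qed

lemma J_eqI: "a \<in> K \<Longrightarrow> b \<in> K \<Longrightarrow> has_path_integral \<omega> (s \<circ> linepath a b) I \<Longrightarrow> J a b = I"
  unfolding J_def using pathin_segment by (intro path_integral_eqI)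

lemma J_midpoint:
  assumes "a \<in> K" "b \<in> K"
  shows "J a b = J a (midpoint a b) + J (midpoint a b) b"
proof (rule J_eqI[OF assms])
  note m = midpoint_in[OF assms]
  have "has_path_integral \<omega> (glue (s \<circ> linepath a (midpoint a b)) (s \<circ> linepath (midpoint a b) b))
      (J a (midpoint a b) + J (midpoint a b) b)"
    by (rule has_path_integral_glue[OF pathin_segment[OF assms(1) m] has_segment_integral[OF assms(1) m]
          pathin_segment[OF m assms(2)] has_segment_integral[OF m assms(2)]])
       (simp add: linepath_0' linepath_1')
  then show "has_path_integral \<omega> (s \<circ> linepath a b) (J a (midpoint a b) + J (midpoint a b) b)"
    by (simp only: glue_linepath)
qed

lemma J_reverse:
  assumes "a \<in> K" "b \<in> K"
  shows "J b a = - J a b"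
proof (rule J_eqI[OF assms(2,1)])
  have "(\<lambda>t. (s \<circ> linepath a b) (1 - t)) = s \<circ> linepath b a"
    by (rule ext) (simp add: linepath_def add.commute)
  then show "has_path_integral \<omega> (s \<circ> linepath b a) (- J a b)"
    using has_path_integral_reverse[OF has_segment_integral[OF assms]] by simp
qed

text \<open>Small triangles lie in the domain of a primitive; a large one is the sum of the four triangles cut
  off by the midpoints of its sides.\<close>

lemma J_triangle:
  assumes "a \<in> K" "b \<in> K" "c \<in> K"
  shows "J a b + J b c + J c a = 0"
proof -
  obtain \<delta> where \<delta>: "\<delta> > 0" "\<And>x. x \<in> K \<Longrightarrow> \<exists>V g. local_primitive \<omega> V g \<and> s ` (ball x \<delta> \<inter> K) \<subseteq> V"
    using uniform_local_primitives by metis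
  have "\<forall>a\<in>K. \<forall>b\<in>K. \<forall>c\<in>K. dist a b < 2 ^ n * \<delta> \<longrightarrow> dist b c < 2 ^ n * \<delta> \<longrightarrow> dist c a < 2 ^ n * \<delta> \<longrightarrow>
      J a b + J b c + J c a = 0" for n
  proof (induction n)
    case 0
    show ?case
    proof (intro ballI impI)
      fix a b c assume K': "a \<in> K" "b \<in> K" "c \<in> K"
        and d: "dist a b < 2 ^ 0 * \<delta>" "dist b c < 2 ^ 0 * \<delta>" "dist c a < 2 ^ 0 * \<delta>"
      obtain V g where V: "local_primitive \<omega> V g" "s ` (ball a \<delta> \<inter> K) \<subseteq> V"
        using \<delta>(2)[OF K'(1)] by metis
      have in_ball: "a \<in> ball a \<delta> \<inter> K" "b \<in> ball a \<delta> \<inter> K" "c \<in> ball a \<delta> \<inter> K"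
        using K' d \<delta>(1) by (auto simp: dist_commute)
      have "J x y = g (s y) - g (s x)" if "x \<in> ball a \<delta> \<inter> K" "y \<in> ball a \<delta> \<inter> K" for x y
      proof (rule J_eqI)
        have "closed_segment x y \<subseteq> ball a \<delta> \<inter> K"
          using that K(2) by (intro closed_segment_subset convex_Int) auto
        then have inV: "(s \<circ> linepath x y) t \<in> V" if "t \<in> {0..1}" for t
          using V(2) linepath_in_path[OF that, of x y] by auto
        from has_path_integral_local[OF V(1), of "s \<circ> linepath x y", OF inV]
        show "has_path_integral \<omega> (s \<circ> linepath x y) (g (s y) - g (s x))"
          by (simp add: linepath_0' linepath_1')
      qed (use that in auto)
      then show "J a b + J b c + J c a = 0" using in_ball by simp
    qed
  next
    case (Suc n)
    show ?case
    proof (intro ballI impI)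
      fix a b c assume K': "a \<in> K" "b \<in> K" "c \<in> K"
        and d: "dist a b < 2 ^ Suc n * \<delta>" "dist b c < 2 ^ Suc n * \<delta>" "dist c a < 2 ^ Suc n * \<delta>"
      define p q r where "p = midpoint a b" and "q = midpoint b c" and "r = midpoint c a"
      have m: "p \<in> K" "q \<in> K" "r \<in> K"
        unfolding p_def q_def r_def using K' by (auto intro!: midpoint_in)
      have half: "dist (midpoint x y) (midpoint z y) = dist x z / 2" for x y z :: 'a
      proof -
        have "midpoint x y - midpoint z y = (1/2) *\<^sub>R (x - z)" by (simp add: midpoint_def algebra_simps)
        then show ?thesis by (simp add: dist_norm)
      qed
      have dm: "dist a p < 2 ^ n * \<delta>" "dist p b < 2 ^ n * \<delta>" "dist b q < 2 ^ n * \<delta>" "dist q c < 2 ^ n * \<delta>"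
        "dist c r < 2 ^ n * \<delta>" "dist r a < 2 ^ n * \<delta>"
        using d by (simp_all add: dist_midpoint p_def q_def r_def)
      have dm': "dist p q < 2 ^ n * \<delta>" "dist q r < 2 ^ n * \<delta>" "dist r p < 2 ^ n * \<delta>"
        using d half[of a b c] half[of b c a] half[of c a b]
        by (simp_all add: p_def q_def r_def midpoint_sym dist_commute)
      have four: "J a p + J p r + J r a = 0" "J b q + J q p + J p b = 0" "J c r + J r q + J q c = 0"
        "J p q + J q r + J r p = 0"
        using Suc K' m dm dm' by (simp_all add: dist_commute)
      have "J a b = J a p + J p b" "J b c = J b q + J q c" "J c a = J c r + J r a"
        unfolding p_def q_def r_def using K' by (auto intro!: J_midpoint)
      moreover have "J p r = - J r p" "J q p = - J p q" "J r q = - J q r"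
        using m by (auto intro!: J_reverse)
      ultimately have "J a b + J b c + J c a =
          (J a p + J p r + J r a) + (J b q + J q p + J p b) + (J c r + J r q + J q c) + (J p q + J q r + J r p)"
        by (simp only:) simp
      then show "J a b + J b c + J c a = 0"
        using four by (simp only:) simp
    qed
  qed
  moreover obtain n :: nat where "(dist a b + dist b c + dist c a) / \<delta> < 2 ^ n"
    using real_arch_pow[of 2 "(dist a b + dist b c + dist c a) / \<delta>"] by auto
  then have "dist a b + dist b c + dist c a < 2 ^ n * \<delta>" using \<delta>(1) by (simp add: field_simps)
  then have "dist a b < 2 ^ n * \<delta>" "dist b c < 2 ^ n * \<delta>" "dist c a < 2 ^ n * \<delta>"
    using zero_le_dist[of a b] zero_le_dist[of b c] zero_le_dist[of c a] by linarith+
  ultimately show ?thesis using assms by blast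
qed

end

lemma has_path_integral_path_integral:
  assumes "\<omega> \<in> holomorphic_differentials" "pathin klein_top \<gamma>"
  shows "has_path_integral \<omega> \<gamma> (path_integral \<omega> \<gamma>)"
proof -
  interpret convex_map \<omega> "{0..1::real}" \<gamma>
    using assms by unfold_locales (auto simp: pathin_def)
  have "\<gamma> \<circ> linepath 0 1 = \<gamma>"
    by (rule ext) (simp add: linepath_def)
  then show ?thesis
    using has_segment_integral[of 0 1] by (simp add: J_def)
qed

text \<open>Barycentric coordinates of the triangle with vertices \<open>(0, 0)\<close>, \<open>(1, 0)\<close>, \<open>(0, 1)\<close>.\<close>

definition triangle_point :: "real \<times> real \<Rightarrow> nat \<Rightarrow> real" where
  "triangle_point = (\<lambda>(x, y) i. if i = 0 then 1 - x - y else if i = 1 then x else if i = 2 then y else 0)"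

lemma edge_point_in_simplex:
  assumes "t \<in> {0..1}"
  shows "(\<lambda>i. if i = 0 then 1 - t else if i = 1 then t else 0) \<in> standard_simplex 1"
proof -
  have "{..1::nat} = {0, 1}" by auto
  then show ?thesis using assms by (auto simp: standard_simplex_def)
qed

text \<open>The faces of a singular 2-simplex are the sides of the triangle, the middle one reversed.\<close>

lemma singular_face_integrals:
  assumes \<omega>: "\<omega> \<in> holomorphic_differentials" and f: "singular_simplex 2 klein_top f"
  defines "I k \<equiv> path_integral \<omega> (path_of_simplex (singular_face 2 k f))"
  shows "I 0 - I 1 + I 2 = 0"
proof -
  let ?K = "{(x, y). 0 \<le> x \<and> 0 \<le> y \<and> x + y \<le> (1::real)}"
  have K_alt: "?K = convex hull {(0,0), (1,0), (0,1)}"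
  proof -
    have "(x, y) \<in> convex hull {(0,0), (1,0), (0,1::real)} \<longleftrightarrow> 0 \<le> x \<and> 0 \<le> y \<and> x + y \<le> 1" for x y :: real
    proof -
      have "(x, y) \<in> convex hull {(0,0), (1,0), (0,1::real)} \<longleftrightarrow>
          (\<exists>u v w. 0 \<le> u \<and> 0 \<le> v \<and> 0 \<le> w \<and> u + v + w = 1 \<and> x = v \<and> y = w)"
        unfolding convex_hull_3 by simp
      also have "\<dots> \<longleftrightarrow> 0 \<le> x \<and> 0 \<le> y \<and> x + y \<le> 1"
        by (auto intro!: exI[of _ "1 - x - y"])
      finally show ?thesis .
    qed
    then show ?thesis by auto
  qed
  have tp: "triangle_point p \<in> standard_simplex 2" if "p \<in> ?K" for p
  proof -
    have "{..2::nat} = {0, 1, 2}" by auto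
    then show ?thesis
      using that by (auto simp: standard_simplex_def triangle_point_def)
  qed
  have "continuous_map (top_of_set ?K) (subtopology (powertop_real UNIV) (standard_simplex 2)) triangle_point"
    unfolding continuous_map_in_subtopology continuous_map_componentwise_UNIV
  proof (intro conjI allI)
    fix i :: nat
    have "continuous_on ?K (\<lambda>p. if i = 0 then 1 - fst p - snd p else if i = 1 then fst p else if i = 2 then snd p else 0)"
      by (cases "i = 0"; cases "i = 1"; cases "i = 2"; simp; intro continuous_intros)
    moreover have "(\<lambda>x. triangle_point x i) =
        (\<lambda>p. if i = 0 then 1 - fst p - snd p else if i = 1 then fst p else if i = 2 then snd p else 0)"
      by (simp add: triangle_point_def case_prod_unfold fun_eq_iff)
    ultimately show "continuous_map (top_of_set ?K) euclideanreal (\<lambda>x. triangle_point x i)"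
      by (simp only: continuous_map_iff_continuous)
  qed (use tp in auto)
  then have "continuous_map (top_of_set ?K) klein_top (f \<circ> triangle_point)"
    using f unfolding singular_simplex_def by (intro continuous_map_compose) auto
  then interpret convex_map \<omega> ?K "f \<circ> triangle_point"
    using \<omega> by unfold_locales (auto simp: K_alt compact_convex_hull finite_imp_compact)
  have face: "I k = J a b" if "\<And>t. t \<in> {0..1} \<Longrightarrow>
      simplical_face k (\<lambda>i. if i = 0 then 1 - t else if i = 1 then t else 0) = triangle_point (linepath a b t)" for k a b
    unfolding I_def J_def
  proof (rule path_integral_cong)
    fix t :: real assume t: "t \<in> {0..1}"
    then have "(\<lambda>i. if i = 0 then 1 - t else if i = 1 then t else 0) \<in> standard_simplex 1"
      by (rule edge_point_in_simplex)
    then show "path_of_simplex (singular_face 2 k f) t = (f \<circ> triangle_point \<circ> linepath a b) t"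
      using that[OF t] by (simp add: path_of_simplex_def singular_face_def)
  qed
  have "I 0 = J (1, 0) (0, 1)"
    by (rule face) (auto simp: simplical_face_def triangle_point_def linepath_def fun_eq_iff)
  moreover have "I 1 = J (0, 0) (0, 1)"
    by (rule face) (auto simp: simplical_face_def triangle_point_def linepath_def fun_eq_iff)
  moreover have "I 2 = J (0, 0) (1, 0)"
    by (rule face) (auto simp: simplical_face_def triangle_point_def linepath_def fun_eq_iff)
  ultimately show ?thesis
    using J_triangle[of "(1, 0)" "(0, 1)" "(0, 0)"] J_reverse[of "(0, 0)" "(0, 1)"] by simp
qed

lemma chain_integral_superset:
  assumes "finite S" "Poly_Mapping.keys c \<subseteq> S"
  shows "chain_integral \<omega> c = (\<Sum>s\<in>S. of_int (Poly_Mapping.lookup c s) * path_integral \<omega> (path_of_simplex s))"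
  unfolding chain_integral_def using assms
  by (intro sum.mono_neutral_left) (auto simp: in_keys_iff)

lemma chain_integral_diff: "chain_integral \<omega> (c - d) = chain_integral \<omega> c - chain_integral \<omega> d"
proof -
  let ?S = "Poly_Mapping.keys c \<union> Poly_Mapping.keys d"
  have "Poly_Mapping.keys (c - d) \<subseteq> ?S" by (rule keys_diff)
  then show ?thesis
    using chain_integral_superset[of ?S c] chain_integral_superset[of ?S d] chain_integral_superset[of ?S "c - d"]
    by (simp add: lookup_minus left_diff_distrib sum_subtractf)
qed

lemma chain_integral_add: "chain_integral \<omega> (c + d) = chain_integral \<omega> c + chain_integral \<omega> d"
  using chain_integral_diff[of \<omega> "c + d" d] by simp

lemma chain_integral_0 [simp]: "chain_integral \<omega> 0 = 0"
  by (simp add: chain_integral_def)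

lemma chain_integral_frag_of [simp]: "chain_integral \<omega> (frag_of s) = path_integral \<omega> (path_of_simplex s)"
  by (simp add: chain_integral_def)

lemma chain_integral_boundary:
  assumes \<omega>: "\<omega> \<in> holomorphic_differentials" and d: "singular_chain 2 klein_top d"
  shows "chain_integral \<omega> (chain_boundary 2 d) = 0"
  using d unfolding singular_chain_def
proof (induction d rule: frag_induction)
  case (one f)
  have "chain_boundary 2 (frag_of f) =
      frag_of (singular_face 2 0 f) - frag_of (singular_face 2 1 f) + frag_of (singular_face 2 2 f)"
    by (simp add: chain_boundary_of numeral_2_eq_2)
  moreover have "singular_simplex 2 klein_top f" using one by simp
  ultimately show ?case
    using singular_face_integrals[OF \<omega>, of f] by (simp add: chain_integral_diff chain_integral_add)
qed (simp_all add: chain_boundary_diff chain_integral_diff)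

lemma path_of_simplex_of_path:
  assumes "t \<in> {0..1}"
  shows "path_of_simplex (simplex_of_path \<gamma>) t = \<gamma> t"
  using edge_point_in_simplex[OF assms] by (simp add: path_of_simplex_def simplex_of_path_def)

text \<open>The elements of the class differ from the loop by boundaries, on which the integral vanishes.\<close>

lemma period_loop_class:
  assumes \<omega>: "\<omega> \<in> holomorphic_differentials"
  shows "period \<omega> (loop_class \<gamma>) = path_integral \<omega> \<gamma>"
proof -
  let ?c = "frag_of (simplex_of_path \<gamma>)"
  have c: "chain_integral \<omega> ?c = path_integral \<omega> \<gamma>"
    unfolding chain_integral_frag_of by (rule path_integral_cong) (rule path_of_simplex_of_path)
  have "chain_integral \<omega> d = path_integral \<omega> \<gamma>" if "d \<in> loop_class \<gamma>" for d
  proof -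
    have "singular_relboundary 1 klein_top {} (?c - d)"
      using that by (simp add: loop_class_def homologous_rel_def)
    then obtain e where "singular_chain 2 klein_top e" "chain_boundary 2 e = ?c - d"
      by (auto simp: singular_boundary numeral_2_eq_2)
    then show ?thesis
      using chain_integral_boundary[OF \<omega>, of e] c by (simp add: chain_integral_diff)
  qed
  moreover have "?c \<in> loop_class \<gamma>"
    by (simp add: loop_class_def)
  ultimately show ?thesis
    unfolding period_def by (intro the_equality) (use c in auto)
qed

lemma loop_class_cong:
  assumes "\<And>t. t \<in> {0..1} \<Longrightarrow> \<gamma> t = \<gamma>' t"
  shows "loop_class \<gamma> = loop_class \<gamma>'"
proof -
  have "simplex_of_path \<gamma> = simplex_of_path \<gamma>'"
    unfolding simplex_of_path_def using assms
    by (intro restrict_ext) (auto simp: standard_simplex_def)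
  then show ?thesis by (simp add: loop_class_def)
qed

lemma singular_simplex_of_path:
  assumes "pathin X \<gamma>"
  shows "singular_simplex 1 X (simplex_of_path \<gamma>)"
proof -
  have "continuous_map (powertop_real UNIV) euclideanreal (\<lambda>x. x (1::nat))"
    by (rule continuous_map_product_projection) simp
  then have "continuous_map (subtopology (powertop_real UNIV) (standard_simplex 1)) (top_of_set {0..1}) (\<lambda>x. x (1::nat))"
    by (auto simp: continuous_map_in_subtopology standard_simplex_def intro: continuous_map_from_subtopology)
  then have "continuous_map (subtopology (powertop_real UNIV) (standard_simplex 1)) X (\<gamma> \<circ> (\<lambda>x. x 1))"
    using assms unfolding pathin_def by (rule continuous_map_compose)
  then have "continuous_map (subtopology (powertop_real UNIV) (standard_simplex 1)) X (simplex_of_path \<gamma>)"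
    by (rule continuous_map_eq) (auto simp: simplex_of_path_def)
  then show ?thesis
    by (simp add: singular_simplex_def simplex_of_path_def)
qed

lemma sigma_star_loop_class:
  assumes \<gamma>: "pathin klein_top \<gamma>" "\<gamma> 0 = \<gamma> 1"
  shows "sigma_star (loop_class \<gamma>) = loop_class (klein_sigma \<circ> \<gamma>)"
proof -
  let ?f = "simplex_of_path \<gamma>"
  have f: "singular_simplex 1 klein_top ?f" using \<gamma>(1) by (rule singular_simplex_of_path)
  have face: "singular_face 1 k ?f = restrict (\<lambda>_. \<gamma> 0) (standard_simplex 0)" if k: "k = 0 \<or> k = 1" for k
    unfolding singular_face_def
  proof (simp, rule restrict_ext)
    fix x :: "nat \<Rightarrow> real" assume x: "x \<in> standard_simplex 0"
    then have "simplical_face k x \<in> standard_simplex 1"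
      using k simplical_face_in_standard_simplex[of 1 k x] by auto
    moreover have "simplical_face k x 1 = (if k = 0 then 1 else 0)"
      using x k by (auto simp: simplical_face_def standard_simplex_def)
    ultimately show "(?f \<circ> simplical_face k) x = \<gamma> 0"
      using \<gamma>(2) by (simp add: simplex_of_path_def)
  qed
  have "singular_face 1 0 ?f = singular_face 1 1 ?f"
    using face[of 0] face[of 1] by simp
  then have "chain_boundary 1 (frag_of ?f) = 0"
    by (simp add: chain_boundary_of)
  then have cyc: "singular_relcycle 1 klein_top {} (frag_of ?f)"
    using f by (simp add: singular_cycle singular_chain_of)
  have "sigma_star (loop_class \<gamma>) = homologous_rel_set 1 klein_top {} (chain_map 1 klein_sigma (frag_of ?f))"
    unfolding sigma_star_def loop_class_def
    using hom_induced_chain_map[OF continuous_map_klein_sigma _ cyc, of "{}"] by simp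
  also have "chain_map 1 klein_sigma (frag_of ?f) = frag_of (simplex_map 1 klein_sigma ?f)"
    by simp
  also have "simplex_map 1 klein_sigma ?f = simplex_of_path (klein_sigma \<circ> \<gamma>)"
    by (rule ext) (simp add: simplex_map_def simplex_of_path_def)
  finally show ?thesis by (simp add: loop_class_def)
qed

section \<open>Primitives in the chart\<close>

text \<open>The seventh power of \<open>base_pt\<close> is the value of \<open>t\<close> at \<open>z = 0\<close>; its images under powers of \<open>zeta\<close> are the seven
  points over \<open>z = 0\<close>.\<close>

definition zeta :: complex where "zeta = exp (2 * of_real pi * \<i> / 7)"

definition base_pt :: complex where "base_pt = exp (of_real pi * \<i> / 21)"

lemma zeta_power_7: "zeta ^ 7 = 1"
proof -
  have "of_nat 7 * (2 * of_real pi * \<i> / 7) = 2 * of_real pi * \<i>" by simp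
  then show ?thesis
    unfolding zeta_def exp_of_nat_mult[symmetric] by (simp only: exp_two_pi_i)
qed

lemma zeta_nonzero [simp]: "zeta \<noteq> 0"
  by (simp add: zeta_def)

lemma zeta_base_pt: "zeta = base_pt ^ 6"
  unfolding zeta_def base_pt_def exp_of_nat_mult[symmetric] by (rule arg_cong[of _ _ exp]) simp

lemma zeta_power_mod: "zeta ^ n = zeta ^ (n mod 7)"
proof -
  have "zeta ^ n = zeta ^ (7 * (n div 7) + n mod 7)" by simp
  then show ?thesis by (simp only: power_add power_mult zeta_power_7 power_one mult_1_left)
qed

text \<open>The eigenvalues \<open>\<zeta>\<^sup>2\<close>, \<open>\<zeta>\<close>, \<open>\<zeta>\<^sup>4\<close> of the order 7 automorphism \<open>u \<mapsto> \<zeta> u\<close> on the differentials.\<close>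

definition weight :: "3 \<Rightarrow> nat" where
  "weight j = (if j = 1 then 2 else if j = 2 then 1 else 4)"

lemma weight_simps [simp]: "weight 1 = 2" "weight 2 = 1" "weight 3 = 4"
  by (simp_all add: weight_def)

lemma zeta_mult_power: "(zeta ^ n * u) ^ 7 = u ^ 7"
proof -
  have "(zeta ^ n) ^ 7 = (zeta ^ 7) ^ n" by (simp only: power_mult[symmetric] mult.commute)
  then show ?thesis by (simp add: power_mult_distrib zeta_power_7)
qed

lemma zeta_mult_slit [simp]: "zeta ^ n * u \<in> slit_domain \<longleftrightarrow> u \<in> slit_domain"
  by (simp add: slit_domain_def zeta_mult_power)

lemma zeta_mult_croot [simp]: "croot (zeta ^ n * u) = croot u"
  by (simp add: croot_def zeta_mult_power)

lemma chart_coeff_nth: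
  "chart_coeff 1 u = - u / croot u ^ 3" "chart_coeff 2 u = 1 / croot u ^ 5" "chart_coeff 3 u = u ^ 3 / croot u ^ 6"
  unfolding chart_coeff_def chart_vec_nth by (simp_all add: power_numeral_reduce)

definition prim :: "3 \<Rightarrow> complex \<Rightarrow> complex" where
  "prim j = (SOME G. (\<forall>u\<in>slit_domain. (G has_field_derivative chart_coeff j u) (at u)) \<and> G 0 = 0)"

lemma prim:
  "u \<in> slit_domain \<Longrightarrow> (prim j has_field_derivative chart_coeff j u) (at u)" "prim j 0 = 0"
proof -
  note hol = holomorphic_on_chart_coeff[of j]
  obtain G where G: "\<And>u. u \<in> slit_domain \<Longrightarrow> (G has_field_derivative chart_coeff j u) (at u)"
    using holomorphic_starlike_primitive[OF holomorphic_on_imp_continuous_on[OF hol] starlike_slit_domain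
        open_slit_domain finite.emptyI] holomorphic_on_imp_differentiable_at[OF hol open_slit_domain]
    by auto
  have "((\<lambda>u. G u - G 0) has_field_derivative chart_coeff j u) (at u)" if "u \<in> slit_domain" for u
    using DERIV_diff[OF G[OF that] DERIV_const[of "G 0"]] by simp
  then have "\<exists>G. (\<forall>u\<in>slit_domain. (G has_field_derivative chart_coeff j u) (at u)) \<and> G 0 = 0"
    by (intro exI[of _ "\<lambda>u. G u - G 0"]) simp
  then have "(\<forall>u\<in>slit_domain. (prim j has_field_derivative chart_coeff j u) (at u)) \<and> prim j 0 = 0"
    unfolding prim_def by (rule someI_ex)
  then show "u \<in> slit_domain \<Longrightarrow> (prim j has_field_derivative chart_coeff j u) (at u)" "prim j 0 = 0"
    by auto
qed

lemma chart_coeff_zeta: "chart_coeff j (zeta * u) * zeta = zeta ^ weight j * chart_coeff j u"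
proof -
  have c: "croot (zeta * u) = croot u" using zeta_mult_croot[of 1 u] by simp
  have "chart_coeff 1 (zeta * u) * zeta = zeta ^ 2 * chart_coeff 1 u"
    "chart_coeff 2 (zeta * u) * zeta = zeta ^ 1 * chart_coeff 2 u"
    "chart_coeff 3 (zeta * u) * zeta = zeta ^ 4 * chart_coeff 3 u"
    unfolding chart_coeff_nth c by (simp_all add: power_numeral_reduce)
  then show ?thesis using exhaust_3[of j] by auto
qed

lemma prim_zeta:
  assumes "u \<in> slit_domain"
  shows "prim j (zeta ^ n * u) = zeta ^ (n * weight j) * prim j u"
proof -
  have step: "prim j (zeta * u) = zeta ^ weight j * prim j u" if u: "u \<in> slit_domain" for u
  proof -
    have der0: "((\<lambda>u. prim j (zeta * u) - zeta ^ weight j * prim j u) has_field_derivative 0) (at u)"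
      if u: "u \<in> slit_domain" for u
    proof -
      have "zeta * u \<in> slit_domain" using u zeta_mult_slit[of 1 u] by simp
      have "((\<lambda>u. zeta * u) has_field_derivative zeta) (at u)"
        by (auto intro!: derivative_eq_intros)
      from DERIV_chain2[OF prim(1)[OF \<open>zeta * u \<in> slit_domain\<close>] this]
      have "((\<lambda>u. prim j (zeta * u)) has_field_derivative chart_coeff j (zeta * u) * zeta) (at u)" .
      from DERIV_diff[OF this DERIV_cmult[OF prim(1)[OF u, of j], of "zeta ^ weight j"]]
      show ?thesis by (simp add: chart_coeff_zeta)
    qed
    have "(\<lambda>u. prim j (zeta * u) - zeta ^ weight j * prim j u) constant_on slit_domain"
      using der0 connected_slit_domain open_slit_domain by (rule has_field_derivative_0_imp_constant_on)
    then have "prim j (zeta * u) - zeta ^ weight j * prim j u = prim j (zeta * 0) - zeta ^ weight j * prim j 0"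
      using u zero_in_slit_domain unfolding constant_on_def by metis
    then show ?thesis by (simp add: prim(2))
  qed
  show ?thesis
  proof (induction n)
    case (Suc n)
    have "prim j (zeta * (zeta ^ n * u)) = zeta ^ weight j * prim j (zeta ^ n * u)"
      using assms by (intro step) simp
    then show ?case using Suc by (simp add: power_add mult.assoc)
  qed simp
qed

section \<open>Crossing from one chart to the next\<close>

text \<open>On the arc the point \<open>t = exp (i \<theta>)\<close> goes from \<open>t(z = 0) = exp (i \<pi> / 3)\<close> to \<open>t(z = \<infinity>) = exp (- i \<pi> / 3)\<close> across the
  negative real axis.  The rotated coordinate \<open>1 / (1 - t)\<close> has real part \<open>1 / 2\<close> there, so that the arc lies
  in the domains of two charts, with \<open>u\<close>-coordinates \<open>v = arc_pt \<theta>\<close> and \<open>1 / croot v\<close>.\<close>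

definition arc_pt :: "real \<Rightarrow> complex" where
  "arc_pt \<theta> = exp (\<i> * of_real \<theta> / 7)"

text \<open>The factorization \<open>1 - exp (i \<theta>) = 2 sin (\<theta> / 2) exp (i (\<theta> - \<pi>) / 2)\<close> gives the principal logarithms of
  both \<open>1 - t\<close> and \<open>1 - 1 / (1 - t) = - t / (1 - t)\<close>.  The last claim says that the two charts differ by the
  rotation of coordinates and a power of \<open>u \<mapsto> \<zeta> u\<close>.\<close>

lemma arc_facts:
  assumes \<theta>: "pi / 3 \<le> \<theta>" "\<theta> \<le> 5 * pi / 3"
  defines "lam \<equiv> of_real (ln (2 * sin (\<theta> / 2))) :: complex" and "mu \<equiv> \<i> * of_real ((\<theta> - pi) / 2)"
  shows "arc_pt \<theta> \<in> slit_domain" "1 / croot (arc_pt \<theta>) \<in> slit_domain"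
    "croot (arc_pt \<theta>) = exp ((lam + mu) / 7)"
    "croot (1 / croot (arc_pt \<theta>)) = exp (- (of_real pi * \<i>) / 7) * arc_pt \<theta> / croot (arc_pt \<theta>)"
proof -
  have sin_pos: "sin (\<theta> / 2) > 0"
  proof (rule sin_gt_zero)
    show "0 < \<theta> / 2" "\<theta> / 2 < pi" using \<theta> pi_gt_zero by linarith+
  qed
  have euler: "exp (\<i> * of_real x) = of_real (cos x) + \<i> * of_real (sin x)" for x
    unfolding cis_conv_exp[symmetric] by (simp add: complex_eq_iff)
  have expl: "exp lam = of_real (2 * sin (\<theta> / 2))"
    using sin_pos unfolding lam_def by (simp add: exp_of_real)
  have arc7: "arc_pt \<theta> ^ 7 = exp (\<i> * of_real \<theta>)"
    by (simp add: arc_pt_def flip: exp_of_nat_mult)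
  have expm: "exp mu = - \<i> * exp (\<i> * of_real (\<theta> / 2))"
  proof -
    have "exp (\<i> * of_real (- (pi / 2))) = - \<i>"
      unfolding cis_conv_exp[symmetric] by (simp add: complex_eq_iff)
    moreover have "exp mu = exp (\<i> * of_real (\<theta> / 2)) * exp (\<i> * of_real (- (pi / 2)))"
      unfolding exp_add[symmetric] by (simp add: mu_def field_simps)
    ultimately show ?thesis by simp
  qed
  have one_minus: "1 - arc_pt \<theta> ^ 7 = exp (lam + mu)"
  proof -
    have "exp (\<i> * of_real \<theta>) = (exp (\<i> * of_real (\<theta> / 2))) ^ 2"
      unfolding exp_of_nat_mult[symmetric] by simp
    also have "\<dots> = (of_real (cos (\<theta> / 2)) + \<i> * of_real (sin (\<theta> / 2))) ^ 2"
      by (simp only: euler)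
    finally have e: "exp (\<i> * of_real \<theta>) = (of_real (cos (\<theta> / 2)) + \<i> * of_real (sin (\<theta> / 2))) ^ 2" .
    have "(of_real (cos (\<theta> / 2)) :: complex) ^ 2 + of_real (sin (\<theta> / 2)) ^ 2 = 1"
      by (metis of_real_1 of_real_add of_real_power sin_cos_squared_add2 add.commute)
    then have "1 - exp (\<i> * of_real \<theta>) = of_real (2 * sin (\<theta> / 2)) * (- \<i> * (of_real (cos (\<theta> / 2)) + \<i> * of_real (sin (\<theta> / 2))))"
      unfolding e by (simp add: power2_eq_square algebra_simps)
    then show ?thesis
      unfolding arc7 exp_add expl expm euler .
  qed
  have Im: "Im (lam + mu) = (\<theta> - pi) / 2" "Im (mu - lam) = (\<theta> - pi) / 2"
    by (simp_all add: lam_def mu_def)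
  have bound: "- pi < (\<theta> - pi) / 2 \<and> (\<theta> - pi) / 2 < pi"
  proof
    have "0 < \<theta> + pi" "\<theta> < 3 * pi" using \<theta> pi_gt_zero by linarith+
    then show "- pi < (\<theta> - pi) / 2" "(\<theta> - pi) / 2 < pi" by (simp_all add: field_simps)
  qed
  have Ln1: "Ln (1 - arc_pt \<theta> ^ 7) = lam + mu"
    unfolding one_minus using bound Im by (intro Ln_exp) simp_all
  have nonneg: "exp z \<notin> \<real>\<^sub>\<le>\<^sub>0" if "\<bar>Im z\<bar> < pi" for z
  proof
    assume "exp z \<in> \<real>\<^sub>\<le>\<^sub>0"
    then obtain r where r: "exp z = of_real r" "r \<le> 0" by (auto elim!: nonpos_Reals_cases)
    have "r \<noteq> 0" using r by (metis exp_not_eq_zero of_real_0)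
    have "Ln (exp z) = z" using that by (intro Ln_exp) auto
    moreover have "Im (Ln (of_real r)) = pi"
      using r \<open>r \<noteq> 0\<close> by (simp add: Im_Ln_eq_pi complex_eq_iff less_le)
    ultimately show False using that r by auto
  qed
  have babs: "\<bar>(\<theta> - pi) / 2\<bar> < pi"
  proof -
    have "\<bar>x\<bar> < pi" if "- pi < x \<and> x < pi" for x :: real
      using that by (simp add: abs_less_iff minus_less_iff)
    then show ?thesis using bound by blast
  qed
  have nn: "exp (lam + mu) \<notin> \<real>\<^sub>\<le>\<^sub>0" "exp (mu - lam) \<notin> \<real>\<^sub>\<le>\<^sub>0"
    by (rule nonneg, use Im babs in \<open>simp only:\<close>)+
  show sl: "arc_pt \<theta> \<in> slit_domain"
    using nn(1) by (simp only: slit_domain_def mem_Collect_eq one_minus not_False_eq_True)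
  show cr: "croot (arc_pt \<theta>) = exp ((lam + mu) / 7)"
    unfolding croot_def Ln1 ..
  have w7: "(1 / croot (arc_pt \<theta>)) ^ 7 = exp (- (lam + mu))"
    by (simp only: power_one_over croot_power[OF sl] one_minus exp_minus inverse_eq_divide)
  have "exp (\<i> * of_real \<theta>) = - exp (2 * mu)"
  proof -
    have "2 * mu = \<i> * of_real \<theta> - of_real pi * \<i>" by (simp add: mu_def field_simps)
    then show ?thesis by (simp only: exp_diff exp_pi_i) simp
  qed
  then have one_minus': "1 - (1 / croot (arc_pt \<theta>)) ^ 7 = exp (mu - lam)"
  proof -
    assume e: "exp (\<i> * of_real \<theta>) = - exp (2 * mu)"
    have h: "exp (lam + mu) - 1 = exp (2 * mu)" using one_minus[symmetric] unfolding arc7 e by simp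
    have "exp (lam + mu) * exp (- (lam + mu)) = 1"
      unfolding exp_add[symmetric] by simp
    then have "exp (lam + mu) * (1 - exp (- (lam + mu))) = exp (2 * mu)"
      by (simp only: right_diff_distrib mult_1_right h)
    also have "\<dots> = exp (lam + mu) * exp (mu - lam)" unfolding exp_add[symmetric] by simp
    finally have "1 - exp (- (lam + mu)) = exp (mu - lam)" by (simp only: mult_cancel_left exp_not_eq_zero simp_thms)
    then show ?thesis unfolding w7 .
  qed
  show "1 / croot (arc_pt \<theta>) \<in> slit_domain"
    using nn(2) by (simp only: slit_domain_def mem_Collect_eq one_minus' not_False_eq_True)
  have Ln2: "Ln (1 - (1 / croot (arc_pt \<theta>)) ^ 7) = mu - lam"
    unfolding one_minus' using bound Im by (intro Ln_exp) simp_all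
  have "exp (- (of_real pi * \<i>) / 7) * arc_pt \<theta> / croot (arc_pt \<theta>) =
      exp (- (of_real pi * \<i>) / 7 + \<i> * of_real \<theta> / 7 - (lam + mu) / 7)"
    unfolding cr unfolding arc_pt_def exp_add exp_diff ..
  also have "- (of_real pi * \<i>) / 7 + \<i> * of_real \<theta> / 7 - (lam + mu) / 7 = (mu - lam) / 7"
    by (simp add: mu_def field_simps)
  finally show "croot (1 / croot (arc_pt \<theta>)) = exp (- (of_real pi * \<i>) / 7) * arc_pt \<theta> / croot (arc_pt \<theta>)"
    unfolding croot_def[of "1 / croot (arc_pt \<theta>)"] Ln2 by simp
qed

text \<open>The factor \<open>v\<^sup>6 / c\<^sup>8\<close> is the derivative of \<open>v \<mapsto> 1 / croot v\<close>: in the overlap of the two charts, \<open>\<eta>\<^sub>j\<close> in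
  one of them is a root of unity times \<open>\<eta>\<^sub>j\<^sub>+\<^sub>2\<close> in the other.\<close>

lemma crossing_coeff:
  assumes \<theta>: "pi / 3 \<le> \<theta>" "\<theta> \<le> 5 * pi / 3"
  defines "v \<equiv> arc_pt \<theta>"
  shows "chart_coeff j (1 / croot v) * (v ^ 6 / croot v ^ 8) = zeta ^ (7 - weight j) * chart_coeff (j + 2) v"
proof -
  define c where "c = croot v"
  \<comment> \<open>All roots of unity that occur are powers of \<open>\<epsilon>\<close>, by \<open>\<epsilon>\<^sup>7 = - 1\<close> and \<open>\<zeta> = \<epsilon>\<^sup>-\<^sup>2\<close>.\<close>
  define \<epsilon> where "\<epsilon> = exp (- (of_real pi * \<i>) / 7)"
  have nz: "c \<noteq> 0" "\<epsilon> \<noteq> 0" "v \<noteq> 0" by (simp_all add: c_def \<epsilon>_def v_def arc_pt_def)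
  have cw: "croot (1 / c) = \<epsilon> * v / c"
    using arc_facts(4)[OF \<theta>] by (simp add: c_def \<epsilon>_def v_def)
  have \<epsilon>7: "\<epsilon> ^ 7 = -1"
  proof -
    have "of_nat 7 * (- (of_real pi * \<i>) / 7) = - (of_real pi * \<i>)" by simp
    then show ?thesis
      unfolding \<epsilon>_def exp_of_nat_mult[symmetric] by (simp only: exp_minus exp_pi_i) simp
  qed
  have "\<epsilon> ^ 2 * zeta = exp (of_nat 2 * (- (of_real pi * \<i>) / 7) + 2 * of_real pi * \<i> / 7)"
    unfolding zeta_def \<epsilon>_def exp_add exp_of_nat_mult ..
  then have z: "\<epsilon> ^ 2 * zeta = 1" by simp
  have z': "zeta ^ (7 - m) = \<epsilon> ^ (2 * m)" if "m \<le> 7" for m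
  proof -
    have "zeta ^ (7 - m) * zeta ^ m = 1"
      unfolding power_add[symmetric] using that zeta_power_7 by simp
    moreover have "\<epsilon> ^ (2 * m) * zeta ^ m = 1"
      unfolding power_mult power_mult_distrib[symmetric] z by simp
    ultimately show ?thesis
      by (metis mult_right_cancel power_not_zero zeta_nonzero)
  qed
  have "chart_coeff 1 (1 / c) * (v ^ 6 / c ^ 8) = zeta ^ (7 - 2) * chart_coeff 3 v"
  proof -
    have "chart_coeff 1 (1 / c) * (v ^ 6 / c ^ 8) = - (v ^ 3) / (\<epsilon> ^ 3 * c ^ 6)"
      unfolding chart_coeff_nth cw using nz by (simp add: field_simps power_numeral_reduce)
    also have "\<dots> = \<epsilon> ^ 7 * v ^ 3 / (\<epsilon> ^ 3 * c ^ 6)" by (simp add: \<epsilon>7)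
    also have "\<dots> = \<epsilon> ^ (2 * 2) * chart_coeff 3 v"
      unfolding chart_coeff_nth using nz by (simp add: c_def field_simps power_numeral_reduce)
    finally show ?thesis by (subst z') auto
  qed
  moreover have "chart_coeff 2 (1 / c) * (v ^ 6 / c ^ 8) = zeta ^ (7 - 1) * chart_coeff 1 v"
  proof -
    have "chart_coeff 2 (1 / c) * (v ^ 6 / c ^ 8) = v / (\<epsilon> ^ 5 * c ^ 3)"
      unfolding chart_coeff_nth cw using nz by (simp add: field_simps power_numeral_reduce)
    also have "\<dots> = - (\<epsilon> ^ 7) * v / (\<epsilon> ^ 5 * c ^ 3)" by (simp add: \<epsilon>7)
    also have "\<dots> = \<epsilon> ^ (2 * 1) * chart_coeff 1 v"
      unfolding chart_coeff_nth using nz by (simp add: c_def field_simps power_numeral_reduce)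
    finally show ?thesis by (subst z') auto
  qed
  moreover have "chart_coeff 3 (1 / c) * (v ^ 6 / c ^ 8) = zeta ^ (7 - 4) * chart_coeff 2 v"
  proof -
    have "chart_coeff 3 (1 / c) * (v ^ 6 / c ^ 8) = 1 / (\<epsilon> ^ 6 * c ^ 5)"
      unfolding chart_coeff_nth cw using nz by (simp add: field_simps power_numeral_reduce)
    also have "\<dots> = (\<epsilon> ^ 7) ^ 2 / (\<epsilon> ^ 6 * c ^ 5)" by (simp add: \<epsilon>7)
    also have "\<dots> = \<epsilon> ^ (2 * 4) * chart_coeff 2 v"
      unfolding chart_coeff_nth using nz by (simp add: c_def field_simps power_numeral_reduce)
    finally show ?thesis by (subst z') auto
  qed
  ultimately show ?thesis
    using exhaust_3[of j] by (auto simp: c_def)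
qed

lemma arc_ends:
  "arc_pt (pi / 3) = base_pt" "arc_pt (5 * pi / 3) = zeta * cnj base_pt"
  "1 / croot base_pt = base_pt" "1 / croot (zeta * cnj base_pt) = cnj base_pt"
  "base_pt \<in> slit_domain" "cnj base_pt \<in> slit_domain"
proof -
  have cnjb: "cnj base_pt = exp (- (of_real pi * \<i>) / 21)"
    by (simp add: base_pt_def exp_cnj)
  show a: "arc_pt (pi / 3) = base_pt"
    by (simp add: arc_pt_def base_pt_def mult.commute)
  show b: "arc_pt (5 * pi / 3) = zeta * cnj base_pt"
    unfolding cnjb by (simp add: arc_pt_def zeta_def field_simps flip: exp_add)
  have r: "pi / 3 \<le> pi / 3" "pi / 3 \<le> 5 * pi / 3" "5 * pi / 3 \<le> 5 * pi / 3"
    using pi_gt_zero by auto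
  have "5 * pi / 3 / 2 = pi - pi / 6" by simp
  then have s: "sin (5 * pi / 3 / 2) = 1 / 2"
    by (simp only: sin_pi_minus sin_30)
  have "of_real (ln (2 * sin ((pi / 3) / 2))) + \<i> * of_real ((pi / 3 - pi) / 2) = - (of_real pi * \<i> / 3)"
    by (simp add: sin_30 field_simps)
  then have "croot base_pt = exp (- (of_real pi * \<i> / 3) / 7)"
    using arc_facts(3)[OF r(1,2)] unfolding a by (simp only:)
  also have "- (of_real pi * \<i> / 3) / 7 = - (of_real pi * \<i> / 21)" by simp
  finally show c: "1 / croot base_pt = base_pt"
    by (simp only: exp_minus base_pt_def[symmetric] inverse_eq_divide[symmetric] inverse_inverse_eq)
  have "of_real (ln (2 * sin ((5 * pi / 3) / 2))) + \<i> * of_real ((5 * pi / 3 - pi) / 2) = of_real pi * \<i> / 3"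
    unfolding s by (simp add: field_simps)
  then have "croot (zeta * cnj base_pt) = exp ((of_real pi * \<i> / 3) / 7)"
    using arc_facts(3)[OF r(2,3)] unfolding b by (simp only:)
  also have "(of_real pi * \<i> / 3) / 7 = - (- (of_real pi * \<i>) / 21)" by simp
  finally show d: "1 / croot (zeta * cnj base_pt) = cnj base_pt"
    by (simp only: exp_minus cnjb[symmetric] inverse_eq_divide[symmetric] inverse_inverse_eq)
  show "base_pt \<in> slit_domain" using arc_facts(1)[OF r(1,2)] unfolding a .
  show "cnj base_pt \<in> slit_domain" using arc_facts(2)[OF r(2,3)] unfolding b d .
qed

text \<open>Both sides are the integral of \<open>\<eta>\<^sub>j\<close> along the same path from \<open>z = 0\<close> to \<open>z = \<infinity>\<close>, computed in two charts.  The
  end point \<open>\<zeta> cnj b\<close> of the arc, where \<open>t\<close> is \<open>exp (5 \<pi> i / 3)\<close>, accounts for the inner root of unity.\<close>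

lemma crossing_relation:
  "prim j (cnj base_pt) - prim j base_pt =
   zeta ^ (7 - weight j) * (zeta ^ weight (j + 2) * prim (j + 2) (cnj base_pt) - prim (j + 2) base_pt)"
proof -
  define H where "H \<theta> = prim j (1 / croot (arc_pt \<theta>)) - zeta ^ (7 - weight j) * prim (j + 2) (arc_pt \<theta>)" for \<theta>
  have der: "(H has_vector_derivative 0) (at \<theta> within {pi / 3..5 * pi / 3})" if \<theta>: "\<theta> \<in> {pi / 3..5 * pi / 3}" for \<theta>
  proof -
    have r: "pi / 3 \<le> \<theta>" "\<theta> \<le> 5 * pi / 3" using \<theta> by auto
    note sl = arc_facts(1,2)[OF r]
    have "((\<lambda>z. exp (\<i> * z / 7)) has_field_derivative \<i> / 7 * arc_pt \<theta>) (at (of_real \<theta>))"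
      unfolding arc_pt_def by (auto intro!: derivative_eq_intros)
    from has_vector_derivative_real_field[OF this]
    have v: "(arc_pt has_vector_derivative \<i> / 7 * arc_pt \<theta>) (at \<theta>)"
      unfolding arc_pt_def[abs_def] .
    have "((\<lambda>v. 1 / croot v) has_field_derivative arc_pt \<theta> ^ 6 / croot (arc_pt \<theta>) ^ 8) (at (arc_pt \<theta>))"
      using sl by (auto intro!: derivative_eq_intros has_field_derivative_croot simp: power_numeral_reduce)
    from DERIV_chain2[OF prim(1)[OF sl(2)] this]
    have "((\<lambda>v. prim j (1 / croot v)) has_field_derivative
        chart_coeff j (1 / croot (arc_pt \<theta>)) * (arc_pt \<theta> ^ 6 / croot (arc_pt \<theta>) ^ 8)) (at (arc_pt \<theta>))" .
    from DERIV_diff[OF this DERIV_cmult[OF prim(1)[OF sl(1), of "j + 2"], of "zeta ^ (7 - weight j)"]]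
    have "((\<lambda>v. prim j (1 / croot v) - zeta ^ (7 - weight j) * prim (j + 2) v) has_field_derivative 0) (at (arc_pt \<theta>))"
      unfolding crossing_coeff[OF r] by simp
    from field_vector_diff_chain_at[OF v this]
    have "(H has_vector_derivative 0) (at \<theta>)"
      by (simp add: H_def[abs_def] o_def)
    then show ?thesis by (rule has_vector_derivative_at_within)
  qed
  obtain c where c: "\<And>\<theta>. \<theta> \<in> {pi / 3..5 * pi / 3} \<Longrightarrow> H \<theta> = c"
    using has_vector_derivative_zero_constant[of "{pi / 3..5 * pi / 3}" H] der by auto
  have lin: "b - a = q - p" if "a - p = b - q" for a b p q :: complex
    using that by (simp add: algebra_simps)
  have "H (pi / 3) = H (5 * pi / 3)"
    using c[of "pi / 3"] c[of "5 * pi / 3"] pi_gt_zero by simp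
  moreover have "prim (j + 2) (zeta * cnj base_pt) = zeta ^ weight (j + 2) * prim (j + 2) (cnj base_pt)"
    using prim_zeta[OF arc_ends(6), of "j + 2" 1] by simp
  ultimately show ?thesis
    unfolding H_def arc_ends(1-4) right_diff_distrib
    using lin[of "prim j base_pt"] by (simp only:)
qed

section \<open>Arguments of the primitives at the base point\<close>

text \<open>For \<open>0 \<le> \<tau> \<le> 1\<close> the number \<open>1 - \<tau>\<^sup>7 exp (i \<pi> / 3)\<close> has an argument \<open>\<alpha>\<close> between \<open>- \<pi> / 3\<close> and \<open>0\<close>; so the argument
  \<open>a \<pi> / 21 - b \<alpha> / 7\<close> of the quotient is between \<open>a \<pi> / 21\<close> and \<open>(a + b) \<pi> / 21\<close>.\<close>

lemma Im_base_pt_croot_pos: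
  assumes \<tau>: "0 \<le> \<tau>" "\<tau> \<le> 1" and ab: "0 < a" "a + b < 21"
  shows "of_real \<tau> * base_pt \<in> slit_domain" "Im (base_pt ^ a / croot (of_real \<tau> * base_pt) ^ b) > 0"
proof -
  have b7: "base_pt ^ 7 = exp (\<i> * of_real (pi / 3))"
    by (simp add: base_pt_def mult.commute flip: exp_of_nat_mult)
  define z where "z = 1 - (of_real \<tau> * base_pt) ^ 7"
  have t7: "\<tau> ^ 7 \<le> 1" "0 \<le> \<tau> ^ 7" using \<tau> by (auto simp: power_le_one)
  have z: "z = 1 - of_real (\<tau> ^ 7) * exp (\<i> * of_real (pi / 3))"
    by (simp add: z_def power_mult_distrib b7)
  have s3: "sin (pi / 3) > 0" by (simp add: sin_60)
  have Re: "Re z > 0" using t7 by (simp add: z Re_exp cos_60)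
  have Im1: "Im z \<le> 0" using t7 s3 by (simp add: z Im_exp)
  have Im2: "Im (exp (\<i> * of_real (pi / 3)) * z) \<ge> 0"
  proof -
    have "Im (exp (\<i> * of_real (pi / 3)) * z) = sin (pi / 3) * (1 - \<tau> ^ 7)"
      using sin_double[of "pi / 3"] 
      by (simp add: z Re_exp Im_exp cos_60 algebra_simps)
    then show ?thesis using t7 s3 by simp
  qed
  show "of_real \<tau> * base_pt \<in> slit_domain"
  proof -
    have "z \<notin> \<real>\<^sub>\<le>\<^sub>0" using Re by (auto simp: complex_nonpos_Reals_iff)
    then show ?thesis by (simp only: slit_domain_def z_def mem_Collect_eq not_False_eq_True)
  qed
  define \<alpha> where "\<alpha> = Im (Ln z)"
  have znz: "z \<noteq> 0" using Re by auto
  have ez: "z = exp (of_real (Re (Ln z)) + \<i> * of_real \<alpha>)"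
    unfolding \<alpha>_def complex_eq[symmetric] using exp_Ln[OF znz] by simp
  have \<alpha>: "\<bar>\<alpha>\<bar> < pi / 2"
    unfolding \<alpha>_def using Re_Ln_pos_lt[OF znz] Re by simp
  have "Im z = exp (Re (Ln z)) * sin \<alpha>" by (subst ez) (simp add: Im_exp)
  then have "sin \<alpha> \<le> 0" using Im1 by (simp add: mult_le_0_iff)
  then have \<alpha>0: "\<alpha> \<le> 0" using \<alpha> sin_gt_zero[of \<alpha>] by (cases "\<alpha> > 0") auto
  have "exp (\<i> * of_real (pi / 3)) * z = exp (of_real (Re (Ln z)) + \<i> * of_real (pi / 3 + \<alpha>))"
    by (subst ez) (simp add: algebra_simps flip: exp_add)
  then have "Im (exp (\<i> * of_real (pi / 3)) * z) = exp (Re (Ln z)) * sin (pi / 3 + \<alpha>)" by (simp add: Im_exp)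
  then have "sin (pi / 3 + \<alpha>) \<ge> 0" using Im2 by (simp add: zero_le_mult_iff)
  then have \<alpha>1: "\<alpha> \<ge> - pi / 3"
  proof -
    have "\<not> 0 < sin (- (pi / 3 + \<alpha>))" using \<open>sin (pi / 3 + \<alpha>) \<ge> 0\<close> by (simp add: not_less del: minus_add_distrib)
    then have "\<not> (0 < - (pi / 3 + \<alpha>) \<and> - (pi / 3 + \<alpha>) < pi)" using sin_gt_zero by blast
    then show ?thesis using \<alpha> pi_gt_zero by (auto simp: abs_less_iff)
  qed
  have cr: "croot (of_real \<tau> * base_pt) = exp (Ln z / 7)"
    by (simp only: croot_def z_def)
  have "base_pt ^ a / croot (of_real \<tau> * base_pt) ^ b =
      exp (of_nat a * (of_real pi * \<i> / 21) - of_nat b * (Ln z / 7))"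
    unfolding cr unfolding base_pt_def exp_diff exp_of_nat_mult ..
  moreover have "Im (of_nat a * (of_real pi * \<i> / 21) - of_nat b * (Ln z / 7)) = a * pi / 21 - b * \<alpha> / 7"
    by (simp add: \<alpha>_def)
  ultimately have "Im (base_pt ^ a / croot (of_real \<tau> * base_pt) ^ b) =
      exp (Re (of_nat a * (of_real pi * \<i> / 21) - of_nat b * (Ln z / 7))) * sin (a * pi / 21 - b * \<alpha> / 7)"
    by (simp only: Im_exp)
  moreover have "sin (a * pi / 21 - b * \<alpha> / 7) > 0"
  proof (rule sin_gt_zero)
    have "b * \<alpha> \<le> 0" using \<alpha>0 by (simp add: mult_le_0_iff)
    moreover have "a * pi > 0" using ab by simp
    ultimately show "a * pi / 21 - b * \<alpha> / 7 > 0" by linarith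
    have "b * (- \<alpha>) \<le> b * (pi / 3)" using \<alpha>1 by (intro mult_left_mono) auto
    moreover have "(a + b) * pi < 21 * pi" using ab by (intro mult_strict_right_mono) auto
    ultimately show "a * pi / 21 - b * \<alpha> / 7 < pi" by (simp add: field_simps)
  qed
  ultimately show "Im (base_pt ^ a / croot (of_real \<tau> * base_pt) ^ b) > 0" by simp
qed

lemma Im_mult_real: "Im (of_real a * z) = a * Im z"
  by simp

text \<open>The primitive is followed along the segment from \<open>0\<close> to \<open>base_pt\<close>.\<close>

lemma Im_prim_ray_pos:
  assumes "\<And>\<tau>. 0 < \<tau> \<Longrightarrow> \<tau> < 1 \<Longrightarrow> Im (k * (chart_coeff j (of_real \<tau> * base_pt) * base_pt)) > 0"
  shows "Im (k * prim j base_pt) > 0"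
proof -
  define f where "f \<tau> = Im (k * prim j (of_real \<tau> * base_pt))" for \<tau>
  have der: "(f has_real_derivative Im (k * (chart_coeff j (of_real \<tau> * base_pt) * base_pt))) (at \<tau>)"
    if "0 \<le> \<tau>" "\<tau> \<le> 1" for \<tau>
  proof -
    have sl: "of_real \<tau> * base_pt \<in> slit_domain"
      using Im_base_pt_croot_pos(1)[OF that, of 1 1] by simp
    have "((\<lambda>z. z * base_pt) has_field_derivative base_pt) (at (of_real \<tau>))"
      by (auto intro!: derivative_eq_intros)
    from DERIV_cmult[OF DERIV_chain2[OF prim(1)[OF sl] this], of k]
    have "((\<lambda>z. k * prim j (z * base_pt)) has_field_derivative k * (chart_coeff j (of_real \<tau> * base_pt) * base_pt)) (at (of_real \<tau>))" .
    from has_vector_derivative_real_field[OF this]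
    have "((\<lambda>\<tau>. k * prim j (of_real \<tau> * base_pt)) has_vector_derivative k * (chart_coeff j (of_real \<tau> * base_pt) * base_pt)) (at \<tau>)" .
    from bounded_linear.has_vector_derivative[OF bounded_linear_Im this]
    show ?thesis unfolding f_def has_real_derivative_iff_has_vector_derivative .
  qed
  have "f 0 < f 1"
  proof (rule DERIV_pos_imp_increasing_open[of 0 1 f])
    show "\<exists>y. (f has_real_derivative y) (at x) \<and> 0 < y" if "0 < x" "x < 1" for x
      using der[of x] assms[of x] that by auto
    show "continuous_on {0..1} f"
      using DERIV_isCont[OF der] by (intro continuous_at_imp_continuous_on) auto
  qed simp
  then show ?thesis by (simp add: f_def prim(2))
qed

lemma prim_1_2_distinct: "prim 1 base_pt \<noteq> zeta * prim 2 base_pt"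
proof -
  have "Im (- 1 * prim 1 base_pt) > 0"
  proof (rule Im_prim_ray_pos)
    fix \<tau> :: real assume \<tau>: "0 < \<tau>" "\<tau> < 1"
    have "- 1 * (chart_coeff 1 (of_real \<tau> * base_pt) * base_pt) = of_real \<tau> * (base_pt ^ 2 / croot (of_real \<tau> * base_pt) ^ 3)"
      unfolding chart_coeff_nth by (simp add: power2_eq_square)
    moreover have "Im (base_pt ^ 2 / croot (of_real \<tau> * base_pt) ^ 3) > 0"
      using \<tau> by (intro Im_base_pt_croot_pos) auto
    then have "Im (of_real \<tau> * (base_pt ^ 2 / croot (of_real \<tau> * base_pt) ^ 3)) > 0"
      using \<tau> by (simp only: Im_mult_real mult_pos_pos) 
    ultimately show "Im (- 1 * (chart_coeff 1 (of_real \<tau> * base_pt) * base_pt)) > 0" by (simp only:)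
  qed
  moreover have "Im (zeta * prim 2 base_pt) > 0"
  proof (rule Im_prim_ray_pos)
    fix \<tau> :: real assume \<tau>: "0 < \<tau>" "\<tau> < 1"
    have "zeta * (chart_coeff 2 (of_real \<tau> * base_pt) * base_pt) = base_pt ^ 7 / croot (of_real \<tau> * base_pt) ^ 5"
      unfolding chart_coeff_nth zeta_base_pt by (simp add: power_numeral_reduce)
    then show "Im (zeta * (chart_coeff 2 (of_real \<tau> * base_pt) * base_pt)) > 0"
      using \<tau> Im_base_pt_croot_pos(2)[of \<tau> 7 5] by simp
  qed
  ultimately show ?thesis by auto
qed

section \<open>The covering by the coordinate z\<close>

lemma rho_eq: "rho = Complex (- 1 / 2) (sqrt 3 / 2)"
proof -
  have "rho = cis (2 * pi / 3)"
    by (simp add: rho_def cis_conv_exp mult_ac)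
  moreover have "2 * pi / 3 = pi - pi / 3" by simp
  then have "cos (2 * pi / 3) = - 1 / 2" "sin (2 * pi / 3) = sqrt 3 / 2"
    by (simp_all only: cos_pi_minus sin_pi_minus cos_60 sin_60)
  ultimately show ?thesis by (simp add: complex_eq_iff)
qed

lemma rho_square: "rho ^ 2 = - 1 - rho"
  by (simp add: rho_eq complex_eq_iff power2_eq_square)

lemma rho_nonzero [simp]: "rho \<noteq> 0"
  by (simp add: rho_def)

lemma rho_cube: "rho ^ 3 = 1"
proof -
  have "rho ^ 3 = rho * rho ^ 2" by (simp add: power_numeral_reduce)
  also have "\<dots> = - rho - rho ^ 2" by (subst rho_square) (simp add: algebra_simps power2_eq_square)
  finally show ?thesis by (simp add: rho_square)
qed

text \<open>The coordinate \<open>z\<close> in terms of \<open>A = X\<^sub>1\<^sup>3 X\<^sub>2\<close>, \<open>B = X\<^sub>2\<^sup>3 X\<^sub>3\<close>, \<open>C = X\<^sub>3\<^sup>3 X\<^sub>1\<close>, with \<open>A + B + C = 0\<close>: it is \<open>- \<rho>\<close> times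
  the quotient of two Lagrange resolvents.  Rotating \<open>A, B, C\<close> multiplies the resolvents by cube roots of
  unity, which makes the effect \<open>z \<mapsto> \<rho>\<^sup>2 z\<close> of the order 3 automorphism visible.\<close>

definition fibre_eq :: "complex ^ 3 \<Rightarrow> complex \<Rightarrow> bool" where
  "fibre_eq v z \<longleftrightarrow>
     (let A = v $ 1 ^ 3 * v $ 2; B = v $ 2 ^ 3 * v $ 3; C = v $ 3 ^ 3 * v $ 1
      in z * (A + rho * B + rho ^ 2 * C) = - rho * (A + rho ^ 2 * B + rho * C))"

lemma fibre_eq_rot: "fibre_eq v z \<Longrightarrow> fibre_eq (rot 1 v) (rho ^ 2 * z)"
proof -
  define A B C where "A = v $ 1 ^ 3 * v $ 2" and "B = v $ 2 ^ 3 * v $ 3" and "C = v $ 3 ^ 3 * v $ 1"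
  assume "fibre_eq v z"
  then have e: "z * (A + rho * B + rho ^ 2 * C) = - rho * (A + rho ^ 2 * B + rho * C)"
    by (simp add: fibre_eq_def A_def B_def C_def Let_def)
  have r3: "rho * rho ^ 2 = 1" using rho_cube by (simp add: power_numeral_reduce)
  have "rho ^ 2 * z * (B + rho * C + rho ^ 2 * A) = rho ^ 2 * z * (rho * rho ^ 2 * B + rho * (rho * rho ^ 2) * C + rho ^ 2 * A)"
    by (simp add: r3)
  also have "\<dots> = rho ^ 2 * rho ^ 2 * (z * (A + rho * B + rho ^ 2 * C))"
    by (simp add: algebra_simps power2_eq_square)
  also have "\<dots> = rho ^ 2 * rho ^ 2 * (- rho * (A + rho ^ 2 * B + rho * C))"
    by (simp only: e)
  also have "\<dots> = - rho * (rho * (rho * rho ^ 2) * A + (rho * rho ^ 2) * (rho * rho ^ 2) * B + (rho * rho ^ 2) * rho ^ 2 * C)"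
    by (simp add: algebra_simps power2_eq_square)
  also have "\<dots> = - rho * (B + rho ^ 2 * C + rho * A)"
    by (simp add: r3)
  finally show ?thesis
    by (simp add: fibre_eq_def A_def B_def C_def Let_def)
qed

lemma coordinate_t_minus:
  assumes "z \<noteq> rho ^ 2"
  shows "1 - rho * z \<noteq> 0" "1 - rho ^ 2 * (z - 1) / (1 - rho * z) = (z - rho) / (1 - rho * z)"
proof -
  have r3: "rho * rho ^ 2 = 1" using rho_cube by (simp add: power_numeral_reduce)
  show nz: "1 - rho * z \<noteq> 0"
  proof
    assume "1 - rho * z = 0"
    then have "rho * z = rho * rho ^ 2" by (simp add: r3)
    then show False using assms by (simp del: mult_cancel_left add: mult_left_cancel)
  qed
  have "1 - rho * z - rho ^ 2 * (z - 1) = z - rho"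
    unfolding rho_square by (simp add: algebra_simps)
  then show "1 - rho ^ 2 * (z - 1) / (1 - rho * z) = (z - rho) / (1 - rho * z)"
    using nz by (simp add: field_simps)
qed

lemma fibre_eqI_t:
  assumes t: "t * (1 - rho * z) = rho ^ 2 * (z - 1)"
    and v: "klein_form v = 0" "v $ 3 ^ 2 * v $ 1 = - t * v $ 2 ^ 3"
  shows "fibre_eq v z"
proof -
  define A B C where "A = v $ 1 ^ 3 * v $ 2" and "B = v $ 2 ^ 3 * v $ 3" and "C = v $ 3 ^ 3 * v $ 1"
  have "C = v $ 3 * (v $ 3 ^ 2 * v $ 1)" by (simp add: C_def power_numeral_reduce)
  then have C: "C = - t * B" unfolding v(2) by (simp add: B_def)
  have "A + B + C = 0" using v(1) by (simp add: klein_form_3 A_def B_def C_def)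
  then have A: "A = - B + t * B" using C by (simp add: eq_neg_iff_add_eq_0 algebra_simps)
  have "z * (A + rho * B + rho ^ 2 * C) + rho * (A + rho ^ 2 * B + rho * C) =
      (1 - rho) * B * (rho * (t * (1 - rho * z)) - (z - 1))"
    unfolding A C rho_square
  proof -
    have r2: "rho * rho = - 1 - rho" using rho_square by (simp add: power2_eq_square)
    have r2': "rho * (rho * x) = (- 1 - rho) * x" for x
      by (simp only: mult.assoc[symmetric] r2)
    show "z * (- B + t * B + rho * B + (- 1 - rho) * (- t * B)) + rho * (- B + t * B + (- 1 - rho) * B + rho * (- t * B)) =
      (1 - rho) * B * (rho * (t * (1 - rho * z)) - (z - 1))"
      by (simp add: algebra_simps r2 r2')
  qed
  also have "\<dots> = 0"
  proof -
    have "rho * (rho ^ 2 * (z - 1)) = rho ^ 3 * (z - 1)" by (simp add: power_numeral_reduce)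
    then show ?thesis unfolding t by (simp add: rho_cube)
  qed
  finally show ?thesis
    by (simp add: fibre_eq_def A_def B_def C_def Let_def eq_neg_iff_add_eq_0)
qed

text \<open>After elimination of \<open>A\<close> the equation of the fibre is \<open>C = - t B\<close>, that is, \<open>t\<close> has the value prescribed by
  \<open>z\<close>; the equation of the curve in the form \<open>s\<^sup>7 = t (1 - t)\<^sup>2\<close> then becomes the one for \<open>w\<close>.\<close>

lemma hpt_in_klein_fibre:
  assumes v: "klein_form v = 0" "\<And>k. v $ k \<noteq> 0" and z: "z \<noteq> 1" "z \<noteq> rho" "z \<noteq> rho ^ 2"
    and fib: "fibre_eq v z"
  shows "hpt v \<in> klein_fibre z"
proof -
  define A B C where "A = v $ 1 ^ 3 * v $ 2" and "B = v $ 2 ^ 3 * v $ 3" and "C = v $ 3 ^ 3 * v $ 1"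
  note nz = coordinate_t_minus(1)[OF z(3)]
  define t where "t = rho ^ 2 * (z - 1) / (1 - rho * z)"
  have t1: "1 - t = (z - rho) / (1 - rho * z)" unfolding t_def by (rule coordinate_t_minus(2)[OF z(3)])
  have tne: "1 - t \<noteq> 0" unfolding t1 using z nz by simp
  have r2: "rho * rho = - 1 - rho" using rho_square by (simp add: power2_eq_square)
  have r2': "rho * (rho * x) = (- 1 - rho) * x" for x
    by (simp only: mult.assoc[symmetric] r2)
  have A: "A = - B - C" using v(1) by (simp add: klein_form_3 A_def B_def C_def eq_neg_iff_add_eq_0 algebra_simps)
  have "z * (A + rho * B + rho ^ 2 * C) + rho * (A + rho ^ 2 * B + rho * C) = 0"
    using fib by (simp add: fibre_eq_def A_def B_def C_def Let_def eq_neg_iff_add_eq_0)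
  moreover have "rho * (z * (A + rho * B + rho ^ 2 * C) + rho * (A + rho ^ 2 * B + rho * C)) =
      (rho - 1) * (rho * (z - 1) * B + rho ^ 2 * C * (1 - rho * z))"
    unfolding A rho_square by (simp add: algebra_simps r2 r2')
  ultimately have "(rho - 1) * (rho * (z - 1) * B + rho ^ 2 * C * (1 - rho * z)) = 0" by simp
  moreover have "rho - 1 \<noteq> 0" by (simp add: rho_eq complex_eq_iff)
  ultimately have "rho * (z - 1) * B + rho ^ 2 * C * (1 - rho * z) = 0" by simp
  then have "rho * (rho * (z - 1) * B + rho ^ 2 * C * (1 - rho * z)) = 0" by simp
  then have "rho ^ 2 * (z - 1) * B + rho ^ 3 * C * (1 - rho * z) = 0"
    by (simp add: algebra_simps power_numeral_reduce)
  then have CB: "C = - t * B"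
    unfolding t_def using nz by (simp add: rho_cube field_simps eq_neg_iff_add_eq_0)
  have d: "v $ 2 \<noteq> 0" using v by simp
  define s x where "s = - v $ 1 / v $ 2" and "x = v $ 3 / v $ 2"
  have vd: "v $ 1 = - v $ 2 * s" "v $ 3 = v $ 2 * x" using d by (auto simp: s_def x_def)
  have xnz: "x \<noteq> 0" "s \<noteq> 0" using v by (auto simp: x_def s_def)
  have "v $ 2 ^ 4 * (x ^ 2 * s * x) = v $ 2 ^ 4 * (t * x)"
    using CB unfolding B_def C_def vd by (simp add: power_numeral_reduce algebra_simps)
  then have t: "x ^ 2 * s = t" using d xnz by simp
  have s3: "s ^ 3 = x * (1 - t)" and s7: "s ^ 7 = t * (1 - t) ^ 2"
    using klein_form_normalized[OF v(1) d, folded s_def x_def] unfolding t by auto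
  define w where "w = s * (1 - rho * z)"
  have "w ^ 7 = rho ^ 2 * (z - 1) * (z - rho) ^ 2 * (1 - rho * z) ^ 4"
    unfolding w_def power_mult_distrib s7 unfolding t1 unfolding t_def
    using nz by (simp add: power_divide power_numeral_reduce)
  also have "1 - rho * z = - rho * (z - rho ^ 2)"
    using rho_cube by (simp add: algebra_simps power_numeral_reduce)
  also have "rho ^ 2 * (z - 1) * (z - rho) ^ 2 * (- rho * (z - rho ^ 2)) ^ 4 =
      (rho ^ 3) ^ 2 * ((z - 1) * (z - rho) ^ 2 * (z - rho ^ 2) ^ 4)"
    by (simp add: power_mult_distrib power_numeral_reduce)
  finally have w7: "w ^ 7 = (z - 1) * (z - rho) ^ 2 * (z - rho ^ 2) ^ 4"
    by (simp add: rho_cube)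
  have ws: "w / (1 - rho * z) = s" using nz by (simp add: w_def)
  have "hpt (vector [(t - 1) / s ^ 2, (1 - t) / s ^ 3, 1]) = hpt v"
  proof -
    have x: "x = s ^ 3 / (1 - t)" using s3 tne by (simp add: field_simps)
    have e1: "v $ 1 = v $ 3 * ((t - 1) / s ^ 2)"
      unfolding vd x using tne xnz by (simp add: field_simps power_numeral_reduce)
    have e2: "v $ 2 = v $ 3 * ((1 - t) / s ^ 3)"
      unfolding vd(2) x using tne xnz by simp
    have "v = v $ 3 *s vector [(t - 1) / s ^ 2, (1 - t) / s ^ 3, 1]"
      using e1 e2 unfolding vec_eq_iff forall_3 vector_smult_component vector_3 by simp
    then show ?thesis using v(2)[of 3] hpt_eqI by metis
  qed
  then have "hpt v = klein_pt z w"
    unfolding klein_pt_def Let_def ws t_def[symmetric] by simp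
  then show ?thesis
    unfolding klein_fibre_def using w7 by blast
qed

section \<open>Uniqueness of lifts\<close>

text \<open>The coordinate \<open>s = - x / y\<close> as a function on the curve; over a given \<open>z\<close> it determines \<open>w\<close>.\<close>

definition slope :: "ppoint \<Rightarrow> complex" where
  "slope P = (SOME r. \<exists>v. v \<noteq> 0 \<and> P = hpt v \<and> r = - v $ 1 / v $ 2)"

lemma slope_hpt: "v \<noteq> 0 \<Longrightarrow> slope (hpt v) = - v $ 1 / v $ 2"
  unfolding slope_def
proof (rule some_equality)
  fix r assume "\<exists>w. w \<noteq> 0 \<and> hpt v = hpt w \<and> r = - w $ 1 / w $ 2"
  then obtain w c where "r = - w $ 1 / w $ 2" "c \<noteq> 0" "v = c *s w"
    by (auto simp: hpt_eq_iff)
  then show "r = - v $ 1 / v $ 2" by simp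
qed auto

lemma continuous_on_slope_path:
  assumes \<gamma>: "pathin klein_top \<gamma>" and nz: "\<And>s v. s \<in> {0..1} \<Longrightarrow> v \<noteq> 0 \<Longrightarrow> \<gamma> s = hpt v \<Longrightarrow> v $ 2 \<noteq> 0"
  shows "continuous_on {0..1} (slope \<circ> \<gamma>)"
  unfolding continuous_openin_preimage_eq
proof (intro allI impI)
  fix U :: "complex set" assume U: "open U"
  let ?Q = "\<lambda>v :: complex ^ 3. v $ 2 \<noteq> 0 \<and> - v $ 1 / v $ 2 \<in> U"
  let ?O = "{hpt v | v. v \<noteq> 0 \<and> klein_form v = 0 \<and> ?Q v}"
  have "open ({v :: complex ^ 3. v $ 2 \<noteq> 0} \<inter> (\<lambda>v. - v $ 1 / v $ 2) -` U)"
    using U by (intro continuous_open_preimage open_Collect_neq continuous_intros) auto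
  moreover have "{v :: complex ^ 3. v $ 2 \<noteq> 0} \<inter> (\<lambda>v. - v $ 1 / v $ 2) -` U = {v. v \<noteq> 0 \<and> ?Q v}"
    by auto
  ultimately have "open {v. v \<noteq> 0 \<and> ?Q v}" by simp
  then have O: "openin klein_top ?O"
    by (rule openin_klein_top_coordinates) auto
  have "openin (top_of_set {0..1}) {s \<in> topspace (top_of_set {0..1}). \<gamma> s \<in> ?O}"
    using \<gamma> O unfolding pathin_def by (rule openin_continuous_map_preimage)
  also have "{s \<in> topspace (top_of_set {0..1}). \<gamma> s \<in> ?O} = {0..1} \<inter> (slope \<circ> \<gamma>) -` U"
  proof (rule equalityI; rule subsetI)
    fix s assume "s \<in> {s \<in> topspace (top_of_set {0..1}). \<gamma> s \<in> ?O}"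
    then show "s \<in> {0..1} \<inter> (slope \<circ> \<gamma>) -` U" by (auto simp: slope_hpt)
  next
    fix s assume s: "s \<in> {0..1} \<inter> (slope \<circ> \<gamma>) -` U"
    then have "\<gamma> s \<in> klein_curve"
      using path_image_subset_topspace[OF \<gamma>] by (auto simp: topspace_klein)
    then obtain v where v: "v \<noteq> 0" "klein_form v = 0" "\<gamma> s = hpt v" by (rule klein_curve_cases)
    then have "?Q v" using s nz[of s v] by (auto simp: slope_hpt)
    then show "s \<in> {s \<in> topspace (top_of_set {0..1}). \<gamma> s \<in> ?O}" using v s by auto
  qed
  finally show "openin (top_of_set {0..1}) ({0..1} \<inter> (slope \<circ> \<gamma>) -` U)" .
qed

lemma slope_klein_pt:
  assumes z: "z \<noteq> 1" "z \<noteq> rho" "z \<noteq> rho ^ 2" and w: "w ^ 7 = (z - 1) * (z - rho) ^ 2 * (z - rho ^ 2) ^ 4"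
  shows "slope (klein_pt z w) = w / (1 - rho * z)" "w \<noteq> 0" "v \<noteq> 0 \<Longrightarrow> klein_pt z w = hpt v \<Longrightarrow> v $ 2 \<noteq> 0"
proof -
  note nz = coordinate_t_minus(1)[OF z(3)]
  have "w ^ 7 \<noteq> 0" using w z by simp
  then show w0: "w \<noteq> 0" by auto
  define t s where "t = rho ^ 2 * (z - 1) / (1 - rho * z)" and "s = w / (1 - rho * z)"
  have s: "s \<noteq> 0" using w0 nz by (simp add: s_def)
  have t1: "1 - t = (z - rho) / (1 - rho * z)" unfolding t_def by (rule coordinate_t_minus(2)[OF z(3)])
  have tne: "1 - t \<noteq> 0" unfolding t1 using z nz by simp
  let ?v = "vector [(t - 1) / s ^ 2, (1 - t) / s ^ 3, 1] :: complex ^ 3"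
  have P: "klein_pt z w = hpt ?v"
    unfolding klein_pt_def Let_def t_def s_def ..
  have comp: "?v $ 1 = (t - 1) / s ^ 2" "?v $ 2 = (1 - t) / s ^ 3" by (simp_all only: vector_3)
  have v2: "?v $ 2 \<noteq> 0" unfolding comp using s tne by simp
  then have "?v \<noteq> 0" by (metis zero_index)
  then have "slope (klein_pt z w) = - ?v $ 1 / ?v $ 2" unfolding P by (rule slope_hpt)
  also have "\<dots> = s" unfolding comp using s tne
    by (simp add: field_simps power_numeral_reduce)
  finally show "slope (klein_pt z w) = w / (1 - rho * z)" by (simp add: s_def)
  show "v $ 2 \<noteq> 0" if "v \<noteq> 0" "klein_pt z w = hpt v" for v
  proof -
    have "hpt ?v = hpt v" using that P by simp
    then obtain c where "c \<noteq> 0" "?v = c *s v" by (auto simp: hpt_eq_iff)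
    then show ?thesis using v2 by (metis mult_zero_right vector_smult_component)
  qed
qed

text \<open>The quotient of the slopes of two lifts is a continuous function whose values are seventh roots of
  unity, hence constant.\<close>

lemma lift_unique:
  assumes \<gamma>: "is_lift p k \<gamma>" and \<delta>: "is_lift p k \<delta>"
    and p: "\<And>s. s \<in> {0..1} \<Longrightarrow> p s \<notin> {1, rho, rho ^ 2}"
    and t: "t \<in> {0..1}"
  shows "\<gamma> t = \<delta> t"
proof -
  have lift: "\<exists>w. w ^ 7 = (p s - 1) * (p s - rho) ^ 2 * (p s - rho ^ 2) ^ 4 \<and> \<epsilon> s = klein_pt (p s) w"
    if "is_lift p k \<epsilon>" "s \<in> {0..1}" for \<epsilon> s
    using that unfolding is_lift_def klein_fibre_def by blast
  then obtain w w' where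
    w: "\<And>s. s \<in> {0..1} \<Longrightarrow> w s ^ 7 = (p s - 1) * (p s - rho) ^ 2 * (p s - rho ^ 2) ^ 4 \<and> \<gamma> s = klein_pt (p s) (w s)" and
    w': "\<And>s. s \<in> {0..1} \<Longrightarrow> w' s ^ 7 = (p s - 1) * (p s - rho) ^ 2 * (p s - rho ^ 2) ^ 4 \<and> \<delta> s = klein_pt (p s) (w' s)"
    using lift[OF \<gamma>] lift[OF \<delta>] by metis
  have slope: "slope (\<gamma> s) = w s / (1 - rho * p s)" "slope (\<delta> s) = w' s / (1 - rho * p s)"
    "w s \<noteq> 0" "w' s \<noteq> 0" "1 - rho * p s \<noteq> 0" if "s \<in> {0..1}" for s
    using p[OF that] w[OF that] w'[OF that] slope_klein_pt[of "p s"] coordinate_t_minus(1)[of "p s"] by auto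
  have "continuous_on {0..1} (slope \<circ> \<gamma>)"
  proof (rule continuous_on_slope_path)
    show "pathin klein_top \<gamma>" using \<gamma> by (simp add: is_lift_def)
    show "v $ 2 \<noteq> 0" if "s \<in> {0..1}" "v \<noteq> 0" "\<gamma> s = hpt v" for s v
      using slope_klein_pt(3)[of "p s" "w s" v] p[OF that(1)] w[OF that(1)] that by auto
  qed
  moreover have "continuous_on {0..1} (slope \<circ> \<delta>)"
  proof (rule continuous_on_slope_path)
    show "pathin klein_top \<delta>" using \<delta> by (simp add: is_lift_def)
    show "v $ 2 \<noteq> 0" if "s \<in> {0..1}" "v \<noteq> 0" "\<delta> s = hpt v" for s v
      using slope_klein_pt(3)[of "p s" "w' s" v] p[OF that(1)] w'[OF that(1)] that by auto
  qed
  ultimately have "continuous_on {0..1} (\<lambda>s. (slope \<circ> \<gamma>) s / (slope \<circ> \<delta>) s)"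
    using slope by (intro continuous_on_divide) auto
  moreover have q: "(slope \<circ> \<gamma>) s / (slope \<circ> \<delta>) s = w s / w' s" if "s \<in> {0..1}" for s
    using slope[OF that] by simp
  ultimately have "continuous_on {0..1} (\<lambda>s. w s / w' s)"
    by (rule continuous_on_eq)
  moreover have "(\<lambda>s. w s / w' s) ` {0..1} \<subseteq> {q. q ^ 7 = 1}"
  proof (rule image_subsetI)
    fix s :: real assume s: "s \<in> {0..1}"
    then have "w s ^ 7 = w' s ^ 7" using w w' by simp
    then show "w s / w' s \<in> {q. q ^ 7 = 1}" using slope(3,4)[OF s] by (simp add: power_divide)
  qed
  then have "finite ((\<lambda>s. w s / w' s) ` {0..1})"
    by (rule finite_subset) (simp add: finite_roots_unity)
  ultimately have "(\<lambda>s. w s / w' s) constant_on {0..1}"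
    by (intro continuous_finite_range_constant) auto
  then have "w t / w' t = w 0 / w' 0"
    using t unfolding constant_on_def by (metis atLeastAtMost_iff order_refl zero_le_one)
  also have "\<dots> = 1"
  proof -
    have "\<gamma> 0 = \<delta> 0" using \<gamma> \<delta> by (simp add: is_lift_def)
    then have "w 0 = w' 0" using slope[of 0] by simp
    then show ?thesis using slope(4)[of 0] by simp
  qed
  finally have "w t = w' t" using slope(4)[OF t] by simp
  then show ?thesis using w[OF t] w'[OF t] by simp
qed

section \<open>Lifts of the loops about the branch points\<close>

text \<open>The loop about a point \<open>p\<close> of modulus 1 is \<open>p (1 - l)\<close> where \<open>l\<close> runs from 1 to \<open>r\<close>, clockwise round the circle of
  radius \<open>r\<close>, and back to 1.\<close>

definition radial :: "real \<Rightarrow> real \<Rightarrow> complex" where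
  "radial r = linepath 1 (of_real r) +++
     (\<lambda>u. of_real r * exp (- 2 * of_real pi * \<i> * of_real u)) +++ linepath (of_real r) 1"

lemma clockwise_loop_radial: "clockwise_loop r p u = p * (1 - radial r u)"
  unfolding clockwise_loop_def radial_def joinpaths_def linepath_def
  by (auto simp: algebra_simps scaleR_conv_of_real)

text \<open>A continuous seventh root of \<open>radial r\<close>; on the way it picks up the factor \<open>\<zeta>\<^sup>-\<^sup>1 = \<zeta>\<^sup>6\<close>.\<close>

definition radial_root :: "real \<Rightarrow> real \<Rightarrow> complex" where
  "radial_root r = (\<lambda>u. of_real (root 7 (1 - u + u * r))) +++
     (\<lambda>u. of_real (root 7 r) * exp (- 2 * of_real pi * \<i> * of_real u / 7)) +++
     (\<lambda>u. of_real (root 7 (r - u * r + u)) * exp (- 2 * of_real pi * \<i> / 7))"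

lemma radial_root:
  assumes r: "0 < r" "r < 1"
  shows "continuous_on {0..1} (radial_root r)"
    and "u \<in> {0..1} \<Longrightarrow> radial_root r u ^ 7 = radial r u"
    and "radial_root r 0 = 1" "radial_root r 1 = zeta ^ 6"
proof -
  have ec: "exp (- 2 * of_real pi * \<i> / 7) ^ 7 = (1 :: complex)"
  proof -
    have "of_nat 7 * (- 2 * of_real pi * \<i> / 7) = - (2 * of_real pi * \<i>)" by simp
    then show ?thesis
      unfolding exp_of_nat_mult[symmetric] by (simp only: exp_minus exp_two_pi_i) simp
  qed
  have "path (radial_root r)"
    unfolding radial_root_def
  proof (intro path_join_imp)
    show "path (\<lambda>u. of_real (root 7 (1 - u + u * r)) :: complex)"
      "path (\<lambda>u. of_real (root 7 r) * exp (- 2 * of_real pi * \<i> * of_real u / 7))"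
      "path (\<lambda>u. of_real (root 7 (r - u * r + u)) * exp (- 2 * of_real pi * \<i> / 7))"
      unfolding path_def by (intro continuous_intros; simp)+
  qed (simp_all add: pathfinish_def pathstart_def joinpaths_def)
  then show "continuous_on {0..1} (radial_root r)" by (simp add: path_def)
  show "radial_root r 0 = 1" by (simp add: radial_root_def joinpaths_def)
  have "zeta ^ 6 = exp (of_nat 6 * (2 * of_real pi * \<i> / 7))"
    unfolding zeta_def exp_of_nat_mult ..
  also have "of_nat 6 * (2 * of_real pi * \<i> / 7) = - 2 * of_real pi * \<i> / 7 + 2 * of_real pi * \<i>"
    by (simp add: field_simps)
  also have "exp \<dots> = exp (- 2 * of_real pi * \<i> / 7)"
    by (simp only: exp_add exp_two_pi_i mult_1_right)
  finally show "radial_root r 1 = zeta ^ 6"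
    by (simp add: radial_root_def joinpaths_def)
  show "radial_root r u ^ 7 = radial r u" if u: "u \<in> {0..1}"
  proof -
    have root7: "(of_real (root 7 x) :: complex) ^ 7 = of_real x" for x
      by (simp add: odd_real_root_pow flip: of_real_power)
    have circle: "exp (- 2 * of_real pi * \<i> * of_real x / 7) ^ 7 = exp (- 2 * of_real pi * \<i> * of_real x)" for x
      unfolding exp_of_nat_mult[symmetric] by (rule arg_cong[of _ _ exp]) simp
    show ?thesis
      unfolding radial_root_def radial_def joinpaths_def linepath_def power_mult_distrib if_distrib[of "\<lambda>x. x ^ 7"] root7 circle ec
      by (simp add: scaleR_conv_of_real algebra_simps)
  qed
qed

lemma radial_bounds:
  assumes r: "0 < r" "r < 1" and u: "u \<in> {0..1}"
  shows "radial r u \<noteq> 0" "cmod (radial r u) \<le> 1"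
proof -
  have cv: "0 < 1 - x + x * r \<and> 1 - x + x * r \<le> 1" if "0 \<le> x" "x \<le> 1" for x
  proof
    have "x * (1 - r) \<le> 1 * (1 - r)" using that r by (intro mult_right_mono) auto
    then show "0 < 1 - x + x * r" using r by (simp add: algebra_simps)
    show "1 - x + x * r \<le> 1" using that r by (simp add: mult_left_le)
  qed
  consider "u \<le> 1/2" | "\<not> u \<le> 1/2" "2 * u - 1 \<le> 1/2" | "\<not> u \<le> 1/2" "\<not> 2 * u - 1 \<le> 1/2" by blast
  then have "radial r u \<noteq> 0 \<and> cmod (radial r u) \<le> 1"
  proof cases
    case 1
    then have "radial r u = of_real (1 - 2 * u + 2 * u * r)"
      by (simp add: radial_def joinpaths_def linepath_def scaleR_conv_of_real)
    moreover have "0 < 1 - 2 * u + 2 * u * r \<and> 1 - 2 * u + 2 * u * r \<le> 1"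
      using cv[of "2 * u"] 1 u by simp
    ultimately show ?thesis by (simp only: norm_of_real of_real_eq_0_iff) simp
  next
    case 2
    then have "radial r u = of_real r * exp (- 2 * of_real pi * \<i> * of_real (2 * (2 * u - 1)))"
      by (simp add: radial_def joinpaths_def)
    moreover have "cmod (exp (- 2 * of_real pi * \<i> * of_real (2 * (2 * u - 1)))) = 1"
      by (simp add: norm_exp_eq_Re)
    ultimately show ?thesis using r by (simp only: norm_mult norm_of_real) simp
  next
    case 3
    define x where "x = 2 - 2 * (2 * u - 1)"
    have "radial r u = of_real (1 - x + x * r)"
      using 3 by (simp add: radial_def joinpaths_def linepath_def scaleR_conv_of_real x_def algebra_simps)
    moreover have "0 < 1 - x + x * r \<and> 1 - x + x * r \<le> 1"
      using 3 u by (intro cv) (auto simp: x_def)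
    ultimately show ?thesis by (simp only: norm_of_real of_real_eq_0_iff) simp
  qed
  then show "radial r u \<noteq> 0" "cmod (radial r u) \<le> 1" by auto
qed

text \<open>For \<open>z = 1 - l\<close> the coordinate \<open>t = \<rho>\<^sup>2 (z - 1) / (1 - \<rho> z)\<close> is \<open>l / shift l\<close>, and \<open>shift l\<close> stays in the
  lower half plane, so that seventh roots of \<open>t / l\<close> are given by the principal logarithm.\<close>

definition shift :: "complex \<Rightarrow> complex" where
  "shift l = - \<i> * of_real (sqrt 3) - rho ^ 2 * l"

lemma cmod_rho: "cmod rho = 1"
  by (simp add: rho_def norm_exp_eq_Re)

lemma sqrt3_gt_1: "sqrt 3 > 1"
  by (simp add: real_less_rsqrt)

text \<open>The third claim, that the loop does not meet the slit, holds since \<open>l / shift l = 1 / a\<close> with \<open>0 < a \<le> 1\<close>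
  would mean \<open>- i sqrt 3 = (a + \<rho>\<^sup>2) l\<close>, but \<open>\<bar>a + \<rho>\<^sup>2\<bar> \<le> 1\<close> and \<open>\<bar>l\<bar> \<le> 1\<close>.\<close>

lemma shift_facts:
  assumes l: "l \<noteq> 0" "cmod l \<le> 1"
  shows "Im (shift l) < 0"
    and "l / shift l * (1 - rho * (1 - l)) = rho ^ 2 * ((1 - l) - 1)"
    and "1 - l / shift l \<notin> \<real>\<^sub>\<le>\<^sub>0"
    and "1 - l \<noteq> 1" "1 - l \<noteq> rho" "1 - l \<noteq> rho ^ 2"
proof -
  have "\<bar>Im (rho ^ 2 * l)\<bar> \<le> cmod (rho ^ 2 * l)" by (rule abs_Im_le_cmod)
  also have "\<dots> \<le> 1" using l by (simp add: norm_mult norm_power cmod_rho)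
  finally have "\<bar>Im (rho ^ 2 * l)\<bar> \<le> 1" .
  moreover have "Im (shift l) = - sqrt 3 - Im (rho ^ 2 * l)" by (simp add: shift_def)
  ultimately show im: "Im (shift l) < 0" using sqrt3_gt_1 by (simp only: abs_le_iff) linarith
  have sh: "shift l = - rho * (1 - rho * (1 - l))"
  proof -
    have "- rho + rho ^ 2 = - \<i> * of_real (sqrt 3)"
      by (simp add: rho_eq complex_eq_iff power2_eq_square)
    then show ?thesis by (simp add: shift_def algebra_simps power2_eq_square)
  qed
  have nz: "shift l \<noteq> 0" using im by auto
  have r3: "rho * rho ^ 2 = 1" using rho_cube by (simp add: power_numeral_reduce)
  have "- (rho ^ 2) * (- rho * e) = (rho * rho ^ 2) * e" for e by (simp add: algebra_simps)
  then have "1 - rho * (1 - l) = - (rho ^ 2) * shift l"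
    unfolding sh by (simp only: r3 mult_1_left)
  then show "l / shift l * (1 - rho * (1 - l)) = rho ^ 2 * ((1 - l) - 1)"
    using nz by simp
  show "1 - l / shift l \<notin> \<real>\<^sub>\<le>\<^sub>0"
  proof
    assume "1 - l / shift l \<in> \<real>\<^sub>\<le>\<^sub>0"
    then obtain x where x: "1 - l / shift l = of_real x" "x \<le> 0" by (auto elim!: nonpos_Reals_cases)
    define a where "a = 1 / (1 - x)"
    have a: "0 \<le> a" "a \<le> 1" using x by (auto simp: a_def field_simps)
    have "l = (1 - of_real x) * shift l" using x nz by (simp add: field_simps)
    then have "shift l = of_real a * l" using x by (simp add: a_def field_simps)
    then have "- \<i> * of_real (sqrt 3) = (of_real a + rho ^ 2) * l"
      by (simp add: shift_def algebra_simps)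
    then have "cmod (- \<i> * of_real (sqrt 3)) = cmod (of_real a + rho ^ 2) * cmod l"
      by (simp only: norm_mult)
    then have eq: "sqrt 3 = cmod (of_real a + rho ^ 2) * cmod l" by (simp add: norm_mult)
    have "(cmod (of_real a + rho ^ 2)) ^ 2 = a * a - a + 1"
      unfolding rho_square by (simp add: rho_eq cmod_power2) (simp add: power2_eq_square algebra_simps)
    also have "\<dots> \<le> 1 ^ 2" using a by (simp add: mult_left_le)
    finally have "cmod (of_real a + rho ^ 2) \<le> 1" by (rule power2_le_imp_le) simp
    then have "cmod (of_real a + rho ^ 2) * cmod l \<le> 1 * 1" using l by (intro mult_mono) auto
    then show False using eq sqrt3_gt_1 by simp
  qed
  show "1 - l \<noteq> 1" using l by simp
  have far: "cmod (1 - rho ^ k) > 1" if "k = 1 \<or> k = 2" for k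
  proof -
    have "(cmod (1 - rho)) ^ 2 = 3" "(cmod (1 - rho ^ 2)) ^ 2 = 3"
      unfolding rho_square by (simp_all add: rho_eq cmod_power2, simp_all add: power2_eq_square)
    then have "cmod (1 - rho ^ k) ^ 2 > 1 ^ 2" using that by auto
    then show ?thesis by (rule power2_less_imp_less) simp
  qed
  have "1 - l \<noteq> rho ^ k" if "k = 1 \<or> k = 2" for k
  proof
    assume "1 - l = rho ^ k"
    then have "l = 1 - rho ^ k" by (simp add: algebra_simps)
    then show False using far[OF that] l by simp
  qed
  from this[of 1] this[of 2] show "1 - l \<noteq> rho" "1 - l \<noteq> rho ^ 2" by simp_all
qed

text \<open>The \<open>u\<close>-coordinate of the lift of the loop about \<open>1\<close> from the point \<open>\<zeta>\<^sup>n b\<close>.  Since \<open>\<sigma>\<close> rotates the sphere by \<open>\<rho>\<^sup>2\<close>,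
  the same path in the next chart lifts the loop about \<open>\<rho>\<^sup>2\<close>.\<close>

definition loop_param :: "real \<Rightarrow> nat \<Rightarrow> real \<Rightarrow> complex" where
  "loop_param r n u = zeta ^ n * (radial_root r u * exp (Ln (1 / shift (radial r u)) / 7))"

lemma loop_param:
  assumes r: "0 < r" "r < 1"
  shows "continuous_on {0..1} (loop_param r n)"
    and "u \<in> {0..1} \<Longrightarrow> loop_param r n u \<in> slit_domain"
    and "u \<in> {0..1} \<Longrightarrow> loop_param r n u \<noteq> 0"
    and "u \<in> {0..1} \<Longrightarrow> loop_param r n u ^ 7 = radial r u / shift (radial r u)"
    and "loop_param r n 0 = zeta ^ n * base_pt" "loop_param r n 1 = zeta ^ (n + 6) * base_pt"
proof -
  have sh: "Im (shift (radial r u)) < 0" if "u \<in> {0..1}" for u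
    using shift_facts(1) radial_bounds[OF r that] by blast
  have shnz: "shift (radial r u) \<noteq> 0" if "u \<in> {0..1}" for u using sh[OF that] by auto
  have nonpos: "1 / shift (radial r u) \<notin> \<real>\<^sub>\<le>\<^sub>0" if "u \<in> {0..1}" for u
  proof -
    have "Im (1 / shift (radial r u)) \<noteq> 0" using sh[OF that] by (simp add: Im_divide sum_power2_eq_zero_iff)
    then show ?thesis by (auto simp: complex_nonpos_Reals_iff)
  qed
  have "continuous_on {0..1} (\<lambda>u. radial_root r u ^ 7)"
    by (intro continuous_intros radial_root(1) r)
  then have cr: "continuous_on {0..1} (radial r)"
    by (rule continuous_on_eq) (simp add: radial_root(2)[OF r])
  show "continuous_on {0..1} (loop_param r n)"
  proof -
    have "continuous_on {0..1} (\<lambda>u. shift (radial r u))"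
      unfolding shift_def by (intro continuous_intros cr)
    then have "continuous_on {0..1} (\<lambda>u. Ln (1 / shift (radial r u)))"
      using shnz by (intro continuous_on_Ln' continuous_on_divide continuous_on_const nonpos) auto
    then show ?thesis
      unfolding loop_param_def
      by (intro continuous_on_mult continuous_on_const continuous_on_exp continuous_on_divide radial_root(1) r) auto
  qed
  have p7: "loop_param r n u ^ 7 = radial r u / shift (radial r u)" if u: "u \<in> {0..1}" for u
    unfolding loop_param_def zeta_mult_power unfolding power_mult_distrib exp_div_7_power
    using u shnz[OF u] by (simp add: exp_Ln radial_root(2)[OF r u])
  show "u \<in> {0..1} \<Longrightarrow> loop_param r n u ^ 7 = radial r u / shift (radial r u)" by (rule p7)
  show "loop_param r n u \<noteq> 0" if u: "u \<in> {0..1}"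
  proof
    assume "loop_param r n u = 0"
    then have "radial r u / shift (radial r u) = 0" using p7[OF u] by simp
    then show False using shnz[OF u] radial_bounds(1)[OF r u] by simp
  qed
  show "loop_param r n u \<in> slit_domain" if u: "u \<in> {0..1}"
    unfolding slit_domain_def using p7[OF u] shift_facts(3)[OF radial_bounds[OF r u]] by simp
  have ends: "radial r 0 = 1" "radial r 1 = 1"
    by (simp_all add: radial_def joinpaths_def linepath_def)
  have "1 / shift 1 = exp (\<i> * of_real (pi / 3))"
  proof -
    have s: "shift 1 = Complex (1 / 2) (- (sqrt 3 / 2))"
      unfolding shift_def rho_square by (simp add: rho_eq complex_eq_iff)
    have "exp (\<i> * of_real (pi / 3)) = Complex (1 / 2) (sqrt 3 / 2)"
      unfolding cis_conv_exp[symmetric] by (simp add: complex_eq_iff cos_60 sin_60)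
    moreover have "Complex (1 / 2) (sqrt 3 / 2) * shift 1 = 1"
      unfolding s by (simp add: complex_eq_iff)
    ultimately show ?thesis by (metis eq_divide_imp mult_zero_right zero_neq_one)
  qed
  then have "Ln (1 / shift 1) = \<i> * of_real (pi / 3)"
    using pi_gt_zero by (simp only:) (intro Ln_exp, simp_all)
  then have "exp (Ln (1 / shift 1) / 7) = exp (\<i> * of_real (pi / 3) / 7)" by (simp only:)
  then have "exp (Ln (1 / shift 1) / 7) = base_pt"
    by (simp add: base_pt_def mult.commute)
  then show "loop_param r n 0 = zeta ^ n * base_pt" "loop_param r n 1 = zeta ^ (n + 6) * base_pt"
    by (simp_all add: loop_param_def ends radial_root(3,4)[OF r] power_add)
qed

lemma chart_vec_components_nonzero: "u \<noteq> 0 \<Longrightarrow> chart_vec u $ k \<noteq> 0"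
  using exhaust_3[of k] by (auto simp only: chart_vec_nth) auto

lemma clockwise_loop_avoids:
  assumes r: "0 < r" "r < 1" and u: "u \<in> {0..1}" and p: "p = 1 \<or> p = rho ^ 2"
  shows "clockwise_loop r p u \<notin> {1, rho, rho ^ 2}"
proof -
  define l where "l = radial r u"
  note b = shift_facts(4-6)[OF radial_bounds[OF r u], folded l_def]
  have r3: "rho ^ 2 * rho = 1" using rho_cube by (simp add: power_numeral_reduce mult_ac)
  then have r4: "rho ^ 2 * rho ^ 2 = rho" by (simp add: power2_eq_square mult_ac)
  have r2: "rho ^ 2 \<noteq> 0" by simp
  have "rho ^ 2 * (1 - l) \<noteq> rho ^ 2 * rho" "rho ^ 2 * (1 - l) \<noteq> rho ^ 2 * rho ^ 2" "rho ^ 2 * (1 - l) \<noteq> rho ^ 2 * 1"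
    using b unfolding mult_left_cancel[OF r2] by auto
  then show ?thesis using p b r3 r4 unfolding clockwise_loop_radial l_def[symmetric] by auto
qed

lemma loop_param_fibre:
  assumes r: "0 < r" "r < 1" and u: "u \<in> {0..1}"
  shows "chart 0 (loop_param r n u) \<in> klein_fibre (clockwise_loop r 1 u)"
    and "chart 1 (loop_param r n u) \<in> klein_fibre (clockwise_loop r (rho ^ 2) u)"
proof -
  define v l where "v = loop_param r n u" and "l = radial r u"
  note b = shift_facts[OF radial_bounds[OF r u], folded l_def]
  have v: "v \<in> slit_domain" "v \<noteq> 0" "v ^ 7 = l / shift l"
    unfolding v_def l_def using loop_param[OF r] u by auto
  have fib: "fibre_eq (chart_vec v) (1 - l)"
  proof (rule fibre_eqI_t)
    show "v ^ 7 * (1 - rho * (1 - l)) = rho ^ 2 * ((1 - l) - 1)" unfolding v(3) by (rule b)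
    show "klein_form (chart_vec v) = 0" using v(1) by (rule klein_form_chart_vec)
    show "chart_vec v $ 3 ^ 2 * chart_vec v $ 1 = - (v ^ 7) * chart_vec v $ 2 ^ 3"
      unfolding chart_vec_nth by (simp add: power_numeral_reduce)
  qed
  have nz: "chart_vec v $ k \<noteq> 0" for k using v(2) by (rule chart_vec_components_nonzero)
  have cl: "clockwise_loop r p u = p * (1 - l)" for p by (simp add: clockwise_loop_radial l_def)
  note form = klein_form_chart_vec[OF v(1)]
  show "chart 0 (loop_param r n u) \<in> klein_fibre (clockwise_loop r 1 u)"
    using form nz clockwise_loop_avoids[OF r u, of 1] fib
    by (auto simp: chart_def v_def[symmetric] cl intro!: hpt_in_klein_fibre)
  have "rot 1 (chart_vec v) $ k \<noteq> 0" for k using nz by simp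
  then show "chart 1 (loop_param r n u) \<in> klein_fibre (clockwise_loop r (rho ^ 2) u)"
    using form clockwise_loop_avoids[OF r u, of "rho ^ 2"] fibre_eq_rot[OF fib]
    unfolding chart_def v_def[symmetric] cl by (intro hpt_in_klein_fibre) (simp_all only: klein_form_rot, auto)
qed

lemma base_path_avoids:
  assumes r: "0 < r" "r < 1" and u: "u \<in> {0..1}"
  shows "base_path r u \<notin> {1, rho, rho ^ 2}"
proof -
  have join: "(p +++ q) u \<notin> S"
    if "\<And>u. u \<in> {0..1} \<Longrightarrow> p u \<notin> S" "\<And>u. u \<in> {0..1} \<Longrightarrow> q u \<notin> S" "u \<in> {0..1}"
    for p q :: "real \<Rightarrow> complex" and u S
  proof (cases "u \<le> 1 / 2")
    case True
    then show ?thesis using that(1)[of "2 * u"] that(3) by (simp add: joinpaths_def)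
  next
    case False
    then show ?thesis using that(2)[of "2 * u - 1"] that(3) by (simp add: joinpaths_def)
  qed
  note a1 = clockwise_loop_avoids[OF r _ disjI1[OF refl]] and a2 = clockwise_loop_avoids[OF r _ disjI2[OF refl]]
  show ?thesis
    unfolding base_path_def by (rule join[OF a1 join[OF a1 join[OF a1 a2]] u])
qed

section \<open>The sheets over z = 0\<close>

lemma base_pt_power_7: "base_pt ^ 7 = - (rho ^ 2)"
proof -
  have "base_pt ^ 7 = exp (of_nat 7 * (of_real pi * \<i> / 21))"
    unfolding base_pt_def exp_of_nat_mult ..
  also have "of_nat 7 * (of_real pi * \<i> / 21) = \<i> * of_real (pi / 3)" by (simp add: field_simps)
  finally show ?thesis
    unfolding rho_square cis_conv_exp[symmetric] by (simp add: rho_eq complex_eq_iff cos_60 sin_60)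
qed

lemma base_pt_nonzero [simp]: "base_pt \<noteq> 0"
  by (simp add: base_pt_def)

lemma croot_sheet: "croot (zeta ^ n * base_pt) = 1 / base_pt"
  using arc_ends(3) unfolding zeta_mult_croot by (simp add: field_simps)

lemma sheet_slit: "zeta ^ n * base_pt \<in> slit_domain"
  using arc_ends(5) by simp

text \<open>Here \<open>s = w = exp (\<pi> i (6 k - 1) / 21)\<close> and \<open>u c\<^sup>2 = \<zeta>\<^sup>k b \<cdot> b\<^sup>-\<^sup>2\<close> agree.\<close>

lemma sheet_chart: "sheet k = chart 0 (zeta ^ k * base_pt)"
proof -
  define u c where "u = zeta ^ k * base_pt" and "c = croot u"
  have c: "c = 1 / base_pt" unfolding c_def u_def by (rule croot_sheet)
  have sl: "u \<in> slit_domain" unfolding u_def by (rule sheet_slit)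
  have nz: "u \<noteq> 0" "c \<noteq> 0" by (simp_all add: u_def c_def)
  have u7: "u ^ 7 = - (rho ^ 2)" unfolding u_def zeta_mult_power by (rule base_pt_power_7)
  define s where "s = exp (of_real pi * \<i> * (6 * of_nat k - 1) / 21)"
  have "zeta ^ k * base_pt * base_pt = s * base_pt * base_pt * base_pt"
  proof -
    have "zeta ^ k = exp (of_nat k * (2 * of_real pi * \<i> / 7))" unfolding zeta_def exp_of_nat_mult ..
    also have "of_nat k * (2 * of_real pi * \<i> / 7) = of_real pi * \<i> * (6 * of_nat k - 1) / 21 + of_real pi * \<i> / 21"
      by (simp add: field_simps)
    finally show ?thesis unfolding s_def base_pt_def exp_add by simp
  qed
  then have "zeta ^ k * base_pt = s * base_pt * base_pt" by simp
  then have s: "s = u * c ^ 2"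
    unfolding u_def c by (simp add: power2_eq_square)
  have t: "1 - u ^ 7 = c ^ 7" using croot_power[OF sl] by (simp add: c_def)
  have "sheet k = hpt (vector [(u ^ 7 - 1) / s ^ 2, (1 - u ^ 7) / s ^ 3, 1])"
    unfolding sheet_def klein_pt_def Let_def s_def[symmetric] u7 by simp
  also have "vector [(u ^ 7 - 1) / s ^ 2, (1 - u ^ 7) / s ^ 3, 1] = (1 / u ^ 3) *s chart_vec u"
  proof -
    have "(u ^ 7 - 1) / s ^ 2 = (1 / u ^ 3) * (- u * c ^ 3)"
    proof -
      have e: "u ^ 7 - 1 = - (c ^ 7)" using t by (simp add: algebra_simps)
      show ?thesis unfolding s e using nz by (simp add: field_simps power_numeral_reduce)
    qed
    moreover have "(1 - u ^ 7) / s ^ 3 = (1 / u ^ 3) * c"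
      unfolding s t using nz by (simp add: field_simps power_numeral_reduce)
    moreover have "1 = (1 / u ^ 3) * u ^ 3" using nz by simp
    ultimately show ?thesis
      unfolding vec_eq_iff forall_3 vector_smult_component vector_3 chart_vec_nth c_def by simp
  qed
  also have "hpt \<dots> = hpt (chart_vec u)" using nz by (intro hpt_eqI) simp
  finally show ?thesis by (simp add: chart_def u_def)
qed

text \<open>All coordinates are powers of \<open>b\<close>, because \<open>\<zeta> = b\<^sup>6\<close>; the two vectors agree up to the factor \<open>b\<^sup>1\<^sup>8\<^sup>n\<^sup>+\<^sup>4\<close> by
  \<open>b\<^sup>2\<^sup>1 = - 1\<close>.\<close>

lemma rotated_sheet: "chart 1 (zeta ^ n * base_pt) = chart 0 (zeta ^ (4 * n + 3) * base_pt)"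
proof -
  define b where "b = base_pt"
  have b21: "b ^ 21 = - 1"
  proof -
    have "(b ^ 7) ^ 3 = - ((rho ^ 3) ^ 2)" unfolding b_def base_pt_power_7 by (simp add: power_numeral_reduce)
    then show ?thesis by (simp add: rho_cube flip: power_mult)
  qed
  have zb: "zeta ^ m = b ^ (6 * m)" for m
    by (simp add: zeta_base_pt b_def power_mult)
  have b0: "b \<noteq> 0" by (simp add: b_def)
  let ?m = "4 * n + 3"
  have cr: "croot (zeta ^ m * b) = 1 / b" for m unfolding b_def by (rule croot_sheet)
  have z7: "b ^ (42 * m) = 1" for m
  proof -
    have "b ^ (42 * m) = ((b ^ 21) ^ 2) ^ m" by (simp flip: power_mult)
    then show ?thesis by (simp add: b21)
  qed
  have "(b ^ (18 * n + 4)) *s chart_vec (zeta ^ ?m * b) = rot 1 (chart_vec (zeta ^ n * b))"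
  proof -
    have "b ^ (18 * n + 4) * chart_vec (zeta ^ ?m * b) $ 1 = chart_vec (zeta ^ n * b) $ 2"
    proof -
      have "b ^ (18 * n + 4) * (b ^ (6 * ?m) * b) = b ^ (42 * n) * (b ^ 21 * b ^ 2)"
      proof -
        have "b ^ (18 * n + 4) * (b ^ (6 * ?m) * b) = b ^ (18 * n + 4 + (6 * ?m + 1))"
          by (simp only: power_add power_one_right)
        also have "18 * n + 4 + (6 * ?m + 1) = 42 * n + (21 + 2)" by simp
        finally show ?thesis by (simp only: power_add)
      qed
      then have "b ^ (18 * n + 4) * (b ^ (6 * ?m) * b) = - (b ^ 2)" by (simp add: z7 b21)
      moreover have "p * (- X * Y) = - (p * X) * Y" for p X Y :: complex by simp
      ultimately have "b ^ (18 * n + 4) * (- (b ^ (6 * ?m) * b) * (1 / b) ^ 3) = b ^ 2 * (1 / b) ^ 3"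
        by (simp only: minus_minus)
      also have "\<dots> = 1 / b" using b0 by (simp add: field_simps power_numeral_reduce)
      finally show ?thesis unfolding chart_vec_nth cr unfolding zb by simp
    qed
    moreover have "b ^ (18 * n + 4) * chart_vec (zeta ^ ?m * b) $ 2 = chart_vec (zeta ^ n * b) $ 3"
    proof -
      have "b ^ (18 * n + 4) * (1 / b) = b ^ (18 * n + 3)"
        using b0 by (simp add: power_add power_numeral_reduce)
      also have "\<dots> = (b ^ (6 * n) * b) ^ 3" 
        by (simp add: power_mult_distrib power_add flip: power_mult)
      finally show ?thesis unfolding chart_vec_nth cr unfolding zb .
    qed
    moreover have "b ^ (18 * n + 4) * chart_vec (zeta ^ ?m * b) $ 3 = chart_vec (zeta ^ n * b) $ 1"
    proof -
      have "b ^ 3 * (b ^ (18 * n + 4) * (b ^ (6 * ?m) * b) ^ 3) = b ^ (3 + (18 * n + 4 + (6 * ?m + 1) * 3))"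
        by (simp only: power_add power_mult power_one_right)
      also have "3 + (18 * n + 4 + (6 * ?m + 1) * 3) = 42 * (2 * n + 1) + 21 + (6 * n + 1)" by simp
      also have "b ^ \<dots> = - (b ^ (6 * n) * b)" by (simp only: power_add z7 b21) simp
      finally have "b ^ (18 * n + 4) * (b ^ (6 * ?m) * b) ^ 3 = - (b ^ (6 * n) * b) * (1 / b) ^ 3"
        using b0 by (simp add: field_simps)
      then show ?thesis unfolding chart_vec_nth cr unfolding zb .
    qed
    ultimately show ?thesis
      unfolding vec_eq_iff forall_3 vector_smult_component rot_nth by simp
  qed
  then show ?thesis
    unfolding chart_def b_def[symmetric] using b0 hpt_eqI[of "b ^ (18 * n + 4)" "chart_vec (zeta ^ ?m * b)"] by simp
qed

section \<open>Integrals along the lifts\<close>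

text \<open>The image under \<open>\<sigma>\<^sup>i\<close> of the lift of the base path from sheet \<open>k\<close>.  Three clockwise turns about \<open>1\<close> lead to
  sheet \<open>k + 18\<close>, the same as \<open>k + 4\<close>.  In the next chart this is the point \<open>\<zeta>\<^sup>m b\<close> with \<open>4 m + 3 = k + 4\<close> modulo 7,
  that is, \<open>m = 2 k + 2\<close>.\<close>

definition lift_path :: "real \<Rightarrow> 3 \<Rightarrow> nat \<Rightarrow> real \<Rightarrow> ppoint" where
  "lift_path r i k = glue (chart i \<circ> loop_param r k) (glue (chart i \<circ> loop_param r (k + 6))
     (glue (chart i \<circ> loop_param r (k + 12)) (chart (i + 1) \<circ> loop_param r (2 * k + 2))))"

lemma glue_ends [simp]: "glue \<gamma> \<delta> 0 = \<gamma> 0" "glue \<gamma> \<delta> 1 = \<delta> 1"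
  by (simp_all add: glue_def)

lemma compose_glue: "f \<circ> glue \<gamma> \<delta> = glue (f \<circ> \<gamma>) (f \<circ> \<delta>)"
  by (auto simp: glue_def)

lemma klein_sigma_chart: "klein_sigma \<circ> (chart i \<circ> c) = chart (i + 1) \<circ> c"
  by (rule ext) (simp add: chart_def klein_sigma_hpt rot_rot add.commute)

lemma klein_sigma_lift_path: "klein_sigma \<circ> lift_path r i k = lift_path r (i + 1) k"
  unfolding lift_path_def compose_glue klein_sigma_chart ..

lemma zeta_shift: "m mod 7 = n mod 7 \<Longrightarrow> zeta ^ m = zeta ^ n"
  by (metis zeta_power_mod)

lemma chart_piece_integral:
  assumes r: "0 < r" "r < 1"
  shows "pathin klein_top (chart i \<circ> loop_param r n)"
    and "has_path_integral (klein_diff j) (chart i \<circ> loop_param r n)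
      (prim (j + i) (zeta ^ (n + 6) * base_pt) - prim (j + i) (zeta ^ n * base_pt))"
proof -
  have der: "(prim (j + i) has_field_derivative klein_diff j slit_domain (chart i) u) (at u)" if "u \<in> slit_domain" for u
    using prim(1)[OF that, of "j + i"] unfolding klein_diff_chart[OF that] .
  have im: "loop_param r n ` {0..1} \<subseteq> slit_domain" using loop_param(2)[OF r] by auto
  show "pathin klein_top (chart i \<circ> loop_param r n)"
    by (rule has_path_integral_klein_param(1)[OF klein_diff_in_holomorphic_differentials klein_param_chart der loop_param(1)[OF r] im])
  show "has_path_integral (klein_diff j) (chart i \<circ> loop_param r n)
      (prim (j + i) (zeta ^ (n + 6) * base_pt) - prim (j + i) (zeta ^ n * base_pt))"
    using has_path_integral_klein_param(2)[OF klein_diff_in_holomorphic_differentials klein_param_chart der loop_param(1)[OF r] im]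
    unfolding loop_param(5,6)[OF r] .
qed

text \<open>The sum of the increments \<open>G\<^sub>j(\<zeta>\<^sup>k\<^sup>+\<^sup>1\<^sup>8 b) - G\<^sub>j(\<zeta>\<^sup>k b)\<close> over the first three loops and
  \<open>G\<^sub>j\<^sub>+\<^sub>1(\<zeta>\<^sup>2\<^sup>k\<^sup>+\<^sup>8 b) - G\<^sub>j\<^sub>+\<^sub>1(\<zeta>\<^sup>2\<^sup>k\<^sup>+\<^sup>2 b)\<close> over the last, where \<open>\<sigma>\<close> turns \<open>\<eta>\<^sub>j\<close> into \<open>\<eta>\<^sub>j\<^sub>+\<^sub>1\<close>.\<close>

definition lift_integral :: "3 \<Rightarrow> nat \<Rightarrow> complex" where
  "lift_integral j k = (zeta ^ ((k + 18) * weight j) - zeta ^ (k * weight j)) * prim j base_pt +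
     (zeta ^ ((2 * k + 8) * weight (j + 1)) - zeta ^ ((2 * k + 2) * weight (j + 1))) * prim (j + 1) base_pt"

lemma rotated_sheet_i: "chart (i + 1) (zeta ^ n * base_pt) = chart i (zeta ^ (4 * n + 3) * base_pt)"
proof -
  have "chart (1 + i) (zeta ^ n * base_pt) = hpt (rot i (rot 1 (chart_vec (zeta ^ n * base_pt))))"
    by (simp add: chart_def rot_rot add.commute)
  also have "\<dots> = hpt (rot i (chart_vec (zeta ^ (4 * n + 3) * base_pt)))"
    using rotated_sheet[of n] by (intro hpt_rot_cong) (simp add: chart_def)
  finally show ?thesis by (simp add: chart_def add.commute)
qed

lemma lift_path_integral:
  assumes r: "0 < r" "r < 1"
  shows "pathin klein_top (lift_path r i k)" "lift_path r i k 0 = chart i (zeta ^ k * base_pt)"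
    "lift_path r i k 1 = lift_path r i k 0"
    "has_path_integral (klein_diff j) (lift_path r i k) (lift_integral (j + i) k)"
proof -
  let ?a = "\<lambda>n. chart i \<circ> loop_param r n" and ?b = "chart (i + 1) \<circ> loop_param r (2 * k + 2)"
  note pa = chart_piece_integral[OF r]
  have ends: "?a n 0 = chart i (zeta ^ n * base_pt)" "?a n 1 = chart i (zeta ^ (n + 6) * base_pt)" for n
    by (simp_all add: loop_param(5,6)[OF r])
  have "zeta ^ (4 * (2 * k + 2) + 3) = zeta ^ (k + 18)"
  proof (rule zeta_shift)
    have "(4 * (2 * k + 2) + 3) mod 7 = (k + 4 + 7 * (k + 1)) mod 7" by (simp add: algebra_simps)
    moreover have "(k + 18) mod 7 = (k + 4 + 7 * 2) mod 7" by (simp add: algebra_simps)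
    ultimately show "(4 * (2 * k + 2) + 3) mod 7 = (k + 18) mod 7" by (simp only: mod_mult_self2)
  qed
  then have b0: "?b 0 = chart i (zeta ^ (k + 18) * base_pt)"
    unfolding o_def loop_param(5)[OF r] rotated_sheet_i by simp
  have "zeta ^ (4 * (2 * k + 8) + 3) = zeta ^ k"
  proof (rule zeta_shift)
    have "(4 * (2 * k + 8) + 3) mod 7 = (k + 7 * (k + 5)) mod 7" by (simp add: algebra_simps)
    then show "(4 * (2 * k + 8) + 3) mod 7 = k mod 7" by (simp only: mod_mult_self2)
  qed
  then have b1: "?b 1 = chart i (zeta ^ k * base_pt)"
    unfolding o_def loop_param(6)[OF r] rotated_sheet_i by (simp add: add.commute add.left_commute)
  have e12: "?a (k + 12) 1 = ?b 0" unfolding b0 ends by (simp add: add.assoc)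
  have e6: "?a (k + 6) 1 = glue (?a (k + 12)) ?b 0" unfolding glue_ends ends by (simp add: add.assoc)
  have e0: "?a k 1 = glue (?a (k + 6)) (glue (?a (k + 12)) ?b) 0" unfolding glue_ends ends ..
  note p12 = pathin_glue[OF pa(1) pa(1) e12]
  note p6 = pathin_glue[OF pa(1) p12 e6]
  note p0 = pathin_glue[OF pa(1) p6 e0]
  note i12 = has_path_integral_glue[OF pa pa e12]
  note i6 = has_path_integral_glue[OF pa p12 i12 e6]
  note i0 = has_path_integral_glue[OF pa p6 i6 e0]
  show "pathin klein_top (lift_path r i k)" unfolding lift_path_def by (rule p0)
  show "lift_path r i k 0 = chart i (zeta ^ k * base_pt)" "lift_path r i k 1 = lift_path r i k 0"
    using ends(1)[of k] b1 by (simp_all add: lift_path_def)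
  have num: "k + 6 + 6 = k + 12" "k + 12 + 6 = k + 18" "2 * k + 2 + 6 = 2 * k + 8" "j + (i + 1) = j + i + 1"
    by (simp_all add: add.assoc)
  show "has_path_integral (klein_diff j) (lift_path r i k) (lift_integral (j + i) k)"
  proof -
    let ?x = "\<lambda>j n. prim j (zeta ^ n * base_pt)"
    have "has_path_integral (klein_diff j) (lift_path r i k)
        (?x (j + i) (k + 6) - ?x (j + i) k + (?x (j + i) (k + 6 + 6) - ?x (j + i) (k + 6) +
         (?x (j + i) (k + 12 + 6) - ?x (j + i) (k + 12) + (?x (j + (i + 1)) (2 * k + 2 + 6) - ?x (j + (i + 1)) (2 * k + 2)))))"
      unfolding lift_path_def by (rule i0)
    also have "(?x (j + i) (k + 6) - ?x (j + i) k + (?x (j + i) (k + 6 + 6) - ?x (j + i) (k + 6) +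
         (?x (j + i) (k + 12 + 6) - ?x (j + i) (k + 12) + (?x (j + (i + 1)) (2 * k + 2 + 6) - ?x (j + (i + 1)) (2 * k + 2))))) =
         (?x (j + i) (k + 18) - ?x (j + i) k) + (?x (j + i + 1) (2 * k + 8) - ?x (j + i + 1) (2 * k + 2))"
      unfolding num by simp
    also have "\<dots> = lift_integral (j + i) k"
      unfolding prim_zeta[OF arc_ends(5)] lift_integral_def by (simp only: left_diff_distrib)
    finally show ?thesis .
  qed
qed

lemma is_lift_lift_path:
  assumes r: "0 < r" "r < 1"
  shows "is_lift (base_path r) k (lift_path r 0 k)"
proof -
  have join: "glue \<gamma> \<delta> u \<in> klein_fibre ((p +++ q) u)"
    if "\<And>u. u \<in> {0..1} \<Longrightarrow> \<gamma> u \<in> klein_fibre (p u)" "\<And>u. u \<in> {0..1} \<Longrightarrow> \<delta> u \<in> klein_fibre (q u)" "u \<in> {0..1}"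
    for \<gamma> \<delta> p q u
    using that by (auto simp: glue_def joinpaths_def)
  have "lift_path r 0 k u \<in> klein_fibre (base_path r u)" if "u \<in> {0..1}" for u
    unfolding lift_path_def base_path_def
    by (intro join that) (simp_all add: loop_param_fibre[OF r])
  then show ?thesis
    using lift_path_integral(1,2)[OF r, of 0 k] by (simp add: is_lift_def sheet_chart)
qed

lemma lift_class_eq:
  assumes r: "0 < r" "r < 1"
  shows "lift_class r k = loop_class (lift_path r 0 k)"
proof -
  have "is_lift (base_path r) k (SOME \<gamma>. is_lift (base_path r) k \<gamma>)"
    by (rule someI[of _ "lift_path r 0 k"]) (rule is_lift_lift_path[OF r])
  then show ?thesis
    unfolding lift_class_def
    using lift_unique[OF _ is_lift_lift_path[OF r] base_path_avoids[OF r]] by (intro loop_class_cong) blast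
qed

lemma sigma_star_lift_path:
  assumes r: "0 < r" "r < 1"
  shows "sigma_star (loop_class (lift_path r i k)) = loop_class (lift_path r (i + 1) k)"
  using sigma_star_loop_class[OF lift_path_integral(1)[OF r]] lift_path_integral(3)[OF r]
  by (simp add: klein_sigma_lift_path)

lemma sigma_orbit_lift_class:
  assumes r: "0 < r" "r < 1"
  shows "sigma_orbit (lift_class r k) i = loop_class (lift_path r (i - 1) k)"
  using exhaust_3[of i] sigma_star_lift_path[OF r, of 0 k] sigma_star_lift_path[OF r, of 1 k]
  by (auto simp: sigma_orbit_def lift_class_eq[OF r])

section \<open>The period matrix\<close>

text \<open>Rewrite rules that reduce polynomials in \<open>z\<close> modulo \<open>z\<^sup>7 = 1\<close>, once powers are written as nested products.\<close>

lemma seventh_root_reduce: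
  fixes z :: complex
  assumes "z ^ 7 = 1"
  shows "z * (z * (z * (z * (z * (z * z))))) = 1" "z * (z * (z * (z * (z * (z * (z * x)))))) = x"
proof -
  show 1: "z * (z * (z * (z * (z * (z * z))))) = 1" using assms by (simp add: power_numeral_reduce)
  have "z * (z * (z * (z * (z * (z * (z * x)))))) = (z * (z * (z * (z * (z * (z * z)))))) * x"
    by (simp only: mult.assoc)
  then show "z * (z * (z * (z * (z * (z * (z * x)))))) = x" by (simp only: 1 mult_1_left)
qed

lemma zeta_neq_1: "zeta \<noteq> 1"
proof
  assume "zeta = 1"
  have "zeta = cis (2 * pi / 7)" by (simp add: zeta_def cis_conv_exp mult_ac)
  then have "sin (2 * pi / 7) = 0" using \<open>zeta = 1\<close> by (simp add: complex_eq_iff)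
  moreover have "sin (2 * pi / 7) > 0" using pi_gt_zero by (intro sin_gt_zero) auto
  ultimately show False by simp
qed

lemma zeta_sum: "1 + zeta + zeta ^ 2 + zeta ^ 3 + zeta ^ 4 + zeta ^ 5 + zeta ^ 6 = 0"
proof -
  have "(zeta - 1) * (1 + zeta + zeta ^ 2 + zeta ^ 3 + zeta ^ 4 + zeta ^ 5 + zeta ^ 6) = zeta ^ 7 - 1"
    by (simp add: algebra_simps power_numeral_reduce)
  then show ?thesis using zeta_neq_1 by (simp add: zeta_power_7)
qed

text \<open>The sum over the quadratic residues \<open>1, 2, 4\<close> is a root of \<open>f\<^sup>2 + f + 2\<close>; its imaginary part is positive.\<close>

lemma gauss_period: "(-1 + \<i> * of_real (sqrt 7)) / 2 = zeta + zeta ^ 2 + zeta ^ 4"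
proof -
  define f where "f = zeta + zeta ^ 2 + zeta ^ 4"
  note red = seventh_root_reduce[OF zeta_power_7]
  \<comment> \<open>The square of \<open>2 f + 1\<close> is reduced modulo the seventh cyclotomic polynomial.\<close>
  have "zeta ^ 6 = - (1 + zeta + zeta ^ 2 + zeta ^ 3 + zeta ^ 4 + zeta ^ 5)"
    using zeta_sum by (simp add: eq_neg_iff_add_eq_0 algebra_simps)
  then have s: "zeta * (zeta * (zeta * (zeta * (zeta * zeta)))) = - (1 + zeta + zeta ^ 2 + zeta ^ 3 + zeta ^ 4 + zeta ^ 5)"
    by (simp add: power_numeral_reduce)
  have "(2 * f + 1) ^ 2 = - 7"
    unfolding f_def by (simp add: algebra_simps power_numeral_reduce red s)
  also have "\<dots> = (\<i> * of_real (sqrt 7)) ^ 2"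
    by (simp add: power_mult_distrib flip: of_real_power)
  finally have "2 * f + 1 = \<i> * of_real (sqrt 7) \<or> 2 * f + 1 = - (\<i> * of_real (sqrt 7))"
    by (rule power2_eq_iff[THEN iffD1])
  moreover have "Im f > 0"
  proof -
    have cis: "zeta ^ n = cis (real n * (2 * pi / 7))" for n
      by (simp add: zeta_def cis_conv_exp mult_ac flip: exp_of_nat_mult)
    have "4 * (2 * pi / 7) = pi / 7 + pi" "2 * (2 * pi / 7) = pi - 3 * pi / 7" by simp_all
    then have "sin (4 * (2 * pi / 7)) = - sin (pi / 7)" "sin (2 * (2 * pi / 7)) = sin (3 * pi / 7)"
      by (simp_all only: sin_periodic_pi sin_pi_minus)
    then have "Im f = sin (2 * pi / 7) + sin (3 * pi / 7) - sin (pi / 7)"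
    proof -
      have "Im (zeta ^ 1) = sin (2 * pi / 7)" unfolding cis[of 1] by simp
      moreover have "Im (zeta ^ 2) = sin (2 * (2 * pi / 7))" unfolding cis[of 2] by simp
      moreover have "Im (zeta ^ 4) = sin (4 * (2 * pi / 7))" unfolding cis[of 4] by simp
      ultimately show ?thesis
        using \<open>sin (4 * (2 * pi / 7)) = - sin (pi / 7)\<close> \<open>sin (2 * (2 * pi / 7)) = sin (3 * pi / 7)\<close>
        by (simp only: f_def plus_complex.sel power_one_right)
    qed
    moreover have "sin (pi / 7) < sin (3 * pi / 7)"
    proof (rule sin_monotone_2pi)
      show "- (pi / 2) \<le> pi / 7" by (rule order_trans[of _ 0]) simp_all
      show "pi / 7 < 3 * pi / 7" "3 * pi / 7 \<le> pi / 2" by simp_all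
    qed
    moreover have "sin (2 * pi / 7) > 0" using pi_gt_zero by (intro sin_gt_zero) auto
    ultimately show ?thesis by linarith
  qed
  ultimately have "2 * f + 1 = \<i> * of_real (sqrt 7)"
  proof (elim disjE)
    assume "2 * f + 1 = - (\<i> * of_real (sqrt 7))"
    then have "Im (2 * f + 1) = - sqrt 7" by simp
    then have "2 * Im f = - sqrt 7" by simp
    then show ?thesis using \<open>Im f > 0\<close> by (smt (verit) real_sqrt_ge_zero)
  qed
  then have "(-1 + \<i> * of_real (sqrt 7)) / 2 = f" by (simp add: field_simps)
  then show ?thesis by (simp only: f_def)
qed

lemma zeta_reduce:
  "zeta ^ 18 = zeta ^ 4" "zeta ^ 36 = zeta" "zeta ^ 72 = zeta ^ 2" "zeta ^ 8 = zeta" "zeta ^ 32 = zeta ^ 4"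
  "zeta ^ 16 = zeta ^ 2" "zeta ^ 40 = zeta ^ 5" "zeta ^ 20 = zeta ^ 6" "zeta ^ 80 = zeta ^ 3" "zeta ^ 12 = zeta ^ 5"
  "zeta ^ 48 = zeta ^ 6" "zeta ^ 24 = zeta ^ 3" "zeta ^ 7 = 1"
  using zeta_power_mod[of 18] zeta_power_mod[of 36] zeta_power_mod[of 72] zeta_power_mod[of 8] zeta_power_mod[of 32]
    zeta_power_mod[of 16] zeta_power_mod[of 40] zeta_power_mod[of 20] zeta_power_mod[of 80] zeta_power_mod[of 12]
    zeta_power_mod[of 48] zeta_power_mod[of 24] zeta_power_7
  by simp_all

lemma lift_integrals:
  defines "x j \<equiv> prim j base_pt"
  shows "lift_integral 1 0 = (zeta - 1) * (x 1 - zeta * x 2)"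
    and "lift_integral 2 0 = (zeta ^ 4 - 1) * (x 2 - zeta ^ 4 * x 3)"
    and "lift_integral 3 0 = (zeta ^ 2 - 1) * (x 3 - zeta ^ 2 * x 1)"
    and "lift_integral 1 2 = zeta ^ 4 * lift_integral 1 0"
    and "lift_integral 2 2 = zeta ^ 2 * lift_integral 2 0"
    and "lift_integral 3 2 = zeta * lift_integral 3 0"
proof -
  note red = seventh_root_reduce[OF zeta_power_7]
  have L: "lift_integral 1 k = (zeta ^ ((k + 18) * 2) - zeta ^ (k * 2)) * x 1 + (zeta ^ (2 * k + 8) - zeta ^ (2 * k + 2)) * x 2"
    "lift_integral 2 k = (zeta ^ (k + 18) - zeta ^ k) * x 2 + (zeta ^ ((2 * k + 8) * 4) - zeta ^ ((2 * k + 2) * 4)) * x 3"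
    "lift_integral 3 k = (zeta ^ ((k + 18) * 4) - zeta ^ (k * 4)) * x 3 + (zeta ^ ((2 * k + 8) * 2) - zeta ^ ((2 * k + 2) * 2)) * x 1" for k
    by (simp_all add: lift_integral_def x_def)
  show "lift_integral 1 0 = (zeta - 1) * (x 1 - zeta * x 2)"
    "lift_integral 2 0 = (zeta ^ 4 - 1) * (x 2 - zeta ^ 4 * x 3)"
    "lift_integral 3 0 = (zeta ^ 2 - 1) * (x 3 - zeta ^ 2 * x 1)"
    "lift_integral 1 2 = zeta ^ 4 * lift_integral 1 0"
    "lift_integral 2 2 = zeta ^ 2 * lift_integral 2 0"
    "lift_integral 3 2 = zeta * lift_integral 3 0"
    unfolding L by (simp_all add: zeta_reduce) (simp_all add: algebra_simps power_numeral_reduce red)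
qed

text \<open>Solving one crossing relation after the other for the values \<open>y\<^sub>j\<close> over \<open>z = \<infinity>\<close> leads back to \<open>y\<^sub>1\<close>, with
  coefficient \<open>\<zeta>\<^sup>7 = 1\<close>; what remains is \<open>D\<^sub>1 + D\<^sub>2 + D\<^sub>3 = 0\<close>.  Together with the relation
  \<open>D\<^sub>1 + \<zeta> D\<^sub>2 + \<zeta>\<^sup>5 D\<^sub>3 = 0\<close>, which holds by definition, it makes \<open>(D\<^sub>1, D\<^sub>2, D\<^sub>3)\<close> a multiple of
  \<open>(\<zeta>\<^sup>5 - \<zeta>, 1 - \<zeta>\<^sup>5, \<zeta> - 1)\<close>.\<close>

lemma lift_integrals_proportional:
  obtains c where "c \<noteq> 0"
    "lift_integral 1 0 = c * (zeta - zeta ^ 2 - zeta ^ 5 + zeta ^ 6)"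
    "lift_integral 2 0 = c * (- 1 - zeta ^ 2 + zeta ^ 4 + zeta ^ 5)"
    "lift_integral 3 0 = c * (1 - zeta - zeta ^ 2 + zeta ^ 3)"
proof -
  define x y where "x j = prim j base_pt" and "y j = prim j (cnj base_pt)" for j
  define D1 D2 D3 where "D1 = x 1 - zeta * x 2" and "D2 = x 2 - zeta ^ 4 * x 3" and "D3 = x 3 - zeta ^ 2 * x 1"
  note red = seventh_root_reduce[OF zeta_power_7]
  have cr: "y 1 - x 1 = zeta ^ 5 * (zeta ^ 4 * y 3 - x 3)" "y 2 - x 2 = zeta ^ 6 * (zeta ^ 2 * y 1 - x 1)"
    "y 3 - x 3 = zeta ^ 3 * (zeta * y 2 - x 2)"
    using crossing_relation[of 1] crossing_relation[of 2] crossing_relation[of 3]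
    by (simp_all add: x_def y_def)
  have y1: "y 1 = x 1 + zeta ^ 5 * (zeta ^ 4 * y 3 - x 3)" and y2: "y 2 = x 2 + zeta ^ 6 * (zeta ^ 2 * y 1 - x 1)"
    and y3: "y 3 = x 3 + zeta ^ 3 * (zeta * y 2 - x 2)"
    using cr by (simp_all add: diff_eq_eq add.commute)
  have "y 1 = x 1 + zeta ^ 5 * (zeta ^ 4 * (x 3 + zeta ^ 3 * (zeta * (x 2 + zeta ^ 6 * (zeta ^ 2 * y 1 - x 1)) - x 2)) - x 3)"
    using y1 unfolding y3 y2 .
  also have "\<dots> = y 1 - zeta ^ 5 * (D1 + D2 + D3)"
    unfolding D1_def D2_def D3_def by (simp add: algebra_simps power_numeral_reduce red)
  finally have s1: "D1 + D2 + D3 = 0" by simp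
  have s2: "D1 + zeta * D2 + zeta ^ 5 * D3 = 0"
    unfolding D1_def D2_def D3_def by (simp add: algebra_simps power_numeral_reduce red)
  define c where "c = D3 / (zeta - 1)"
  have z1: "zeta - 1 \<noteq> 0" using zeta_neq_1 by simp
  have D3: "D3 = c * (zeta - 1)" using z1 by (simp add: c_def)
  have "(zeta - 1) * D1 = (zeta ^ 5 - zeta) * D3"
  proof -
    have "zeta * (D1 + D2 + D3) - (D1 + zeta * D2 + zeta ^ 5 * D3) = 0" unfolding s1 s2 by simp
    then show ?thesis by (simp add: algebra_simps)
  qed
  then have "(zeta - 1) * D1 = (zeta - 1) * (c * (zeta ^ 5 - zeta))" unfolding D3 by (simp add: mult_ac)
  then have D1: "D1 = c * (zeta ^ 5 - zeta)" using z1 by simp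
  have "D2 = - D1 - D3" using s1 by (simp add: eq_neg_iff_add_eq_0 algebra_simps)
  then have D2: "D2 = c * (1 - zeta ^ 5)" unfolding D1 D3 by (simp add: algebra_simps)
  have "D1 \<noteq> 0" using prim_1_2_distinct by (simp add: D1_def x_def)
  then have c: "c \<noteq> 0" unfolding D1 by auto
  have "lift_integral 1 0 = (zeta - 1) * D1" "lift_integral 2 0 = (zeta ^ 4 - 1) * D2" "lift_integral 3 0 = (zeta ^ 2 - 1) * D3"
    using lift_integrals(1-3) by (simp_all add: D1_def D2_def D3_def x_def)
  then show ?thesis
    using that[OF c] unfolding D1 D2 D3 by (simp add: algebra_simps power_numeral_reduce red)
qed

definition lift_periods :: "nat \<Rightarrow> complex ^ 3 ^ 3" where
  "lift_periods k = (\<chi> i j. lift_integral (j + (i - 1)) k)"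

lemma lift_periods_nth:
  "lift_periods k $ 1 $ j = lift_integral j k" "lift_periods k $ 2 $ j = lift_integral (j + 1) k"
  "lift_periods k $ 3 $ j = lift_integral (j + 2) k"
  by (simp_all add: lift_periods_def)

text \<open>The determinant is \<open>- 14 c\<^sup>3 n\<close>, and \<open>n\<close> times its complex conjugate is 14.\<close>

lemma invertible_lift_periods: "invertible (lift_periods 0)"
proof -
  obtain c where c: "c \<noteq> 0"
    "lift_integral 1 0 = c * (zeta - zeta ^ 2 - zeta ^ 5 + zeta ^ 6)"
    "lift_integral 2 0 = c * (- 1 - zeta ^ 2 + zeta ^ 4 + zeta ^ 5)"
    "lift_integral 3 0 = c * (1 - zeta - zeta ^ 2 + zeta ^ 3)"
    by (rule lift_integrals_proportional)
  note red = seventh_root_reduce[OF zeta_power_7]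
  define n where "n = 3 * zeta ^ 6 - zeta ^ 5 - zeta ^ 4 - zeta ^ 2"
  have "n * (3 * zeta - zeta ^ 2 - zeta ^ 3 - zeta ^ 5) = 14 - 2 * (1 + zeta + zeta ^ 2 + zeta ^ 3 + zeta ^ 4 + zeta ^ 5 + zeta ^ 6)"
    unfolding n_def by (simp add: algebra_simps power_numeral_reduce red)
  then have n: "n \<noteq> 0" unfolding zeta_sum by auto
  have "det (lift_periods 0) = - 14 * c ^ 3 * n"
    unfolding det_3 lift_periods_nth n_def
    by (simp add: c) (simp add: algebra_simps power_numeral_reduce red)
  then have "det (lift_periods 0) \<noteq> 0" using c(1) n by simp
  then show ?thesis by (simp add: invertible_det_nz)
qed

lemma lift_periods_2:
  assumes e: "e = (-1 + \<i> * of_real (sqrt 7)) / 2"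
  defines "\<tau> \<equiv> (1 / 2) *\<^sub>R vector [vector [e, 1, 1], vector [1, e, 1], vector [1, 1, e]] :: complex ^ 3 ^ 3"
  shows "lift_periods 2 = \<tau> ** lift_periods 0"
proof -
  obtain c where c: "c \<noteq> 0"
    "lift_integral 1 0 = c * (zeta - zeta ^ 2 - zeta ^ 5 + zeta ^ 6)"
    "lift_integral 2 0 = c * (- 1 - zeta ^ 2 + zeta ^ 4 + zeta ^ 5)"
    "lift_integral 3 0 = c * (1 - zeta - zeta ^ 2 + zeta ^ 3)"
    by (rule lift_integrals_proportional)
  note red = seventh_root_reduce[OF zeta_power_7]
  have ez: "e = zeta + zeta ^ 2 + zeta ^ 4" unfolding e by (rule gauss_period)
  have q: "lift_integral 1 2 = (1 / 2) * (e * lift_integral 1 0 + lift_integral 2 0 + lift_integral 3 0)"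
    "lift_integral 2 2 = (1 / 2) * (lift_integral 1 0 + e * lift_integral 2 0 + lift_integral 3 0)"
    "lift_integral 3 2 = (1 / 2) * (lift_integral 1 0 + lift_integral 2 0 + e * lift_integral 3 0)"
    unfolding lift_integrals(4-6) c(2-4) ez by (simp_all add: algebra_simps power_numeral_reduce red)
  have t: "\<tau> $ 1 $ 1 = e / 2" "\<tau> $ 1 $ 2 = 1 / 2" "\<tau> $ 1 $ 3 = 1 / 2"
    "\<tau> $ 2 $ 1 = 1 / 2" "\<tau> $ 2 $ 2 = e / 2" "\<tau> $ 2 $ 3 = 1 / 2"
    "\<tau> $ 3 $ 1 = 1 / 2" "\<tau> $ 3 $ 2 = 1 / 2" "\<tau> $ 3 $ 3 = e / 2"
    unfolding \<tau>_def vector_scaleR_component vector_3 by (simp_all add: scaleR_conv_of_real)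
  show ?thesis
    unfolding vec_eq_iff forall_3 matrix_matrix_mult_def vec_lambda_beta sum_3 t lift_periods_nth
    by (simp add: q)
qed

lemma matrix_inv_right:
  fixes A :: "complex ^ 3 ^ 3"
  assumes "invertible A"
  shows "A ** matrix_inv A = mat 1"
  using assms unfolding invertible_def matrix_inv_def by (rule someI2_ex) simp

lemma period_lift_class:
  assumes r: "0 < r" "r < 1" and \<omega>: "\<omega> \<in> holomorphic_differentials"
  shows "period \<omega> (sigma_orbit (lift_class r k) i) = path_integral \<omega> (lift_path r (i - 1) k)"
  unfolding sigma_orbit_lift_class[OF r] using \<omega> by (rule period_loop_class)

text \<open>Periods are linear in the differential, so expressing the \<open>\<eta>\<^sub>j\<close> by other differentials multiplies the
  period matrix on the right.\<close>

lemma period_entries_basis: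
  assumes r: "0 < r" "r < 1" and \<omega>: "\<And>j. \<omega> j \<in> holomorphic_differentials"
    and C: "\<And>j D \<phi> u. klein_diff j D \<phi> u = (\<Sum>k\<in>UNIV. C $ k $ j * \<omega> k D \<phi> u)"
  shows "lift_periods k = period_entries \<omega> (sigma_orbit (lift_class r k)) ** C"
  unfolding vec_eq_iff
proof (intro allI)
  fix i j
  let ?\<gamma> = "lift_path r (i - 1) k"
  have "has_path_integral (klein_diff j) ?\<gamma> (\<Sum>k\<in>UNIV. C $ k $ j * path_integral (\<omega> k) ?\<gamma>)"
    by (rule has_path_integral_linear_combination[OF C])
       (rule has_path_integral_path_integral[OF \<omega> lift_path_integral(1)[OF r]])
  then have "path_integral (klein_diff j) ?\<gamma> = (\<Sum>k\<in>UNIV. C $ k $ j * path_integral (\<omega> k) ?\<gamma>)"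
    by (rule path_integral_eqI[OF lift_path_integral(1)[OF r]])
  moreover have "path_integral (klein_diff j) ?\<gamma> = lift_integral (j + (i - 1)) k"
    by (rule path_integral_eqI[OF lift_path_integral(1,4)[OF r]])
  ultimately show "lift_periods k $ i $ j = (period_entries \<omega> (sigma_orbit (lift_class r k)) ** C) $ i $ j"
    by (simp add: lift_periods_def matrix_matrix_mult_def period_entries_def period_lift_class[OF r \<omega>] mult.commute)
qed

theorem theorem1:
  fixes \<omega> :: "3 \<Rightarrow> differential" and r :: real and e :: complex
  assumes "0 < r" and "r < 1"
    and "differential_basis \<omega>"
    and "e = (-1 + \<i> * of_real (sqrt 7)) / 2"
  shows "invertible (period_entries \<omega> (a_cycles r)) \<and>
         period_entries \<omega> (b_cycles r) ** matrix_inv (period_entries \<omega> (a_cycles r)) =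
           (1 / 2) *\<^sub>R vector [vector [e, 1, 1], vector [1, e, 1], vector [1, 1, e]]"
proof -
  let ?\<tau> = "(1 / 2) *\<^sub>R vector [vector [e, 1, 1], vector [1, e, 1], vector [1, 1, e]] :: complex ^ 3 ^ 3"
  let ?A = "period_entries \<omega> (a_cycles r)" and ?B = "period_entries \<omega> (b_cycles r)"
  note r = assms(1,2)
  have \<omega>: "\<omega> j \<in> holomorphic_differentials" for j
    using assms(3) by (simp add: differential_basis_def)
  have "\<forall>j. \<exists>c :: 3 \<Rightarrow> complex. \<forall>D \<phi> u. klein_diff j D \<phi> u = (\<Sum>k\<in>UNIV. c k * \<omega> k D \<phi> u)"
    using assms(3) klein_diff_in_holomorphic_differentials by (simp add: differential_basis_def)
  then obtain c :: "3 \<Rightarrow> 3 \<Rightarrow> complex" where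
    c: "\<And>j D \<phi> u. klein_diff j D \<phi> u = (\<Sum>k\<in>UNIV. c j k * \<omega> k D \<phi> u)" by metis
  define C :: "complex ^ 3 ^ 3" where "C = (\<chi> k j. c j k)"
  have C: "klein_diff j D \<phi> u = (\<Sum>k\<in>UNIV. C $ k $ j * \<omega> k D \<phi> u)" for j D \<phi> u
    by (simp add: C_def c)
  have A: "lift_periods 0 = ?A ** C" and B: "lift_periods 2 = ?B ** C"
    unfolding a_cycles_def b_cycles_def by (rule period_entries_basis[OF r \<omega> C])+
  have "det (?A ** C) \<noteq> 0"
    using invertible_lift_periods by (simp add: A invertible_det_nz)
  then have det: "det ?A \<noteq> 0" "det C \<noteq> 0" by (auto simp: det_mul)
  have invA: "invertible ?A" and invC: "invertible C" using det by (simp_all add: invertible_det_nz)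
  have "?B ** C = (?\<tau> ** ?A) ** C"
    using lift_periods_2[OF assms(4)] by (simp only: A B matrix_mul_assoc)
  then have "?B ** C ** matrix_inv C = ?\<tau> ** ?A ** C ** matrix_inv C" by simp
  then have BA: "?B = ?\<tau> ** ?A"
    by (simp only: matrix_mul_assoc[symmetric] matrix_inv_right[OF invC] matrix_mul_rid)
  have "?B ** matrix_inv ?A = ?\<tau>"
    unfolding BA by (simp only: matrix_mul_assoc[symmetric] matrix_inv_right[OF invA] matrix_mul_rid)
  with invA show ?thesis by blast
qed

end
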